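(* Let $Q:\mathbb{R}^{2\times2}\to\mathbb{R}$ be a homogeneous polynomial of degree $4$ (in the four matrix entries) such that $$Q(UFV^T)=Q(F)\qquad\text{for every }F\in\mathbb{R}^{2\times2}\text{ and all }U,V\in SO(2).$$ Then $Q$ is quasiconvex if and only if it is rank-one convex.
   Context: A continuous function $f:\mathbb{R}^{m\times n}\to\mathbb{R}$ (here $m=n=2$) is called quasiconvex if $$\int_U f(F+D\varphi)\,\mathrm{d}x\geq |U|\,f(F)$$ for every bounded Lipschitz domain $U\subset\mathbb{R}^n$, every $F\in\mathbb{R}^{m\times n}$, and every $\varphi\in W^{1,\infty}_0(U,\mathbb{R}^m)$. Here $|U|$ is the Lebesgue measure of $U$ and $D\varphi$ is the $m\times n$ Jacobian matrix, $(D\varphi)_{ij}=\partial_j\varphi_i$. A function $f:\mathbb{R}^{m\times n}\to\mathbb{R}$ is called rank-one convex if $$f\bigl((1-t)A+tB\bigr)\leq(1-t)f(A)+tf(B)$$ whenever $t\in[0,1]$, $A,B\in\mathbb{R}^{m\times n}$, and $\operatorname{rank}(A-B)\leq1$. *)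

theory Defs
  imports "HOL-Analysis.Analysis"
begin

subsection \<open>Smooth test functions\<close>

definition partial_derivative ::
    "'n::finite \<Rightarrow> (real^'n \<Rightarrow> 'b::real_normed_vector) \<Rightarrow> real^'n \<Rightarrow> 'b" where
  "partial_derivative j f x = frechet_derivative f (at x) (axis j 1)"

primrec k_times_continuously_differentiable ::
    "nat \<Rightarrow> (real^'n::finite \<Rightarrow> 'b::real_normed_vector) \<Rightarrow> bool" where
  "k_times_continuously_differentiable 0 f \<longleftrightarrow> continuous_on UNIV f"
| "k_times_continuously_differentiable (Suc k) f \<longleftrightarrow>
     (\<forall>x. f differentiable (at x)) \<and>
     (\<forall>j. k_times_continuously_differentiable k (partial_derivative j f))"

definition smooth :: "(real^'n::finite \<Rightarrow> 'b::real_normed_vector) \<Rightarrow> bool" where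
  "smooth f \<longleftrightarrow> (\<forall>k. k_times_continuously_differentiable k f)"

text \<open>Elements of \<open>C\<^sub>c\<^sup>\<infinity>(U)\<close>, extended by zero to the whole space.\<close>

definition test_function ::
    "(real^'n::finite) set \<Rightarrow> (real^'n \<Rightarrow> 'b::real_normed_vector) \<Rightarrow> bool" where
  "test_function U \<psi> \<longleftrightarrow> smooth \<psi> \<and> (\<exists>K. compact K \<and> K \<subseteq> U \<and> (\<forall>x. x \<notin> K \<longrightarrow> \<psi> x = 0))"

subsection \<open>Sobolev spaces\<close>

text \<open>Sobolev functions are represented by functions on the whole space of which only the
  almost everywhere values on \<open>U\<close> matter. A function is always accompanied by (a representative
  of) its weak Jacobian \<open>G\<close>, where \<open>G x $ i $ j\<close> is the weak \<open>j\<close>-th partial derivative of the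
  \<open>i\<close>-th component, as in the library constant \<open>jacobian\<close>.\<close>

definition locally_integrable_on ::
    "(real^'n::finite \<Rightarrow> 'b::euclidean_space) \<Rightarrow> (real^'n) set \<Rightarrow> bool" where
  "locally_integrable_on f U \<longleftrightarrow> (\<forall>K. compact K \<and> K \<subseteq> U \<longrightarrow> integrable (lebesgue_on K) f)"

definition has_weak_jacobian_on ::
    "(real^'n::finite \<Rightarrow> real^'m::finite) \<Rightarrow> (real^'n \<Rightarrow> real^'n^'m) \<Rightarrow> (real^'n) set \<Rightarrow> bool" where
  "has_weak_jacobian_on \<phi> G U \<longleftrightarrow>
     locally_integrable_on \<phi> U \<and> locally_integrable_on G U \<and>
     (\<forall>(\<psi>::real^'n \<Rightarrow> real) i j. test_function U \<psi> \<longrightarrow>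
        (\<integral>x. \<phi> x $ i * partial_derivative j \<psi> x \<partial>lebesgue_on U)
          = - (\<integral>x. G x $ i $ j * \<psi> x \<partial>lebesgue_on U))"

definition L_infinity_on ::
    "(real^'n::finite \<Rightarrow> 'b::euclidean_space) \<Rightarrow> (real^'n) set \<Rightarrow> bool" where
  "L_infinity_on f U \<longleftrightarrow>
     f \<in> borel_measurable (lebesgue_on U) \<and> (\<exists>C. AE x in lebesgue_on U. norm (f x) \<le> C)"

definition W_1_infinity ::
    "(real^'n::finite) set \<Rightarrow> (real^'n \<Rightarrow> real^'m::finite) \<Rightarrow> (real^'n \<Rightarrow> real^'n^'m) \<Rightarrow> bool" where
  "W_1_infinity U \<phi> G \<longleftrightarrow> has_weak_jacobian_on \<phi> G U \<and> L_infinity_on \<phi> U \<and> L_infinity_on G U"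

text \<open>\<open>W\<^sub>0\<^sup>1\<^sup>,\<^sup>1(U)\<close> is the closure of the test functions in the norm of \<open>W\<^sup>1\<^sup>,\<^sup>1(U)\<close>.\<close>

definition W_1_1_zero ::
    "(real^'n::finite) set \<Rightarrow> (real^'n \<Rightarrow> real^'m::finite) \<Rightarrow> (real^'n \<Rightarrow> real^'n^'m) \<Rightarrow> bool" where
  "W_1_1_zero U \<phi> G \<longleftrightarrow>
     has_weak_jacobian_on \<phi> G U \<and> integrable (lebesgue_on U) \<phi> \<and> integrable (lebesgue_on U) G \<and>
     (\<exists>\<psi>::nat \<Rightarrow> real^'n \<Rightarrow> real^'m. (\<forall>k. test_function U (\<psi> k)) \<and>
        (\<lambda>k. \<integral>\<^sup>+x. ennreal (norm (\<psi> k x - \<phi> x)) \<partial>lebesgue_on U) \<longlonglongrightarrow> 0 \<and>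
        (\<lambda>k. \<integral>\<^sup>+x. ennreal (norm (jacobian (\<psi> k) (at x) - G x)) \<partial>lebesgue_on U) \<longlonglongrightarrow> 0)"

text \<open>For bounded \<open>U\<close>, \<open>W\<^sub>0\<^sup>1\<^sup>,\<^sup>\<infinity>(U)\<close> is the space of functions in \<open>W\<^sup>1\<^sup>,\<^sup>\<infinity>(U)\<close> with zero boundary
  values, that is \<open>W\<^sup>1\<^sup>,\<^sup>\<infinity>(U) \<inter> W\<^sub>0\<^sup>1\<^sup>,\<^sup>1(U)\<close>. It is not the (smaller) closure of the test functions in
  the norm of \<open>W\<^sup>1\<^sup>,\<^sup>\<infinity>(U)\<close>.\<close>

definition W_1_infinity_zero ::
    "(real^'n::finite) set \<Rightarrow> (real^'n \<Rightarrow> real^'m::finite) \<Rightarrow> (real^'n \<Rightarrow> real^'n^'m) \<Rightarrow> bool" where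
  "W_1_infinity_zero U \<phi> G \<longleftrightarrow> W_1_infinity U \<phi> G \<and> W_1_1_zero U \<phi> G"

subsection \<open>Lipschitz domains\<close>

text \<open>Near each boundary point \<open>U\<close> is the strict epigraph, in some unit direction \<open>\<nu>\<close>, of a
  Lipschitz function \<open>g\<close> of the orthogonal projection \<open>y - (y \<bullet> \<nu>) *\<^sub>R \<nu>\<close> to the hyperplane
  normal to \<open>\<nu>\<close>. Only the restriction of \<open>g\<close> to that hyperplane is relevant.\<close>

definition bounded_lipschitz_domain :: "('a::euclidean_space) set \<Rightarrow> bool" where
  "bounded_lipschitz_domain U \<longleftrightarrow>
     open U \<and> connected U \<and> U \<noteq> {} \<and> bounded U \<and>
     (\<forall>p \<in> frontier U. \<exists>r>0. \<exists>\<nu>. norm \<nu> = 1 \<and>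
        (\<exists>(g::'a \<Rightarrow> real) L. L-lipschitz_on UNIV g \<and>
           U \<inter> ball p r = {y \<in> ball p r. y \<bullet> \<nu> > g (y - (y \<bullet> \<nu>) *\<^sub>R \<nu>)}))"

subsection \<open>Convexity notions and homogeneous polynomials\<close>

definition quasiconvex :: "(real^'n::finite^'m::finite \<Rightarrow> real) \<Rightarrow> bool" where
  "quasiconvex f \<longleftrightarrow> continuous_on UNIV f \<and>
     (\<forall>U F \<phi> G. bounded_lipschitz_domain U \<longrightarrow> W_1_infinity_zero U \<phi> G \<longrightarrow>
        (\<integral>x. f (F + G x) \<partial>lebesgue_on U) \<ge> measure lebesgue U * f F)"

definition rank_one_convex :: "(real^'n::finite^'m::finite \<Rightarrow> real) \<Rightarrow> bool" where
  "rank_one_convex f \<longleftrightarrow>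
     (\<forall>t A B. 0 \<le> t \<longrightarrow> t \<le> 1 \<longrightarrow> rank (A - B) \<le> 1 \<longrightarrow>
        f ((1 - t) *\<^sub>R A + t *\<^sub>R B) \<le> (1 - t) * f A + t * f B)"

text \<open>The sum runs over the (finitely many) multi-indices \<open>\<alpha>\<close> of total degree \<open>d\<close>; the zero
  polynomial counts as homogeneous of every degree.\<close>

definition homogeneous_polynomial :: "nat \<Rightarrow> (real^'n::finite^'m::finite \<Rightarrow> real) \<Rightarrow> bool" where
  "homogeneous_polynomial d Q \<longleftrightarrow>
     (\<exists>c :: ('m \<times> 'n \<Rightarrow> nat) \<Rightarrow> real. \<forall>F.
        Q F = (\<Sum>\<alpha> | (\<Sum>p\<in>UNIV. \<alpha> p) = d. c \<alpha> * (\<Prod>(i,j)\<in>UNIV. F $ i $ j ^ \<alpha> (i,j))))"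

lemma finite_multi_indices: "finite {\<alpha> :: 'a::finite \<Rightarrow> nat. (\<Sum>p\<in>UNIV. \<alpha> p) = d}"
proof (rule finite_subset)
  show "{\<alpha> :: 'a \<Rightarrow> nat. (\<Sum>p\<in>UNIV. \<alpha> p) = d} \<subseteq> (\<Pi>\<^sub>E p\<in>UNIV. {..d})"
    by (auto simp: PiE_def intro: member_le_sum)
qed (intro finite_PiE; simp)

end

theory Submission
  imports Defs
begin

text \<open>
  A real \<open>2 \<times> 2\<close> matrix \<open>F\<close> acts on the complex plane as \<open>h \<mapsto> z h + w cnj h\<close>. In the coordinates
  \<open>(z, w)\<close> a pair of rotations multiplies \<open>z\<close> and \<open>w\<close> by independent phases, hence
  \<open>Q = \<alpha> |z|\<^sup>4 + \<beta> |z|\<^sup>2 |w|\<^sup>2 + \<gamma> |w|\<^sup>4\<close> (\<open>biinvariant_quartic\<close>). Moreover \<open>det F = |z|\<^sup>2 - |w|\<^sup>2\<close>, so the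
  matrices of rank at most one are those with \<open>|z| = |w|\<close>, and rank-one convexity is nonnegativity of
  the second variation in these directions. It forces
  \<open>2\<alpha> + \<beta>, 2\<gamma> + \<beta>, 6\<alpha> + \<beta>, 6\<gamma> + \<beta> \<ge> 0\<close> and \<open>4\<beta>\<^sup>2 \<le> (6\<alpha> + \<beta>) (6\<gamma> + \<beta>)\<close>
  (\<open>quartic_coefficient_conditions\<close>). The cone described by these inequalities is generated by \<open>|z|\<^sup>4\<close>,
  \<open>|w|\<^sup>4\<close>, \<open>(det F)\<^sup>2\<close> and the curve \<open>Q\<^sub>s = (2s - 1) |z|\<^sup>4 + 6 |z|\<^sup>2 |w|\<^sup>2 + (2/s - 1) |w|\<^sup>4\<close>, \<open>s > 0\<close>; it
  suffices that each generator is quasiconvex.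

  The square of the determinant is quasiconvex by Jensen's inequality, the determinant being a null
  Lagrangian. For the other generators let the map follow the heat flow. For a periodic map the
  gradient converges to its mean \<open>F\<close>, so it is enough that the energy \<open>\<integral> Q(z, w)\<close> decreases along
  the flow. After integration by parts its derivative is minus the integral of a form that is
  quadratic in the second derivatives \<open>A = \<partial>\<partial>\<phi>\<close>, \<open>B = \<partial>\<partial>\<^sup>*\<phi>\<close>, \<open>C = \<partial>\<^sup>*\<partial>\<^sup>*\<phi>\<close> (where \<open>\<partial>\<close> and \<open>\<partial>\<^sup>*\<close> are
  the two Wirtinger derivatives) and quadratic in \<open>(z, w)\<close>. This form is not unique: divergences of
  the type \<open>\<partial>(c B) - \<partial>\<^sup>*(c A)\<close> and \<open>\<partial>(c C) - \<partial>\<^sup>*(c B)\<close>, with \<open>c\<close> cubic in \<open>(z, w)\<close>, contain no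
  third derivatives and may be added. The crux is that for \<open>Q\<^sub>s\<close> a suitable choice of these null
  Lagrangians makes the form nonnegative pointwise (\<open>real_dissipation_nonneg\<close>,
  \<open>dissipation_nonneg_extremal\<close>), although it is not nonnegative for an arbitrary choice.

  The flow is run on trigonometric polynomials, where differentiation and integration are algebraic
  operations on coefficients (\<open>periodic_quasiconvex\<close>). A function in \<open>W\<^sub>0\<^sup>1\<^sup>,\<^sup>\<infinity>(U)\<close> is extended by zero to a
  large period box and convolved with a nonnegative trigonometric kernel. The gradients stay bounded and
  converge in \<open>L\<^sup>1\<close>, so the inequality passes to the limit (\<open>quartic_quasiconvex_inequality\<close>).

  Conversely, a quasiconvex \<open>Q\<close> is tested on the unit ball with \<open>\<chi>(x) sin(N b \<bullet> x) a\<close> and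
  \<open>\<chi>(x) cos(N b \<bullet> x) a\<close>. When the second variations along the two maps are added, all cross terms
  cancel, and letting \<open>N\<close> grow isolates the second variation in the direction \<open>a \<otimes> b\<close>
  (\<open>quasiconvex_imp_second_variation_nonneg\<close>).
\<close>

section \<open>Biinvariant quartics in conformal coordinates\<close>

text \<open>With \<open>\<real>\<^sup>2\<close> identified with the complex plane, \<open>F h = z h + w cnj h\<close> for the conformal part \<open>z\<close> and
  the anticonformal part \<open>w\<close>. For a gradient \<open>F = D\<phi>\<close> they are the Wirtinger derivatives \<open>\<partial>\<phi>\<close> and
  \<open>\<partial>\<^sup>*\<phi>\<close>.\<close>

definition conformal_part :: "real^2^2 \<Rightarrow> complex" where
  "conformal_part F = Complex ((F$1$1 + F$2$2)/2) ((F$2$1 - F$1$2)/2)"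

definition anticonformal_part :: "real^2^2 \<Rightarrow> complex" where
  "anticonformal_part F = Complex ((F$1$1 - F$2$2)/2) ((F$2$1 + F$1$2)/2)"

definition of_parts :: "complex \<Rightarrow> complex \<Rightarrow> real^2^2" where
  "of_parts z w = vector [vector [Re z + Re w, Im w - Im z], vector [Im w + Im z, Re z - Re w]]"

definition quartic :: "real \<Rightarrow> real \<Rightarrow> real \<Rightarrow> complex \<Rightarrow> complex \<Rightarrow> real" where
  "quartic \<alpha> \<beta> \<gamma> z w = \<alpha> * (norm z)^4 + \<beta> * (norm z)^2 * (norm w)^2 + \<gamma> * (norm w)^4"

lemma quartic_combination:
  "quartic (a * \<alpha> + b * \<alpha>') (a * \<beta> + b * \<beta>') (a * \<gamma> + b * \<gamma>') z w
    = a * quartic \<alpha> \<beta> \<gamma> z w + b * quartic \<alpha>' \<beta>' \<gamma>' z w"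
  by (simp add: quartic_def algebra_simps)

lemma parts_of_parts [simp]:
  "conformal_part (of_parts z w) = z" "anticonformal_part (of_parts z w) = w"
  by (simp_all add: conformal_part_def anticonformal_part_def of_parts_def complex_eq_iff)

lemma of_parts_parts [simp]: "of_parts (conformal_part F) (anticonformal_part F) = F"
  by (simp add: conformal_part_def anticonformal_part_def of_parts_def vec_eq_iff forall_2 field_simps)

lemma linear_parts: "linear conformal_part" "linear anticonformal_part"
  by (auto intro!: linearI simp: conformal_part_def anticonformal_part_def complex_eq_iff field_simps)

lemma det_eq_parts: "det F = (norm (conformal_part F))^2 - (norm (anticonformal_part F))^2"
  unfolding cmod_power2 conformal_part_def anticonformal_part_def det_2
  by (simp add: power2_eq_square field_simps)

definition rotation2 :: "real \<Rightarrow> real^2^2" where "rotation2 t = of_parts (cis t) 0"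

lemma rotation_matrix_rotation2: "rotation_matrix (rotation2 t)"
  by (simp add: rotation_matrix_def orthogonal_matrix_def rotation2_def of_parts_def det_2
      matrix_matrix_mult_def transpose_def mat_def vec_eq_iff forall_2 sum_2
      flip: power2_eq_square)

text \<open>The two phases \<open>g - h\<close> and \<open>g + h\<close> can be prescribed independently; this is what makes the
  invariants of the action so few.\<close>

lemma parts_rotation2:
  "conformal_part (rotation2 g ** F ** transpose (rotation2 h)) = cis (g - h) * conformal_part F"
  "anticonformal_part (rotation2 g ** F ** transpose (rotation2 h)) = cis (g + h) * anticonformal_part F"
  by (simp_all add: conformal_part_def anticonformal_part_def rotation2_def of_parts_def complex_eq_iff
      matrix_matrix_mult_def transpose_def sum_2 cos_diff sin_diff cos_add sin_add algebra_simps add_divide_distrib diff_divide_distrib)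

text \<open>On diagonal matrices only the monomials without off-diagonal factors survive, since \<open>0 ^ k = 0\<close> for
  \<open>k > 0\<close>.\<close>

lemma diagonal_homogeneous_polynomial:
  fixes Q :: "real^2^2 \<Rightarrow> real"
  assumes "homogeneous_polynomial d Q"
  shows "\<exists>k. \<forall>a b. Q (vector [vector [a, 0], vector [0, b]]) = (\<Sum>i\<le>d. k i * a^i * b^(d-i))"
proof -
  define P :: "(real \<Rightarrow> real \<Rightarrow> real) \<Rightarrow> bool"
    where "P f \<longleftrightarrow> (\<exists>k. \<forall>a b. f a b = (\<Sum>i\<le>d. k i * a^i * b^(d-i)))" for f
  have P0: "P (\<lambda>a b. 0)" unfolding P_def by (intro exI[of _ "\<lambda>_. 0"]) simp
  have Padd: "P (\<lambda>a b. f a b + g a b)" if fg: "P f" "P g" for f g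
  proof -
    obtain k l where "\<And>a b. f a b = (\<Sum>i\<le>d. k i * a^i * b^(d-i))" "\<And>a b. g a b = (\<Sum>i\<le>d. l i * a^i * b^(d-i))"
      using fg unfolding P_def by blast
    then show ?thesis unfolding P_def
      by (intro exI[of _ "\<lambda>i. k i + l i"]) (simp add: sum.distrib algebra_simps)
  qed
  have Psum: "P (\<lambda>a b. \<Sum>x\<in>A. f x a b)" if "finite A" "\<And>x. x \<in> A \<Longrightarrow> P (f x)" for A :: "(2 \<times> 2 \<Rightarrow> nat) set" and f
    using that by (induction A rule: finite_induct) (auto intro: P0 Padd)
  obtain c where c: "\<And>F. Q F = (\<Sum>\<alpha> | (\<Sum>p\<in>UNIV. \<alpha> p) = d. c \<alpha> * (\<Prod>(i,j)\<in>UNIV. F $ i $ j ^ \<alpha> (i,j)))"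
    using assms unfolding homogeneous_polynomial_def by blast
  have U: "(UNIV :: (2\<times>2) set) = {(1,1),(1,2),(2,1),(2,2::2)}"
    unfolding UNIV_Times_UNIV[symmetric] UNIV_2 by auto
  have "P (\<lambda>a b. Q (vector [vector [a, 0], vector [0, b]]))"
    unfolding c
  proof (rule Psum[OF finite_multi_indices, where f="\<lambda>\<alpha> a b. c \<alpha> *
      (\<Prod>(i,j)\<in>UNIV. (vector [vector [a, 0], vector [0, b]] :: real^2^2) $ i $ j ^ \<alpha> (i,j))"])
    fix \<alpha> :: "2 \<times> 2 \<Rightarrow> nat" assume "\<alpha> \<in> {\<alpha>. (\<Sum>p\<in>UNIV. \<alpha> p) = d}"
    then have s: "\<alpha> (1,1) + \<alpha> (1,2) + \<alpha> (2,1) + \<alpha> (2,2) = d" by (simp add: U)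
    have *: "(\<Prod>(i,j)\<in>UNIV. (vector [vector [a, 0], vector [0, b]] :: real^2^2) $ i $ j ^ \<alpha> (i,j))
      = a ^ \<alpha> (1,1) * (0 ^ \<alpha> (1,2) * 0 ^ \<alpha> (2,1)) * b ^ \<alpha> (2,2)" for a b
      by (simp add: U)
    define e :: real where "e = c \<alpha> * (0 ^ \<alpha> (1,2) * 0 ^ \<alpha> (2,1))"
    have e: "e = 0 \<or> \<alpha> (2,2) = d - \<alpha> (1,1)"
      using s by (cases "\<alpha> (1,2)"; cases "\<alpha> (2,1)") (auto simp: e_def)
    show "P (\<lambda>a b. c \<alpha> * (\<Prod>(i,j)\<in>UNIV. (vector [vector [a, 0], vector [0, b]] :: real^2^2) $ i $ j ^ \<alpha> (i,j)))"
      unfolding P_def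
    proof (intro exI[of _ "\<lambda>i. if i = \<alpha> (1,1) then e else 0"] allI)
      fix a b :: real
      have "(\<Sum>i\<le>d. (if i = \<alpha> (1,1) then e else 0) * a^i * b^(d-i))
         = (\<Sum>i\<le>d. if i = \<alpha> (1,1) then e * a^i * b^(d-i) else 0)"
        by (intro sum.cong) auto
      also have "\<dots> = e * a^\<alpha> (1,1) * b^(d-\<alpha> (1,1))" using s by simp
      also have "\<dots> = e * a^\<alpha> (1,1) * b^\<alpha> (2,2)" using e by auto
      finally show "c \<alpha> * (\<Prod>(i,j)\<in>UNIV. (vector [vector [a, 0], vector [0, b]] :: real^2^2) $ i $ j ^ \<alpha> (i,j))
        = (\<Sum>i\<le>d. (if i = \<alpha> (1,1) then e else 0) * a^i * b^(d-i))"
        unfolding * e_def by simp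
    qed
  qed
  then show ?thesis unfolding P_def .
qed

text \<open>Rotations make \<open>z\<close> and \<open>w\<close> real and nonnegative, which leaves a diagonal matrix and hence a binary
  quartic in \<open>|z|\<close> and \<open>|w|\<close>. The sign change \<open>z \<mapsto> -z\<close> is also a rotation and removes the two terms
  of odd degree in \<open>|z|\<close>.\<close>

lemma biinvariant_quartic:
  fixes Q :: "real^2^2 \<Rightarrow> real"
  assumes "homogeneous_polynomial 4 Q"
    and inv: "\<And>F U V. rotation_matrix U \<Longrightarrow> rotation_matrix V \<Longrightarrow> Q (U ** F ** transpose V) = Q F"
  obtains \<alpha> \<beta> \<gamma> where "\<And>F. Q F = quartic \<alpha> \<beta> \<gamma> (conformal_part F) (anticonformal_part F)"
proof -
  define q where "q z w = Q (of_parts z w)" for z w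
  have Qq: "Q F = q (conformal_part F) (anticonformal_part F)" for F by (simp add: q_def)
  have phase: "q (cis (g - h) * z) (cis (g + h) * w) = q z w" for g h z w
  proof -
    have "Q (rotation2 g ** of_parts z w ** transpose (rotation2 h)) = Q (of_parts z w)"
      by (intro inv rotation_matrix_rotation2)
    then show ?thesis by (simp add: Qq parts_rotation2)
  qed
  have reduce: "q z w = q (of_real (norm z)) (of_real (norm w))" for z w
  proof -
    define g h where "g = - (Arg z + Arg w)/2" and "h = (Arg z - Arg w)/2"
    have "g - h = - Arg z" "g + h = - Arg w" by (auto simp: g_def h_def field_simps)
    moreover have "cis (- Arg z) * z = of_real (norm z)" for z
    proof -
      have "cis (- Arg z) * z = cis (- Arg z) * (of_real (norm z) * cis (Arg z))"
        using rcis_cmod_Arg[of z] by (simp add: rcis_def)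
      also have "\<dots> = of_real (norm z)" by (simp add: cis_mult mult.left_commute)
      finally show ?thesis .
    qed
    ultimately show ?thesis using phase[of g h z w] by simp
  qed
  obtain k where k: "\<And>a b. Q (vector [vector [a, 0], vector [0, b]]) = (\<Sum>i\<le>4. k i * a^i * b^(4-i))"
    using diagonal_homogeneous_polynomial[OF assms(1)] by blast
  have qk: "q (of_real x) (of_real y) = (\<Sum>i\<le>4. k i * (x+y)^i * (x-y)^(4-i))" for x y
    unfolding k[symmetric] q_def by (rule arg_cong[of _ _ Q]) (simp add: of_parts_def)
  define c0 c1 c2 c3 c4 where
    "c0 = k 0 + k 1 + k 2 + k 3 + k 4"
    and "c1 = - 4*k 0 - 2*k 1 + 2*k 3 + 4*k 4"
    and "c2 = 6*k 0 - 2*k 2 + 6*k 4"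
    and "c3 = - 4*k 0 + 2*k 1 - 2*k 3 + 4*k 4"
    and "c4 = k 0 - k 1 + k 2 - k 3 + k 4"
  have qc: "q (of_real x) (of_real y) = c0*x^4 + c1*x^3*y + c2*x^2*y^2 + c3*x*y^3 + c4*y^4" for x y
  proof -
    have "q (of_real x) (of_real y) = k 0*(x-y)^4 + k 1*(x+y)*(x-y)^3 + k 2*(x+y)^2*(x-y)^2 + k 3*(x+y)^3*(x-y) + k 4*(x+y)^4"
      unfolding qk by (simp add: numeral_eq_Suc)
    then show ?thesis unfolding c0_def c1_def c2_def c3_def c4_def by algebra
  qed
  have "q (of_real (-x)) (of_real y) = q (of_real x) (of_real y)" for x y
    using reduce[of "of_real (-x)" "of_real y"] reduce[of "of_real x" "of_real y"] by simp
  (* Two values of y already determine that both odd coefficients vanish. *)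
  from this[of 1 1] this[of 1 2] have c13: "c1 + c3 = 0" "2*c1 + 8*c3 = 0" unfolding qc by simp_all
  then have "c1 = 0" "c3 = 0" by linarith+
  then have "Q F = quartic c0 c2 c4 (conformal_part F) (anticonformal_part F)" for F
    unfolding Qq quartic_def by (subst reduce, subst qc) simp
  then show ?thesis using that by blast
qed

section \<open>Rank-one convexity as conditions on the coefficients\<close>

text \<open>The coefficient of \<open>t\<^sup>2\<close> in \<open>quartic \<alpha> \<beta> \<gamma> (z + t \<zeta>) (w + t \<omega>)\<close>, that is, half of the second
  derivative at \<open>t = 0\<close> along the line.\<close>

definition second_variation :: "real \<Rightarrow> real \<Rightarrow> real \<Rightarrow> complex \<Rightarrow> complex \<Rightarrow> complex \<Rightarrow> complex \<Rightarrow> real" where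
  "second_variation \<alpha> \<beta> \<gamma> z w \<zeta> \<omega> =
     \<alpha> * (4 * (z \<bullet> \<zeta>)\<^sup>2 + 2 * (norm z)\<^sup>2 * (norm \<zeta>)\<^sup>2)
   + \<beta> * (4 * (z \<bullet> \<zeta>) * (w \<bullet> \<omega>) + (norm z)\<^sup>2 * (norm \<omega>)\<^sup>2 + (norm w)\<^sup>2 * (norm \<zeta>)\<^sup>2)
   + \<gamma> * (4 * (w \<bullet> \<omega>)\<^sup>2 + 2 * (norm w)\<^sup>2 * (norm \<omega>)\<^sup>2)"

lemma norm_squared_line:
  fixes z \<zeta> :: "'a::real_inner"
  shows "(norm (z + t *\<^sub>R \<zeta>))\<^sup>2 = (norm z)\<^sup>2 + 2 * t * (z \<bullet> \<zeta>) + t\<^sup>2 * (norm \<zeta>)\<^sup>2"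
  unfolding power2_norm_eq_inner inner_add_left inner_add_right inner_scaleR_left inner_scaleR_right
  unfolding inner_commute[of \<zeta> z] by algebra

lemma quartic_eq_squares: "quartic \<alpha> \<beta> \<gamma> z w = \<alpha> * ((norm z)\<^sup>2)\<^sup>2 + \<beta> * (norm z)\<^sup>2 * (norm w)\<^sup>2 + \<gamma> * ((norm w)\<^sup>2)\<^sup>2"
  by (simp add: quartic_def flip: power_mult)

text \<open>The symmetric difference removes the odd orders in \<open>t\<close>, so that convexity along a line and
  quasiconvexity both turn into statements about the second variation.\<close>

lemma quartic_symmetric_difference:
  "quartic \<alpha> \<beta> \<gamma> (z + t *\<^sub>R \<zeta>) (w + t *\<^sub>R \<omega>) + quartic \<alpha> \<beta> \<gamma> (z - t *\<^sub>R \<zeta>) (w - t *\<^sub>R \<omega>)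
   = 2 * quartic \<alpha> \<beta> \<gamma> z w + 2 * t\<^sup>2 * second_variation \<alpha> \<beta> \<gamma> z w \<zeta> \<omega> + 2 * t^4 * quartic \<alpha> \<beta> \<gamma> \<zeta> \<omega>"
proof -
  have minus: "(norm (z - t *\<^sub>R \<zeta>))\<^sup>2 = (norm z)\<^sup>2 - 2 * t * (z \<bullet> \<zeta>) + t\<^sup>2 * (norm \<zeta>)\<^sup>2" for z \<zeta> :: complex
    using norm_squared_line[of z "-t" \<zeta>] by simp
  show ?thesis unfolding quartic_eq_squares norm_squared_line minus second_variation_def
    by algebra
qed

lemma nonneg_of_perturbation:
  fixes a b :: real
  assumes "\<And>t. t > 0 \<Longrightarrow> 0 \<le> t\<^sup>2 * a + t^4 * b"
  shows "0 \<le> a"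
proof -
  have "((\<lambda>t. a + t\<^sup>2 * b) \<longlongrightarrow> a + 0\<^sup>2 * b) (at_right 0)" by (intro tendsto_intros)
  moreover have "eventually (\<lambda>t. 0 \<le> a + t\<^sup>2 * b) (at_right 0)"
    unfolding eventually_at_right_field
  proof (intro exI[of _ 1] conjI allI impI)
    fix t :: real assume t: "0 < t" "t < 1"
    have "t\<^sup>2 * a + t^4 * b = t\<^sup>2 * (a + t\<^sup>2 * b)" by algebra
    with assms[OF t(1)] have "0 \<le> t\<^sup>2 * (a + t\<^sup>2 * b)" by simp
    then show "0 \<le> a + t\<^sup>2 * b" using t by (simp add: zero_le_mult_iff)
  qed simp
  ultimately have "0 \<le> a + 0\<^sup>2 * b" by (rule tendsto_lowerbound) simp
  then show ?thesis by simp
qed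

text \<open>The four linear conditions are the second variation at a pure \<open>z\<close> or a pure \<open>w\<close>, with direction
  parallel or orthogonal to it. Parallel directions at a general real pair \<open>(x, y)\<close> give a binary
  quadratic form, whose discriminant is the last condition.\<close>

lemma quartic_coefficient_conditions:
  assumes sv: "\<And>z w \<zeta> \<omega>. norm \<zeta> = norm \<omega> \<Longrightarrow> 0 \<le> second_variation \<alpha> \<beta> \<gamma> z w \<zeta> \<omega>"
  shows "2*\<alpha> + \<beta> \<ge> 0" "2*\<gamma> + \<beta> \<ge> 0" "6*\<alpha> + \<beta> \<ge> 0" "6*\<gamma> + \<beta> \<ge> 0"
    "4*\<beta>\<^sup>2 \<le> (6*\<alpha> + \<beta>) * (6*\<gamma> + \<beta>)"
proof -
  show "2*\<alpha> + \<beta> \<ge> 0" using sv[of \<i> 1 1 0] by (simp add: second_variation_def inner_complex_def)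
  show "2*\<gamma> + \<beta> \<ge> 0" using sv[of 1 \<i> 0 1] by (simp add: second_variation_def inner_complex_def)
  show u: "6*\<alpha> + \<beta> \<ge> 0" using sv[of 1 1 1 0] by (simp add: second_variation_def inner_complex_def)
  show v: "6*\<gamma> + \<beta> \<ge> 0" using sv[of 1 1 0 1] by (simp add: second_variation_def inner_complex_def)
  define u v where "u = 6*\<alpha> + \<beta>" and "v = 6*\<gamma> + \<beta>"
  have form: "0 \<le> u * x\<^sup>2 + 4 * \<beta> * x * y + v * y\<^sup>2" for x y
    using sv[of 1 1 "of_real x" "of_real y"]
    by (simp add: second_variation_def inner_complex_def u_def v_def algebra_simps power2_eq_square)
  show "4*\<beta>\<^sup>2 \<le> (6*\<alpha> + \<beta>) * (6*\<gamma> + \<beta>)"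
  proof (cases "u = 0")
    case True
    have "\<beta> = 0"
    proof (rule ccontr)
      assume b: "\<beta> \<noteq> 0"
      have "0 \<le> 4 * \<beta> * (- (v + 1) / (4 * \<beta>)) * 1 + v" using form[of "- (v + 1) / (4 * \<beta>)" 1] True by simp
      then show False using b by simp
    qed
    then show ?thesis using True by (simp add: u_def)
  next
    case False
    then have u0: "u > 0" using u by (simp add: u_def)
    have "0 \<le> u * (- 2 * \<beta>)\<^sup>2 + 4 * \<beta> * (- 2 * \<beta>) * u + v * u\<^sup>2" by (rule form)
    also have "\<dots> = u * (u * v - 4*\<beta>\<^sup>2)" by algebra
    finally have "0 \<le> u * v - 4*\<beta>\<^sup>2" using u0 by (simp add: zero_le_mult_iff)
    then show ?thesis by (simp add: u_def v_def)
  qed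
qed

lemma rank_le_1_iff_parts:
  "rank (A :: real^2^2) \<le> 1 \<longleftrightarrow> norm (conformal_part A) = norm (anticonformal_part A)"
proof -
  have "rank A \<le> 1 \<longleftrightarrow> det A = 0" using det_eq_0_rank[of A] by auto
  also have "\<dots> \<longleftrightarrow> norm (conformal_part A) = norm (anticonformal_part A)"
    unfolding det_eq_parts by (simp add: power2_eq_iff_nonneg)
  finally show ?thesis .
qed

text \<open>One direction is midpoint convexity on a short segment, the other the second derivative test on the
  line through \<open>A\<close> and \<open>B\<close>.\<close>

lemma rank_one_convex_quartic_iff:
  fixes Q :: "real^2^2 \<Rightarrow> real"
  assumes Q: "\<And>F. Q F = quartic \<alpha> \<beta> \<gamma> (conformal_part F) (anticonformal_part F)"
  shows "rank_one_convex Q \<longleftrightarrow> (\<forall>z w \<zeta> \<omega>. norm \<zeta> = norm \<omega> \<longrightarrow> 0 \<le> second_variation \<alpha> \<beta> \<gamma> z w \<zeta> \<omega>)"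
proof
  note lin = linear_parts[THEN linear_add] linear_parts[THEN linear_diff] linear_parts[THEN linear_scale]
  assume rc: "rank_one_convex Q"
  show "\<forall>z w \<zeta> \<omega>. norm \<zeta> = norm \<omega> \<longrightarrow> 0 \<le> second_variation \<alpha> \<beta> \<gamma> z w \<zeta> \<omega>"
  proof (intro allI impI)
    fix z w \<zeta> \<omega> :: complex assume n: "norm \<zeta> = norm \<omega>"
    show "0 \<le> second_variation \<alpha> \<beta> \<gamma> z w \<zeta> \<omega>"
    proof (rule nonneg_of_perturbation)
      fix t :: real assume "t > 0"
      define A B where "A = of_parts (z + t *\<^sub>R \<zeta>) (w + t *\<^sub>R \<omega>)" and "B = of_parts (z - t *\<^sub>R \<zeta>) (w - t *\<^sub>R \<omega>)"
      have "conformal_part (A - B) = (2 * t) *\<^sub>R \<zeta>" "anticonformal_part (A - B) = (2 * t) *\<^sub>R \<omega>"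
        by (simp_all add: A_def B_def lin scaleR_conv_of_real algebra_simps)
      then have "rank (A - B) \<le> 1" unfolding rank_le_1_iff_parts using n by simp
      then have "Q ((1 - 1/2) *\<^sub>R A + (1/2) *\<^sub>R B) \<le> (1 - 1/2) * Q A + (1/2) * Q B"
        by (intro rc[unfolded rank_one_convex_def, rule_format]) simp_all
      moreover have "conformal_part ((1 - 1/2) *\<^sub>R A + (1/2) *\<^sub>R B) = z" "anticonformal_part ((1 - 1/2) *\<^sub>R A + (1/2) *\<^sub>R B) = w"
        unfolding A_def B_def lin parts_of_parts by (simp_all add: scaleR_conv_of_real field_simps)
      ultimately show "0 \<le> t\<^sup>2 * second_variation \<alpha> \<beta> \<gamma> z w \<zeta> \<omega> + t^4 * quartic \<alpha> \<beta> \<gamma> \<zeta> \<omega>"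
        using quartic_symmetric_difference[of \<alpha> \<beta> \<gamma> z t \<zeta> w \<omega>] by (simp add: Q A_def B_def)
    qed
  qed
next
  note lin = linear_parts[THEN linear_add] linear_parts[THEN linear_diff] linear_parts[THEN linear_scale]
  assume sv: "\<forall>z w \<zeta> \<omega>. norm \<zeta> = norm \<omega> \<longrightarrow> 0 \<le> second_variation \<alpha> \<beta> \<gamma> z w \<zeta> \<omega>"
  show "rank_one_convex Q"
    unfolding rank_one_convex_def
  proof (intro allI impI)
    fix t :: real and A B :: "real^2^2" assume t: "0 \<le> t" "t \<le> 1" and r: "rank (A - B) \<le> 1"
    define z w \<zeta> \<omega> where "z = conformal_part A" and "w = anticonformal_part A"
      and "\<zeta> = conformal_part (B - A)" and "\<omega> = anticonformal_part (B - A)"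
    have n: "norm \<zeta> = norm \<omega>"
      using r unfolding rank_le_1_iff_parts \<zeta>_def \<omega>_def lin by (simp add: norm_minus_commute)
    define X Y where "X t = (norm z)\<^sup>2 + 2 * t * (z \<bullet> \<zeta>) + t\<^sup>2 * (norm \<zeta>)\<^sup>2"
      and "Y t = (norm w)\<^sup>2 + 2 * t * (w \<bullet> \<omega>) + t\<^sup>2 * (norm \<omega>)\<^sup>2" for t
    define X' Y' where "X' t = 2 * (z \<bullet> \<zeta>) + 2 * t * (norm \<zeta>)\<^sup>2"
      and "Y' t = 2 * (w \<bullet> \<omega>) + 2 * t * (norm \<omega>)\<^sup>2" for t
    define g where "g t = \<alpha> * (X t)\<^sup>2 + \<beta> * X t * Y t + \<gamma> * (Y t)\<^sup>2" for t
    have gQ: "g t = Q (A + t *\<^sub>R (B - A))" for t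
      unfolding Q lin quartic_eq_squares g_def X_def Y_def norm_squared_line[symmetric]
      by (simp add: z_def w_def \<zeta>_def \<omega>_def lin)
    have dX: "(X has_real_derivative X' t) (at t)" "(Y has_real_derivative Y' t) (at t)"
      "(X' has_real_derivative 2 * (norm \<zeta>)\<^sup>2) (at t)" "(Y' has_real_derivative 2 * (norm \<omega>)\<^sup>2) (at t)" for t
      unfolding X_def[abs_def] Y_def[abs_def] X'_def[abs_def] Y'_def[abs_def]
      by (auto intro!: derivative_eq_intros)
    have "convex_on UNIV g"
    proof (rule f''_ge0_imp_convex)
      show "(g has_real_derivative (2 * \<alpha> * X t * X' t + \<beta> * (X' t * Y t + X t * Y' t) + 2 * \<gamma> * Y t * Y' t)) (at t)" for t
        unfolding g_def[abs_def] by (auto intro!: derivative_eq_intros dX simp: algebra_simps)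
      show "((\<lambda>t. 2 * \<alpha> * X t * X' t + \<beta> * (X' t * Y t + X t * Y' t) + 2 * \<gamma> * Y t * Y' t) has_real_derivative
        (2 * \<alpha> * ((X' t)\<^sup>2 + X t * (2 * (norm \<zeta>)\<^sup>2)) + \<beta> * (2 * (norm \<zeta>)\<^sup>2 * Y t + 2 * X' t * Y' t + X t * (2 * (norm \<omega>)\<^sup>2))
          + 2 * \<gamma> * ((Y' t)\<^sup>2 + Y t * (2 * (norm \<omega>)\<^sup>2)))) (at t)" for t
        by (auto intro!: derivative_eq_intros dX simp: algebra_simps power2_eq_square)
      fix t :: real
      have sv0: "0 \<le> second_variation \<alpha> \<beta> \<gamma> (z + t *\<^sub>R \<zeta>) (w + t *\<^sub>R \<omega>) \<zeta> \<omega>" using sv n by blast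
      have i: "(z + t *\<^sub>R \<zeta>) \<bullet> \<zeta> = X' t / 2" "(w + t *\<^sub>R \<omega>) \<bullet> \<omega> = Y' t / 2"
        by (simp_all add: X'_def Y'_def inner_add_left power2_norm_eq_inner)
      have sveq: "second_variation \<alpha> \<beta> \<gamma> (z + t *\<^sub>R \<zeta>) (w + t *\<^sub>R \<omega>) \<zeta> \<omega> =
        \<alpha> * (4 * (X' t / 2)\<^sup>2 + 2 * X t * (norm \<zeta>)\<^sup>2)
        + \<beta> * (4 * (X' t / 2) * (Y' t / 2) + X t * (norm \<omega>)\<^sup>2 + Y t * (norm \<zeta>)\<^sup>2)
        + \<gamma> * (4 * (Y' t / 2)\<^sup>2 + 2 * Y t * (norm \<omega>)\<^sup>2)"
        unfolding second_variation_def i norm_squared_line X_def Y_def ..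
      show "0 \<le> 2 * \<alpha> * ((X' t)\<^sup>2 + X t * (2 * (norm \<zeta>)\<^sup>2)) + \<beta> * (2 * (norm \<zeta>)\<^sup>2 * Y t + 2 * X' t * Y' t + X t * (2 * (norm \<omega>)\<^sup>2))
          + 2 * \<gamma> * ((Y' t)\<^sup>2 + Y t * (2 * (norm \<omega>)\<^sup>2))"
        using mult_left_mono[OF sv0[unfolded sveq], of 2] by (simp add: field_simps)
    qed simp
    from convex_onD[OF this t, of 0 1] have "g t \<le> (1 - t) * g 0 + t * g 1" by simp
    moreover have "(1 - t) *\<^sub>R A + t *\<^sub>R B = A + t *\<^sub>R (B - A)" by (simp add: algebra_simps)
    ultimately show "Q ((1 - t) *\<^sub>R A + t *\<^sub>R B) \<le> (1 - t) * Q A + t * Q B"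
      by (simp add: gQ)
  qed
qed

lemma quadratic_form_nonneg:
  fixes a b c x y :: real
  assumes "a > 0" "b^2 \<le> 4*a*c"
  shows "a*x^2 + b*x*y + c*y^2 \<ge> 0"
proof -
  have "4*a*(a*x^2 + b*x*y + c*y^2) = (2*a*x + b*y)^2 + (4*a*c - b^2)*y^2"
    by (simp add: algebra_simps power2_eq_square)
  also have "\<dots> \<ge> 0" using assms by simp
  finally show ?thesis using assms(1) by (simp add: zero_le_mult_iff)
qed

section \<open>Pointwise nonnegativity of the dissipation\<close>

text \<open>The form that measures the decay of the energy along the heat flow. The first three summands arise from
  \<open>-\<integral> \<partial>\<^sub>t Q(z, w)\<close> by moving one derivative from the third order factors \<open>\<partial>\<^sub>t z = \<partial>\<^sup>*A\<close> and
  \<open>\<partial>\<^sub>t w = \<partial>C\<close>. The last four are divergences: with \<open>m1\<close> and \<open>m2\<close> those of type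
  \<open>\<partial>(c B) - \<partial>\<^sup>*(c A)\<close> for \<open>c = z (cnj z)\<^sup>2 / 2\<close> and \<open>c = cnj z |w|\<^sup>2\<close>, with \<open>m3\<close> and \<open>m4\<close> those of type
  \<open>\<partial>(c C) - \<partial>\<^sup>*(c B)\<close> for \<open>c = w (cnj w)\<^sup>2 / 2\<close> and \<open>c = cnj w |z|\<^sup>2\<close>. Among the cubic \<open>c\<close> these are the ones
  compatible with the two phase symmetries.\<close>

definition dissipation :: "real \<Rightarrow> real \<Rightarrow> real \<Rightarrow> real \<Rightarrow> real \<Rightarrow> real \<Rightarrow> real
    \<Rightarrow> complex \<Rightarrow> complex \<Rightarrow> complex \<Rightarrow> complex \<Rightarrow> complex \<Rightarrow> complex" where
  "dissipation \<alpha> \<beta> \<gamma> m1 m2 m3 m4 z w A B C =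
     of_real \<alpha> * (4 * cnj z^2*A*B + 8*z*cnj z*A*cnj A)
   + of_real \<beta> * (2*w*cnj w*A*cnj A + 2*z*cnj z*C*cnj C + 4*cnj z*cnj w*A*C
        + 2*cnj z*w*A*cnj B + 2*z*cnj w*cnj B*C)
   + of_real \<gamma> * (4 * cnj w^2*B*C + 8*w*cnj w*C*cnj C)
   + of_real m1 * (z*cnj z*(B*cnj B - A*cnj A))
   + of_real m2 * (w*cnj w*(B*cnj B - A*cnj A) + cnj z*cnj w*(B*B-A*C) + cnj z*w*(cnj C*B - cnj B*A))
   + of_real m3 * (w*cnj w*(C*cnj C - B*cnj B))
   + of_real m4 * (z*cnj z*(C*cnj C - B*cnj B) + cnj z*cnj w*(A*C-B*B) + z*cnj w*(cnj B*C - cnj A*B))"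

text \<open>The dissipation at real arguments, to which the general case is reduced in \<open>dissipation_phases\<close>.\<close>

definition real_dissipation :: "real \<Rightarrow> real \<Rightarrow> real \<Rightarrow> real \<Rightarrow> real \<Rightarrow> real \<Rightarrow> real
    \<Rightarrow> real \<Rightarrow> real \<Rightarrow> real \<Rightarrow> real \<Rightarrow> real \<Rightarrow> real" where
  "real_dissipation \<alpha> \<beta> \<gamma> m1 m2 m3 m4 z w a b c =
     \<alpha> * (4 * z^2*a*b + 8*z^2*a^2)
   + \<beta> * (2*w^2*a^2 + 2*z^2*c^2 + 4*z*w*a*c + 2*z*w*a*b + 2*z*w*b*c)
   + \<gamma> * (4 * w^2*b*c + 8*w^2*c^2)
   + m1 * (z^2*(b^2-a^2))
   + m2 * (w^2*(b^2-a^2) + z*w*(b^2-a*c) + z*w*(c*b-b*a))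
   + m3 * (w^2*(c^2-b^2))
   + m4 * (z^2*(c^2-b^2) + z*w*(a*c-b^2) + z*w*(b*c-a*b))"

text \<open>Exchanging the two Wirtinger derivatives exchanges \<open>z\<close> with \<open>w\<close> and \<open>A\<close> with \<open>C\<close>; it reduces
  \<open>s \<ge> 1\<close> to \<open>s \<le> 1\<close> below.\<close>

lemma real_dissipation_swap:
  "real_dissipation \<alpha> \<beta> \<gamma> m1 m2 m3 m4 z w a b c = real_dissipation \<gamma> \<beta> \<alpha> (-m3) (-m4) (-m1) (-m2) w z c b a"
  unfolding real_dissipation_def by algebra

text \<open>The heart of the proof. Since the inequality \<open>4\<beta>\<^sup>2 \<le> (6\<alpha> + \<beta>) (6\<gamma> + \<beta>)\<close> is an equality for
  \<open>Q\<^sub>s\<close>, the form vanishes at \<open>w = -s z\<close>, \<open>a = b = c\<close>. Nonnegativity therefore requires its gradient to vanish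
  there, which expresses \<open>m1\<close> through \<open>m2\<close> and \<open>m3\<close> through \<open>m4\<close>. The values of \<open>m2\<close> and \<open>m4\<close> are one
  convenient choice for which the form is nonnegative for all \<open>s \<in> {0<..1}\<close>. In coordinates centred at
  the zero the form is a quadratic polynomial in \<open>d * b\<close>, and its discriminant has the right sign.\<close>

lemma real_dissipation_nonneg:
  fixes s z w a b c :: real
  assumes "0 < s" "s \<le> 1"
  shows "real_dissipation (2* s-1) 6 (2/s-1) (8* s-4-(1-s)*(6+s/2)) (23/2)
           (4-8/s-13/2*(1-s)/s) (s/2-12) z w a b c \<ge> 0"
proof -
  (* The zero of the form becomes d = 0, u = v = 0. *)
  define y where "y = - w / s"
  have w: "w = - (s*y)" using assms by (simp add: y_def)
  define d u v where "d = z - y" and "u = a - b" and "v = c - b"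
  have z: "z = d + y" and a: "a = b + u" and c: "c = b + v" by (auto simp: d_def u_def v_def)
  define X Y Z W where "X = z*u" and "Y = z* v" and "Z = y*u" and "W = y* v"
  define L where "L = (13/2-s/2)*X - s*Z/2 + Y/2 - (11/2+s/2)*W"
  define R where "R = (2+2* s+s*(1-s)/2)*X^2 + s/2*Y^2 + s^2/2*Z^2 + s*(2+2* s-(1-s)/2)*W^2 - (1+s)* s/2*X*W"
  have form: "real_dissipation (2* s-1) 6 (2/s-1) (8* s-4-(1-s)*(6+s/2)) (23/2)
           (4-8/s-13/2*(1-s)/s) (s/2-12) z w a b c
     = 24* s*(d*b)^2 + 2* s*(d*b)*L + R"
    unfolding real_dissipation_def w L_def R_def X_def Y_def Z_def W_def z a c
    using assms by (simp add: field_simps) algebra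
  have "s * L^2 \<le> 24 * R"
  proof -
    define p q where "p = 13/2-s/2" and "q = 11/2+s/2"
    have L: "L = (p*X - q*W) + (Y - s*Z)/2" by (simp add: L_def p_def q_def field_simps)
    (* The weights 24/23 and 24 of Young's inequality are such that the second term is
       absorbed by the squares of Y and Z in R. *)
    have "23*L^2 \<le> 24*(p*X-q*W)^2 + 23*24*(((Y-s*Z)/2)^2)"
    proof -
      define P T where "P = p*X-q*W" and "T = (Y-s*Z)/2"
      have "24*P^2 + 23*24*T^2 - 23*(P+T)^2 = (P-23*T)^2" by algebra
      then show ?thesis unfolding L P_def[symmetric] T_def[symmetric]
        by (metis diff_ge_0_iff_ge zero_le_power2)
    qed
    moreover have "(Y-s*Z)^2 \<le> 2*(Y^2+s*Z^2)"
    proof -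
      have "(1+s)*(Y^2+s*Z^2) - (Y-s*Z)^2 = s*(Y+Z)^2" by algebra
      moreover have "s*(Y+Z)^2 \<ge> 0" using assms by simp
      moreover have "(1+s)*(Y^2+s*Z^2) \<le> 2*(Y^2+s*Z^2)" using assms by (intro mult_right_mono) auto
      ultimately show ?thesis by linarith
    qed
    ultimately have L2: "23*L^2 \<le> 24*(p*X-q*W)^2 + 23*12*(Y^2+s*Z^2)" by (simp add: power_divide)
    have "s * (23*L^2) \<le> s * (24*(p*X-q*W)^2 + 23*12*(Y^2+s*Z^2))"
      using L2 assms by (intro mult_left_mono) auto
    moreover have "23*24*R - s * (24*(p*X-q*W)^2 + 23*12*(Y^2+s*Z^2)) =
       24 * ((46+61/4* s-5* s^2-s^3/4)*X^2 + (s*(60-21/2* s-s^2/2))*X*W + (s*(17/4+52* s-s^2/4))*W^2)"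
      unfolding R_def p_def q_def by (simp add: field_simps) algebra
    moreover have "(46+61/4* s-5* s^2-s^3/4)*X^2 + (s*(60-21/2* s-s^2/2))*X*W + (s*(17/4+52* s-s^2/4))*W^2 \<ge> 0"
    proof (rule quadratic_form_nonneg)
      have s2: "s^2 \<le> s" "s^3 \<le> s" using assms power_decreasing[of 1 _ s] by (auto simp del: power_Suc)
      have 1: "46+61/4* s-5* s^2-s^3/4 \<ge> 46" using s2 assms by linarith
      then show "46+61/4* s-5* s^2-s^3/4 > 0" by linarith
      have 2: "17/4+52* s-s^2/4 \<ge> 51* s" using s2 assms by linarith
      have 3: "0 \<le> 60-21/2* s-s^2/2" "60-21/2* s-s^2/2 \<le> 60"
        using s2 assms zero_le_power2[of s] by linarith+
      have "(s*(60-21/2* s-s^2/2))^2 \<le> (s*60)^2"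
        using 3 assms by (intro power_mono mult_left_mono) auto
      also have "\<dots> \<le> 4*46*(s*(51* s))" by (simp add: power2_eq_square)
      also have "\<dots> \<le> 4*(46+61/4* s-5* s^2-s^3/4)*(s*(17/4+52* s-s^2/4))"
        using 1 2 assms by (intro mult_mono) auto
      finally show "(s*(60-21/2* s-s^2/2))^2 \<le> 4*(46+61/4* s-5* s^2-s^3/4)*(s*(17/4+52* s-s^2/4))" .
    qed
    ultimately have "0 \<le> 23*24*R - s * (23*L^2)" by (smt (verit, best))
    then show ?thesis by simp
  qed
  then have "(24* s*(d*b) + s*L)^2 + s*(24*R - s*L^2) \<ge> 0" using assms by simp
  also have "(24* s*(d*b) + s*L)^2 + s*(24*R - s*L^2) = 24* s*(24* s*(d*b)^2 + 2* s*(d*b)*L + R)"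
    by algebra
  finally show ?thesis unfolding form using assms by (simp add: zero_le_mult_iff)
qed

text \<open>The phase symmetries of \<open>Q\<close> carry over to the dissipation, so \<open>z\<close> and \<open>w\<close> may be taken real. Then the
  real and the imaginary parts of \<open>(A, B, C)\<close> decouple, and the form of the imaginary parts is that of
  the real parts after a change of sign of \<open>w\<close> and \<open>B\<close>.\<close>

lemma dissipation_phases:
  fixes z w A B C :: complex
  assumes "z = of_real r * cis (g - h)" "w = of_real t * cis (g + h)"
  defines "a \<equiv> A * cis (2*h-g)" and "b \<equiv> B * cis (-g)" and "c \<equiv> C * cis (-2*h-g)"
  shows "Re (dissipation \<alpha> \<beta> \<gamma> m1 m2 m3 m4 z w A B C)
    = real_dissipation \<alpha> \<beta> \<gamma> m1 m2 m3 m4 r t (Re a) (Re b) (Re c)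
    + real_dissipation \<alpha> \<beta> \<gamma> m1 m2 m3 m4 r (-t) (Im a) (-Im b) (Im c)"
proof -
  have A: "A = a * cis (g-2*h)" and B: "B = b * cis g"
    unfolding a_def b_def by (simp_all add: cis_mult mult.assoc)
  have "(-2*h-g) + (g+2*h) = 0" by simp
  then have C: "C = c * cis (g+2*h)"
    unfolding c_def mult.assoc cis_mult by simp
  define G H where "G = cis g" and "H = cis h"
  have GG: "cnj G = inverse G" "cnj H = inverse H" "G \<noteq> 0" "H \<noteq> 0"
    by (auto simp: G_def H_def cis_cnj cis_inverse)
  have e: "cis (g-h) = G * inverse H" "cis (g+h) = G*H" "cis (g-2*h) = G * inverse H * inverse H"
     "cis g = G" "cis (g+2*h) = G*H*H"
    unfolding G_def H_def by (simp_all add: cis_mult cis_inverse) (simp_all add: algebra_simps)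
  have "dissipation \<alpha> \<beta> \<gamma> m1 m2 m3 m4 z w A B C = dissipation \<alpha> \<beta> \<gamma> m1 m2 m3 m4 (of_real r) (of_real t) a b c"
    unfolding dissipation_def assms(1,2) A B C e complex_cnj_mult complex_cnj_inverse GG(1,2) complex_cnj_complex_of_real inverse_inverse_eq
    using GG(3,4) by (simp add: field_simps power2_eq_square)
  moreover have "Re (dissipation \<alpha> \<beta> \<gamma> m1 m2 m3 m4 (of_real r) (of_real t) a b c) =
      real_dissipation \<alpha> \<beta> \<gamma> m1 m2 m3 m4 r t (Re a) (Re b) (Re c)
    + real_dissipation \<alpha> \<beta> \<gamma> m1 m2 m3 m4 r (-t) (Im a) (-Im b) (Im c)"
    unfolding dissipation_def real_dissipation_def
    by (cases a; cases b; cases c) (simp add: algebra_simps power2_eq_square)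
  ultimately show ?thesis by simp
qed

lemma dissipation_nonneg:
  assumes "\<And>r t a b c. real_dissipation \<alpha> \<beta> \<gamma> m1 m2 m3 m4 r t a b c \<ge> 0"
  shows "Re (dissipation \<alpha> \<beta> \<gamma> m1 m2 m3 m4 z w A B C) \<ge> 0"
proof -
  define g h where "g = (Arg z + Arg w)/2" and "h = (Arg w - Arg z)/2"
  have "z = of_real (norm z) * cis (g - h)" "w = of_real (norm w) * cis (g + h)"
    using rcis_cmod_Arg[of z] rcis_cmod_Arg[of w] by (auto simp: g_def h_def field_simps rcis_def)
  from dissipation_phases[OF this] show ?thesis using assms by simp
qed

lemma dissipation_nonneg_extremal:
  assumes "s > 0"
  shows "\<exists>m1 m2 m3 m4. \<forall>z w A B C. Re (dissipation (2* s-1) 6 (2/s-1) m1 m2 m3 m4 z w A B C) \<ge> 0"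
proof (cases "s \<le> 1")
  case True
  show ?thesis using dissipation_nonneg[OF real_dissipation_nonneg[OF assms True]] by blast
next
  case False
  then have s: "0 < inverse s" "inverse s \<le> 1" by (auto simp: field_simps)
  have "2*inverse s-1 = 2/s-1" "2/inverse s - 1 = 2* s-1" by (auto simp: field_simps)
  with real_dissipation_nonneg[OF s] obtain m1 m2 m3 m4 where
    "\<And>r t a b c. real_dissipation (2/s-1) 6 (2* s-1) m1 m2 m3 m4 r t a b c \<ge> 0"
    by metis
  then have "\<And>r t a b c. real_dissipation (2* s-1) 6 (2/s-1) (-m3) (-m4) (-m1) (-m2) r t a b c \<ge> 0"
    by (subst real_dissipation_swap) simp
  from dissipation_nonneg[OF this] show ?thesis by blast
qed

lemma dissipation_nonneg_power4:
  "\<exists>m1 m2 m3 m4. \<forall>z w A B C. Re (dissipation 1 0 0 m1 m2 m3 m4 z w A B C) \<ge> 0"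
  "\<exists>m1 m2 m3 m4. \<forall>z w A B C. Re (dissipation 0 0 1 m1 m2 m3 m4 z w A B C) \<ge> 0"
proof -
  have 1: "real_dissipation 1 0 0 4 0 0 0 r t a b c \<ge> 0" for r t a b c
  proof -
    have "real_dissipation 1 0 0 4 0 0 0 r t a b c = 2*(r*(a+b))^2 + 2*(r*a)^2+2*(r*b)^2"
      unfolding real_dissipation_def by algebra
    then show ?thesis by simp
  qed
  from dissipation_nonneg[OF 1] show "\<exists>m1 m2 m3 m4. \<forall>z w A B C. Re (dissipation 1 0 0 m1 m2 m3 m4 z w A B C) \<ge> 0"
    by blast
  have "real_dissipation 0 0 1 0 0 (-4) 0 r t a b c \<ge> 0" for r t a b c
    using 1[of t r c b a] by (subst real_dissipation_swap) simp
  from dissipation_nonneg[OF this] show "\<exists>m1 m2 m3 m4. \<forall>z w A B C. Re (dissipation 0 0 1 m1 m2 m3 m4 z w A B C) \<ge> 0"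
    by blast
qed

section \<open>Trigonometric polynomials and their Wirtinger derivatives\<close>

text \<open>The frequencies are the points of the lattice \<open>\<rho> \<int>\<^sup>2\<close>; with \<open>\<rho> = pi / l\<close> the waves have the period box
  \<open>[-l, l]\<^sup>2\<close>.\<close>

definition wave :: "real \<Rightarrow> int \<times> int \<Rightarrow> real^2 \<Rightarrow> complex" where
  "wave \<rho> k x = cis (\<rho> * (of_int (fst k) * x$1 + of_int (snd k) * x$2))"

text \<open>The Wirtinger derivatives \<open>\<partial>\<close> and \<open>\<partial>\<^sup>*\<close> act on a wave as multiplication by \<open>dz_symbol\<close> and
  \<open>dzbar_symbol\<close>.\<close>

definition dz_symbol :: "real \<Rightarrow> int \<times> int \<Rightarrow> complex" where
  "dz_symbol \<rho> k = Complex (\<rho> * of_int (snd k) / 2) (\<rho> * of_int (fst k) / 2)"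

definition dzbar_symbol :: "real \<Rightarrow> int \<times> int \<Rightarrow> complex" where
  "dzbar_symbol \<rho> k = Complex (- \<rho> * of_int (snd k) / 2) (\<rho> * of_int (fst k) / 2)"

abbreviation period_box :: "real \<Rightarrow> (real^2) set" where
  "period_box l \<equiv> cbox (vec (-l)) (vec l)"

lemma wave_mult: "wave \<rho> j x * wave \<rho> k x = wave \<rho> (j + k) x"
  by (simp add: wave_def cis_mult algebra_simps)

lemma cnj_wave: "cnj (wave \<rho> k x) = wave \<rho> (-k) x"
  by (simp add: wave_def cis_cnj algebra_simps)

lemma wave_0 [simp]: "wave \<rho> 0 x = 1" by (simp add: wave_def)

lemma norm_wave [simp]: "norm (wave \<rho> k x) = 1" by (simp add: wave_def)

lemma symbol_add: "dz_symbol \<rho> (j + k) = dz_symbol \<rho> j + dz_symbol \<rho> k"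
  "dzbar_symbol \<rho> (j + k) = dzbar_symbol \<rho> j + dzbar_symbol \<rho> k"
  by (simp_all add: dz_symbol_def dzbar_symbol_def complex_eq_iff field_simps)

lemma symbol_0 [simp]: "dz_symbol \<rho> 0 = 0" "dzbar_symbol \<rho> 0 = 0"
  by (simp_all add: dz_symbol_def dzbar_symbol_def complex_eq_iff)

lemma cnj_symbol: "cnj (dz_symbol \<rho> k) = dzbar_symbol \<rho> (-k)" "cnj (dzbar_symbol \<rho> k) = dz_symbol \<rho> (-k)"
  by (simp_all add: dz_symbol_def dzbar_symbol_def complex_eq_iff)

lemma continuous_on_wave [continuous_intros]: "continuous_on S f \<Longrightarrow> continuous_on S (\<lambda>x. wave \<rho> k (f x))"
  unfolding wave_def by (intro continuous_intros)

text \<open>\<open>trig \<rho> f f1 f2\<close> says that \<open>f\<close> is a trigonometric polynomial with \<open>\<partial>f = f1\<close> and \<open>\<partial>\<^sup>*f = f2\<close>. Building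
  the derivatives into the predicate makes differentiation purely algebraic: the product rule and the
  conjugation rule are proved on waves.\<close>

inductive trig :: "real \<Rightarrow> (real^2 \<Rightarrow> complex) \<Rightarrow> (real^2 \<Rightarrow> complex) \<Rightarrow> (real^2 \<Rightarrow> complex) \<Rightarrow> bool"
  for \<rho> where
  trig_wave: "trig \<rho> (\<lambda>x. c * wave \<rho> k x) (\<lambda>x. c * dz_symbol \<rho> k * wave \<rho> k x) (\<lambda>x. c * dzbar_symbol \<rho> k * wave \<rho> k x)"
| trig_add: "trig \<rho> f f1 f2 \<Longrightarrow> trig \<rho> g g1 g2 \<Longrightarrow>
     trig \<rho> (\<lambda>x. f x + g x) (\<lambda>x. f1 x + g1 x) (\<lambda>x. f2 x + g2 x)"

lemma trig_cong:
  assumes "trig \<rho> f f1 f2" "\<And>x. f x = g x" "\<And>x. f1 x = g1 x" "\<And>x. f2 x = g2 x"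
  shows "trig \<rho> g g1 g2"
proof -
  have "f = g" "f1 = g1" "f2 = g2" using assms by auto
  with assms(1) show ?thesis by simp
qed

lemma trig_const: "trig \<rho> (\<lambda>x. c) (\<lambda>x. 0) (\<lambda>x. 0)"
  using trig_wave[of \<rho> c 0] by simp

lemma trig_mult_wave:
  assumes "trig \<rho> f f1 f2"
  shows "trig \<rho> (\<lambda>x. f x * (c * wave \<rho> k x)) (\<lambda>x. f1 x * (c * wave \<rho> k x) + f x * (c * dz_symbol \<rho> k * wave \<rho> k x))
     (\<lambda>x. f2 x * (c * wave \<rho> k x) + f x * (c * dzbar_symbol \<rho> k * wave \<rho> k x))"
  using assms
proof induction
  case (trig_wave d j)
  show ?case
    by (rule trig_cong[OF trig.trig_wave[of \<rho> "d*c" "j+k"]])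
       (simp_all add: symbol_add flip: wave_mult, simp_all add: algebra_simps)
next
  case (trig_add f f1 f2 g g1 g2)
  show ?case
    by (rule trig_cong[OF trig.trig_add[OF trig_add.IH]]) (simp_all add: algebra_simps)
qed

lemma trig_mult:
  assumes "trig \<rho> f f1 f2" "trig \<rho> g g1 g2"
  shows "trig \<rho> (\<lambda>x. f x * g x) (\<lambda>x. f1 x * g x + f x * g1 x) (\<lambda>x. f2 x * g x + f x * g2 x)"
  using assms(2)
proof induction
  case (trig_wave c k)
  show ?case by (rule trig_mult_wave[OF assms(1)])
next
  case (trig_add g g1 g2 h h1 h2)
  show ?case
    by (rule trig_cong[OF trig.trig_add[OF trig_add.IH]]) (simp_all add: algebra_simps)
qed

lemma trig_scale: "trig \<rho> f f1 f2 \<Longrightarrow> trig \<rho> (\<lambda>x. c * f x) (\<lambda>x. c * f1 x) (\<lambda>x. c * f2 x)"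
  using trig_mult[OF trig_const] by simp

lemma trig_minus: "trig \<rho> f f1 f2 \<Longrightarrow> trig \<rho> (\<lambda>x. - f x) (\<lambda>x. - f1 x) (\<lambda>x. - f2 x)"
  using trig_scale[of \<rho> f f1 f2 "-1"] by simp

lemma trig_cnj:
  assumes "trig \<rho> f f1 f2"
  shows "trig \<rho> (\<lambda>x. cnj (f x)) (\<lambda>x. cnj (f2 x)) (\<lambda>x. cnj (f1 x))"
  using assms
proof induction
  case (trig_wave c k)
  show ?case
    by (rule trig_cong[OF trig.trig_wave[of \<rho> "cnj c" "-k"]]) (simp_all add: cnj_wave cnj_symbol)
next
  case (trig_add f f1 f2 g g1 g2)
  show ?case
    by (rule trig_cong[OF trig.trig_add[OF trig_add.IH]]) (simp_all add: algebra_simps)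
qed

lemma trig_sum:
  assumes "finite K" "\<And>k. k \<in> K \<Longrightarrow> trig \<rho> (f k) (f1 k) (f2 k)"
  shows "trig \<rho> (\<lambda>x. \<Sum>k\<in>K. f k x) (\<lambda>x. \<Sum>k\<in>K. f1 k x) (\<lambda>x. \<Sum>k\<in>K. f2 k x)"
  using assms by (induction K rule: finite_induct) (auto intro: trig_const trig_add)

lemma trig_continuous: 
  assumes "trig \<rho> f f1 f2" 
  shows "continuous_on S f" "continuous_on S f1" "continuous_on S f2"
  using assms by (induction) (auto intro!: continuous_intros)

lemma integral_lborel_prod:
  fixes f :: "'a::euclidean_space \<Rightarrow> real \<Rightarrow> complex"
  assumes "\<And>b. b \<in> Basis \<Longrightarrow> integrable lborel (f b)"
  shows "(\<integral>x. (\<Prod>b\<in>Basis. f b (x \<bullet> b)) \<partial>lborel) = (\<Prod>b\<in>Basis. (\<integral>x. f b x \<partial>lborel))"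
proof -
  interpret product_sigma_finite "\<lambda>_::'a. lborel :: real measure" by standard
  have [measurable]: "f b \<in> borel_measurable borel" if "b \<in> Basis" for b
    using borel_measurable_integrable[OF assms[OF that]] by simp
  have "(\<integral>x. (\<Prod>b\<in>Basis. f b (x \<bullet> b)) \<partial>lborel)
      = (\<integral>y. (\<Prod>b\<in>Basis. f b ((\<Sum>b\<in>Basis. y b *\<^sub>R b) \<bullet> b)) \<partial>(\<Pi>\<^sub>M b\<in>Basis. lborel))"
    by (subst lborel_eq, subst integral_distr) auto
  also have "\<dots> = (\<integral>y. (\<Prod>b\<in>Basis. f b (y b)) \<partial>(\<Pi>\<^sub>M b\<in>Basis. lborel))"
    by simp
  also have "\<dots> = (\<Prod>b\<in>Basis. (\<integral>x. f b x \<partial>lborel))"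
    by (rule product_integral_prod) (use assms in auto)
  finally show ?thesis .
qed

lemma integral_wave_interval:
  assumes "l > 0"
  shows "integral {-l..l} (\<lambda>t. cis (pi / l * (of_int n * t))) = (if n = 0 then of_real (2 * l) else 0)"
proof (cases "n = 0")
  case False
  define e where "e = pi / l * of_int n"
  have e: "e \<noteq> 0" using False assms by (simp add: e_def)
  have "((\<lambda>t. cis (e * t)) has_integral (cis (e * l) / (\<i> * e) - cis (e * (-l)) / (\<i> * e))) {-l..l}"
  proof (rule fundamental_theorem_of_calculus)
    show "((\<lambda>t. cis (e * t) / (\<i> * e)) has_vector_derivative cis (e * x)) (at x within {-l..l})" for x
      unfolding has_vector_derivative_def using e
      by (auto intro!: derivative_eq_intros simp: scaleR_conv_of_real field_simps)
  qed (use assms in auto)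
  moreover have "cis (e * l) = cis (e * (-l))"
  proof -
    have "e * l = of_int n * pi" using assms by (simp add: e_def)
    moreover have "sin (of_int n * pi) = 0" by (auto simp: sin_zero_iff_int2)
    ultimately show ?thesis by (simp add: complex_eq_iff)
  qed
  ultimately have "((\<lambda>t. cis (e * t)) has_integral 0) {-l..l}" by simp
  then show ?thesis using False by (simp add: e_def integral_unique mult.assoc)
qed (use assms in \<open>simp add: scaleR_conv_of_real\<close>)

lemma Basis_2: "(Basis :: (real^2) set) = {axis 1 1, axis 2 1}"
  by (auto simp: Basis_vec_def UNIV_2)

lemma prod_Basis_2: "(\<Prod>b\<in>(Basis :: (real^2) set). h b) = h (axis 1 1) * h (axis 2 1)"
  by (simp add: Basis_2 axis_eq_axis)

lemma continuous_imp_set_integrable_cbox: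
  fixes f :: "'a::euclidean_space \<Rightarrow> 'b::euclidean_space"
  assumes "continuous_on (cbox a b) f" 
  shows "set_integrable lborel (cbox a b) f"
  unfolding set_integrable_def
  by (rule borel_integrable_compact[OF compact_cbox assms])

text \<open>Distinct waves are orthogonal: on the square the integral factors into two integrals over an interval,
  one of which is zero unless the frequency is.\<close>

lemma integral_wave:
  assumes "l > 0"
  shows "integral (period_box l) (wave (pi / l) k) = (if k = 0 then of_real ((2 * l)\<^sup>2) else 0)"
proof -
  define g :: "int \<Rightarrow> real \<Rightarrow> complex" where "g n t = indicator {-l..l} t *\<^sub>R cis (pi / l * (of_int n * t))" for n t
  define f where "f b = g (if b = axis 1 1 then fst k else snd k)" for b :: "real^2"
  have ax: "axis 1 (1::real) \<noteq> (axis 2 1 :: real^2)" by (simp add: axis_eq_axis)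
  have si: "set_integrable lborel {-l..l} (\<lambda>t. cis (pi / l * (of_int n * t)))" for n
  proof -
    have "continuous_on (cbox (-l) l) (\<lambda>t. cis (pi / l * (of_int n * t)))"
      by (intro continuous_intros)
    from continuous_imp_set_integrable_cbox[OF this] show ?thesis
      by (simp only: box_real)
  qed
  then have gi: "integrable lborel (g n)" for n
    unfolding g_def set_integrable_def by auto
  have gint: "(\<integral>t. g n t \<partial>lborel) = (if n = 0 then of_real (2 * l) else 0)" for n
    unfolding g_def integral_wave_interval[OF assms, symmetric]
    using set_borel_integral_eq_integral(2)[OF si] unfolding set_lebesgue_integral_def by simp
  have "integral (period_box l) (wave (pi / l) k) = (\<integral>x. indicator (period_box l) x *\<^sub>R wave (pi / l) k x \<partial>lborel)"
    using set_borel_integral_eq_integral(2)[OF continuous_imp_set_integrable_cbox[OF continuous_on_wave[OF continuous_on_id]]]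
    unfolding set_lebesgue_integral_def by simp
  also have "\<dots> = (\<integral>x. (\<Prod>b\<in>Basis. f b (x \<bullet> b)) \<partial>lborel)"
  proof (rule Bochner_Integration.integral_cong)
    fix x :: "real^2"
    have "(indicator (period_box l) x :: real) = indicator {-l..l} (x$1) * indicator {-l..l} (x$2)"
      by (auto simp: indicator_def mem_box_cart forall_2)
    moreover have "wave (pi / l) k x = cis (pi / l * (of_int (fst k) * x$1)) * cis (pi / l * (of_int (snd k) * x$2))"
      by (simp add: wave_def cis_mult algebra_simps)
    ultimately show "indicator (period_box l) x *\<^sub>R wave (pi / l) k x = (\<Prod>b\<in>Basis. f b (x \<bullet> b))"
      using ax by (simp add: prod_Basis_2 f_def g_def inner_axis scaleR_conv_of_real)
  qed simp
  also have "\<dots> = (\<Prod>b\<in>Basis. (\<integral>x. f b x \<partial>lborel))"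
    by (rule integral_lborel_prod) (simp add: f_def gi)
  also have "\<dots> = (if k = 0 then of_real ((2 * l)\<^sup>2) else 0)"
    using ax by (simp add: prod_Basis_2 f_def gint prod_eq_iff power2_eq_square)
  finally show ?thesis .
qed

text \<open>This replaces integration by parts for periodic functions: a derivative has no constant Fourier
  coefficient.\<close>

lemma trig_derivative_integral:
  assumes "trig (pi / l) f f1 f2" "l > 0"
  shows "integral (period_box l) f1 = 0" "integral (period_box l) f2 = 0"
proof -
  have "(f1 has_integral 0) (period_box l) \<and> (f2 has_integral 0) (period_box l)"
    using assms(1)
  proof induction
    case (trig_wave c k)
    have "(wave (pi / l) k has_integral (if k = 0 then of_real ((2 * l)\<^sup>2) else 0)) (period_box l)"
      unfolding integral_wave[OF assms(2), symmetric]
      by (intro integrable_integral integrable_continuous continuous_intros)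
    from has_integral_mult_right[OF this] show ?case by (cases "k = 0") fastforce+
  next
    case (trig_add f f1 f2 g g1 g2)
    then show ?case using has_integral_add[of f1 0 _ g1 0] has_integral_add[of f2 0 _ g2 0] by simp
  qed
  then show "integral (period_box l) f1 = 0" "integral (period_box l) f2 = 0"
    by (auto intro: integral_unique)
qed

section \<open>Energy decay along the heat flow\<close>

text \<open>The left-hand side is \<open>\<partial>P + \<partial>\<^sup>*S\<close>, expanded by the product rule, where
  \<open>P = (m1/2 |z|\<^sup>2 cnj z + m2 cnj z |w|\<^sup>2) B + ((4\<gamma> + m3/2) |w|\<^sup>2 cnj w + (2\<beta> + m4) cnj w |z|\<^sup>2) C\<close> and
  \<open>S = ((4\<alpha> - m1/2) |z|\<^sup>2 cnj z + (2\<beta> - m2) cnj z |w|\<^sup>2) A - (m3/2 |w|\<^sup>2 cnj w + m4 cnj w |z|\<^sup>2) B\<close>. Here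
  \<open>Z\<close> and \<open>W\<close> stand for the third derivatives \<open>\<partial>\<partial>\<partial>\<^sup>*\<phi>\<close> and \<open>\<partial>\<partial>\<^sup>*\<partial>\<^sup>*\<phi>\<close>, which are the time derivatives
  of \<open>z\<close> and \<open>w\<close> under the heat flow.\<close>

lemma dissipation_algebra:
  fixes z w A B C Z W :: complex
  shows "((of_real (m1/2) * ((A * cnj z + z * cnj B) * cnj z + z * cnj z * cnj B)
       + of_real m2 * ((cnj B * w + cnj z * B) * cnj w + cnj z * w * cnj C)) * B
      + (of_real (m1/2) * (z * cnj z * cnj z) + of_real m2 * (cnj z * w * cnj w)) * Z
      + ((of_real (4*\<gamma>+m3/2) * ((B * cnj w + w * cnj C) * cnj w + w * cnj w * cnj C)
       + of_real (2*\<beta>+m4) * ((cnj C * z + cnj w * A) * cnj z + cnj w * z * cnj B)) * C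
      + (of_real (4*\<gamma>+m3/2) * (w * cnj w * cnj w) + of_real (2*\<beta>+m4) * (cnj w * z * cnj z)) * W))
     + ((of_real (4*\<alpha>-m1/2) * ((B * cnj z + z * cnj A) * cnj z + z * cnj z * cnj A)
       + of_real (2*\<beta>-m2) * ((cnj A * w + cnj z * C) * cnj w + cnj z * w * cnj B)) * A
      + (of_real (4*\<alpha>-m1/2) * (z * cnj z * cnj z) + of_real (2*\<beta>-m2) * (cnj z * w * cnj w)) * Z
      + ((of_real (-m3/2) * ((C * cnj w + w * cnj B) * cnj w + w * cnj w * cnj B)
       + of_real (-m4) * ((cnj B * z + cnj w * B) * cnj z + cnj w * z * cnj A)) * B
      + (of_real (-m3/2) * (w * cnj w * cnj w) + of_real (-m4) * (cnj w * z * cnj z)) * W))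
    = (4 * of_real \<alpha> * z * cnj z^2 * Z + 2 * of_real \<beta> * (cnj z * Z * w * cnj w
         + z * cnj z * cnj w * W) + 4 * of_real \<gamma> * w * cnj w^2 * W)
      + dissipation \<alpha> \<beta> \<gamma> m1 m2 m3 m4 z w A B C"
proof -
  define n1 n3 where "n1 = m1/2" and "n3 = m3/2"
  have m: "m1 = 2*n1" "m3 = 2*n3" by (auto simp: n1_def n3_def)
  show ?thesis unfolding dissipation_def m
   by (simp, algebra)
qed

lemma dissipation_identity:
  assumes "l > 0"
    and z: "trig (pi / l) z A B" and w: "trig (pi / l) w B C"
    and A: "trig (pi / l) A A1 Z" and B: "trig (pi / l) B Z W" and C: "trig (pi / l) C W C1"
  shows "integral (period_box l) (\<lambda>x. 
      (4 * of_real \<alpha> * z x * cnj (z x)^2 * Z x + 2 * of_real \<beta> * (cnj (z x) * Z x * w x * cnj (w x)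
         + z x * cnj (z x) * cnj (w x) * W x) + 4 * of_real \<gamma> * w x * cnj (w x)^2 * W x)
      + dissipation \<alpha> \<beta> \<gamma> m1 m2 m3 m4 (z x) (w x) (A x) (B x) (C x)) = 0"
proof -
  note zb = trig_cnj[OF z] and wb = trig_cnj[OF w]
  note c1 = trig_mult[OF trig_mult[OF z zb] zb] and c2 = trig_mult[OF trig_mult[OF zb w] wb]
    and c3 = trig_mult[OF trig_mult[OF w wb] wb] and c4 = trig_mult[OF trig_mult[OF wb z] zb]
  note P = trig_add[OF
    trig_mult[OF trig_add[OF trig_scale[OF c1, of "of_real (m1/2)"] trig_scale[OF c2, of "of_real m2"]] B]
    trig_mult[OF trig_add[OF trig_scale[OF c3, of "of_real (4*\<gamma>+m3/2)"] trig_scale[OF c4, of "of_real (2*\<beta>+m4)"]] C]]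
  note S = trig_add[OF
    trig_mult[OF trig_add[OF trig_scale[OF c1, of "of_real (4*\<alpha>-m1/2)"] trig_scale[OF c2, of "of_real (2*\<beta>-m2)"]] A]
    trig_mult[OF trig_add[OF trig_scale[OF c3, of "of_real (-m3/2)"] trig_scale[OF c4, of "of_real (-m4)"]] B]]
  note 1 = integrable_integral[OF trig_continuous(2)[OF P, THEN integrable_continuous[where a="vec (-l)" and b="vec l"]], unfolded trig_derivative_integral(1)[OF P assms(1)]]
  note 2 = integrable_integral[OF trig_continuous(3)[OF S, THEN integrable_continuous[where a="vec (-l)" and b="vec l"]], unfolded trig_derivative_integral(2)[OF S assms(1)]]
  show ?thesis
    by (rule integral_unique, rule has_integral_eq_rhs[OF has_integral_eq[OF _ has_integral_add[OF 1 2]]])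
       (rule dissipation_algebra, simp)
qed

text \<open>If the dissipation is pointwise nonnegative, the energy cannot increase: the integrand is the time
  derivative of \<open>quartic \<alpha> \<beta> \<gamma> z w\<close> when \<open>\<partial>\<^sub>t z = Z\<close> and \<open>\<partial>\<^sub>t w = W\<close>.\<close>

lemma energy_rate_nonpos:
  assumes "l > 0"
    and z: "trig (pi / l) z A B" and w: "trig (pi / l) w B C"
    and A: "trig (pi / l) A A1 Z" and B: "trig (pi / l) B Z W" and C: "trig (pi / l) C W C1"
    and cert: "\<And>z w A B C. Re (dissipation \<alpha> \<beta> \<gamma> m1 m2 m3 m4 z w A B C) \<ge> 0"
  shows "integral (period_box l) (\<lambda>x. 
      4 * \<alpha> * (norm (z x))\<^sup>2 * (z x \<bullet> Z x) + 2 * \<beta> * ((z x \<bullet> Z x) * (norm (w x))\<^sup>2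
         + (norm (z x))\<^sup>2 * (w x \<bullet> W x)) + 4 * \<gamma> * (norm (w x))\<^sup>2 * (w x \<bullet> W x)) \<le> 0"
    (is "integral ?D ?rate \<le> 0")
proof -
  note cont = trig_continuous[OF z] trig_continuous[OF w] trig_continuous[OF A] trig_continuous[OF B] trig_continuous[OF C]
  define h where "h x = dissipation \<alpha> \<beta> \<gamma> m1 m2 m3 m4 (z x) (w x) (A x) (B x) (C x)" for x
  define g where "g x = (4 * of_real \<alpha> * z x * cnj (z x)^2 * Z x + 2 * of_real \<beta> * (cnj (z x) * Z x * w x * cnj (w x)
         + z x * cnj (z x) * cnj (w x) * W x) + 4 * of_real \<gamma> * w x * cnj (w x)^2 * W x)" for x
  have hc: "continuous_on ?D h" unfolding h_def dissipation_def by (intro continuous_intros cont)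
  have gc: "continuous_on ?D g" unfolding g_def by (intro continuous_intros cont)
  have gr: "Re (g x) = ?rate x" for x
  proof -
    have zz: "z x * cnj (z x)^2 * Z x = of_real ((norm (z x))\<^sup>2) * (cnj (z x) * Z x)"
      "w x * cnj (w x)^2 * W x = of_real ((norm (w x))\<^sup>2) * (cnj (w x) * W x)"
      unfolding complex_norm_square by (simp_all add: power2_eq_square)
    have "g x = of_real (4 * \<alpha> * (norm (z x))\<^sup>2) * (cnj (z x) * Z x)
       + of_real (2 * \<beta>) * ((cnj (z x) * Z x) * of_real ((norm (w x))\<^sup>2) + of_real ((norm (z x))\<^sup>2) * (cnj (w x) * W x))
       + of_real (4 * \<gamma> * (norm (w x))\<^sup>2) * (cnj (w x) * W x)"
      unfolding of_real_mult complex_norm_square g_def by (simp add: power2_eq_square)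
    moreover have "Re (cnj a * b) = a \<bullet> b" for a b by (simp add: inner_complex_def)
    ultimately show ?thesis by simp
  qed
  have "integral ?D (\<lambda>x. g x + h x) = 0"
    using dissipation_identity[OF assms(1) z w A B C] unfolding g_def h_def .
  then have "integral ?D (\<lambda>x. Re (g x + h x)) = 0"
    using integral_linear[OF integrable_continuous[OF continuous_on_add[OF gc hc]] bounded_linear_Re]
    by (simp add: o_def)
  then have "integral ?D (\<lambda>x. Re (g x)) + integral ?D (\<lambda>x. Re (h x)) = 0"
    by (simp, subst (asm) Henstock_Kurzweil_Integration.integral_add)
       (auto intro!: integrable_continuous continuous_intros gc hc)
  moreover have "integral ?D (\<lambda>x. Re (h x)) \<ge> 0"
    by (rule Henstock_Kurzweil_Integration.integral_nonneg)
       (intro integrable_continuous continuous_intros hc, simp add: h_def cert)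
  ultimately show ?thesis unfolding gr by simp
qed

text \<open>The symbol of \<open>\<partial>\<partial>\<^sup>*\<close>, a quarter of the Laplacian, is real and nonpositive.\<close>

lemma symbol_product: "dz_symbol \<rho> k * dzbar_symbol \<rho> k = - of_real ((norm (dz_symbol \<rho> k))\<^sup>2)"
  unfolding cmod_power2 by (simp add: complex_eq_iff dz_symbol_def dzbar_symbol_def power2_eq_square)

lemma content_period_box: "l > 0 \<Longrightarrow> measure lborel (period_box l) = (2 * l)\<^sup>2"
  by (subst content_cbox_cart) (auto simp: interval_eq_empty_cart UNIV_2 power2_eq_square)

lemma norm_squared_has_derivative:
  fixes f :: "real \<Rightarrow> 'a::real_inner"
  assumes "(f has_vector_derivative f') (at t)"
  shows "((\<lambda>t. (norm (f t))\<^sup>2) has_real_derivative 2 * (f t \<bullet> f')) (at t)"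
  using has_derivative_inner[OF assms[unfolded has_vector_derivative_def] assms[unfolded has_vector_derivative_def]]
  by (auto simp: dot_square_norm has_field_derivative_def inner_commute algebra_simps elim!: has_derivative_eq_rhs)

lemma quartic_bound:
  assumes "norm z \<le> M" "norm w \<le> M"
  shows "\<bar>quartic \<alpha> \<beta> \<gamma> z w\<bar> \<le> (\<bar>\<alpha>\<bar> + \<bar>\<beta>\<bar> + \<bar>\<gamma>\<bar>) * M^4"
proof -
  have "(norm z)^4 \<le> M^4" "(norm w)^4 \<le> M^4"
    using assms by (auto intro!: power_mono)
  moreover have "(norm z)^2 * (norm w)^2 \<le> M^2 * M^2"
    using assms by (intro mult_mono power_mono) auto
  ultimately have "\<bar>\<alpha>\<bar> * (norm z)^4 \<le> \<bar>\<alpha>\<bar> * M^4" "\<bar>\<gamma>\<bar> * (norm w)^4 \<le> \<bar>\<gamma>\<bar> * M^4"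
     "\<bar>\<beta>\<bar> * ((norm z)^2 * (norm w)^2) \<le> \<bar>\<beta>\<bar> * M^4"
    by (auto intro!: mult_left_mono simp flip: power_add)
  moreover have "\<bar>quartic \<alpha> \<beta> \<gamma> z w\<bar> \<le> \<bar>\<alpha> * (norm z)^4\<bar> + \<bar>\<beta> * ((norm z)^2 * (norm w)^2)\<bar> + \<bar>\<gamma> * (norm w)^4\<bar>"
    unfolding quartic_def by (simp add: mult.assoc)
  ultimately show ?thesis by (simp add: abs_mult distrib_right)
qed

lemma continuous_on_quartic [continuous_intros]:
  "continuous_on S f \<Longrightarrow> continuous_on S g \<Longrightarrow> continuous_on S (\<lambda>x. quartic \<alpha> \<beta> \<gamma> (f x) (g x))"
  unfolding quartic_def by (intro continuous_intros)

text \<open>The heat flow \<open>\<partial>\<^sub>t \<phi> = \<partial>\<partial>\<^sup>*\<phi>\<close> of the map with Fourier coefficients \<open>c\<close>, seen through its derivatives: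
  \<open>z\<close> and \<open>w\<close> are the parts of the gradient, shifted by the parts \<open>z0\<close> and \<open>w0\<close> of the mean gradient,
  and the further capital letters are higher derivatives as in \<open>dissipation_algebra\<close>.\<close>

locale periodic_map =
  fixes l :: real and K :: "(int \<times> int) set" and c :: "int \<times> int \<Rightarrow> complex" and z0 w0 :: complex
  assumes l_pos: "l > 0" and finite_K: "finite K"
begin

abbreviation "p \<equiv> dz_symbol (pi / l)"
abbreviation "q \<equiv> dzbar_symbol (pi / l)"
definition "decay k t = exp (t *\<^sub>R (p k * q k))"
definition "z t x = z0 + (\<Sum>k\<in>K. c k * p k * decay k t * wave (pi / l) k x)"
definition "w t x = w0 + (\<Sum>k\<in>K. c k * q k * decay k t * wave (pi / l) k x)"
definition "A t x = (\<Sum>k\<in>K. c k * p k * p k * decay k t * wave (pi / l) k x)"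
definition "B t x = (\<Sum>k\<in>K. c k * p k * q k * decay k t * wave (pi / l) k x)"
definition "C t x = (\<Sum>k\<in>K. c k * q k * q k * decay k t * wave (pi / l) k x)"
definition "Z t x = (\<Sum>k\<in>K. c k * p k * p k * q k * decay k t * wave (pi / l) k x)"
definition "W t x = (\<Sum>k\<in>K. c k * p k * q k * q k * decay k t * wave (pi / l) k x)"

lemma trig_series: 
  "trig (pi / l) (\<lambda>x. \<Sum>k\<in>K. a k * wave (pi / l) k x) (\<lambda>x. \<Sum>k\<in>K. a k * p k * wave (pi / l) k x)
     (\<lambda>x. \<Sum>k\<in>K. a k * q k * wave (pi / l) k x)"
  by (intro trig_sum finite_K trig_wave)

lemma trig_fields:
  "trig (pi / l) (z t) (A t) (B t)" "trig (pi / l) (w t) (B t) (C t)"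
  "\<exists>A1. trig (pi / l) (A t) A1 (Z t)" "trig (pi / l) (B t) (Z t) (W t)" "\<exists>C1. trig (pi / l) (C t) (W t) C1"
proof -
  show "trig (pi / l) (z t) (A t) (B t)"
    by (rule trig_cong[OF trig_add[OF trig_const[of _ z0] trig_series[of "\<lambda>k. c k * p k * decay k t"]]])
      (simp_all add: z_def A_def B_def mult_ac)
  show "trig (pi / l) (w t) (B t) (C t)"
    by (rule trig_cong[OF trig_add[OF trig_const[of _ w0] trig_series[of "\<lambda>k. c k * q k * decay k t"]]])
      (simp_all add: w_def B_def C_def mult_ac)
  show "trig (pi / l) (B t) (Z t) (W t)"
    by (rule trig_cong[OF trig_series[of "\<lambda>k. c k * p k * q k * decay k t"]])
      (simp_all add: B_def Z_def W_def mult_ac)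
  show "\<exists>A1. trig (pi / l) (A t) A1 (Z t)"
    by (rule exI, rule trig_cong[OF trig_series[of "\<lambda>k. c k * p k * p k * decay k t"]])
      (simp_all add: A_def Z_def mult_ac)
  show "\<exists>C1. trig (pi / l) (C t) (W t) C1"
    by (rule exI, rule trig_cong[OF trig_series[of "\<lambda>k. c k * q k * q k * decay k t"]])
      (simp_all add: C_def W_def mult_ac)
qed

lemma decay_derivative:
  "((\<lambda>t. decay k t) has_vector_derivative p k * q k * decay k t) (at t)"
  using exp_scaleR_has_vector_derivative_left[of "p k * q k" t] by (simp add: decay_def)

lemma heat_equation:
  "((\<lambda>t. z t x) has_vector_derivative Z t x) (at t)" "((\<lambda>t. w t x) has_vector_derivative W t x) (at t)"
proof -
  have d: "((\<lambda>t. a * decay k t * b) has_vector_derivative a * (p k * q k * decay k t) * b) (at t)" for a b k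
    by (intro has_vector_derivative_mult_left has_vector_derivative_mult_right decay_derivative)
  have s: "((\<lambda>t. y + (\<Sum>k\<in>K. a k * decay k t * b k)) has_vector_derivative
     0 + (\<Sum>k\<in>K. a k * (p k * q k * decay k t) * b k)) (at t)" for y a b
    by (intro has_vector_derivative_add has_vector_derivative_const has_vector_derivative_sum d)
  show "((\<lambda>t. z t x) has_vector_derivative Z t x) (at t)" "((\<lambda>t. w t x) has_vector_derivative W t x) (at t)"
    using s[of z0 "\<lambda>k. c k * p k" "\<lambda>k. wave (pi / l) k x"] s[of w0 "\<lambda>k. c k * q k" "\<lambda>k. wave (pi / l) k x"]
    unfolding z_def Z_def w_def W_def by (simp_all add: mult.assoc mult.left_commute)
qed

lemma continuous_fields:
  "continuous_on S (\<lambda>y. z (fst y) (snd y))" "continuous_on S (\<lambda>y. w (fst y) (snd y))"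
  "continuous_on S (\<lambda>y. Z (fst y) (snd y))" "continuous_on S (\<lambda>y. W (fst y) (snd y))"
  unfolding z_def w_def Z_def W_def decay_def by (intro continuous_intros)+

lemma decay_bound: "t \<ge> 0 \<Longrightarrow> norm (decay k t) \<le> 1"
  by (simp add: decay_def symbol_product)

lemma decay_limit: 
  assumes "p k \<noteq> 0"
  shows "(\<lambda>n. decay k (real n)) \<longlonglongrightarrow> 0"
proof -
  have "decay k (real n) = (decay k 1) ^ n" for n
    by (simp add: decay_def scaleR_conv_of_real flip: exp_of_nat_mult)
  moreover have "norm (decay k 1) < 1"
    using assms by (simp add: decay_def symbol_product)
  ultimately show ?thesis using LIMSEQ_power_zero[of "decay k 1"] by simp
qed


end

context periodic_map begin
text \<open>All modes decay except those of frequency zero, and these do not contribute to a gradient.\<close>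

lemma fields_limit: "(\<lambda>n. z (real n) x) \<longlonglongrightarrow> z0" "(\<lambda>n. w (real n) x) \<longlonglongrightarrow> w0"
proof -
  have q0: "p k = 0 \<Longrightarrow> q k = 0" for k by (simp add: dz_symbol_def dzbar_symbol_def complex_eq_iff)
  have vanish: "(\<lambda>n. a * s * decay k (real n) * b) \<longlonglongrightarrow> 0" if "s \<noteq> 0 \<Longrightarrow> p k \<noteq> 0" for a b s k
  proof (cases "s = 0")
    case False
    have "(\<lambda>n. a * s * decay k (real n) * b) \<longlonglongrightarrow> a * s * 0 * b"
      by (intro tendsto_intros decay_limit that False)
    then show ?thesis by simp
  qed simp
  have "(\<lambda>n. z (real n) x) \<longlonglongrightarrow> z0 + (\<Sum>k\<in>K. 0)" unfolding z_def
    by (intro tendsto_intros vanish) auto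
  then show "(\<lambda>n. z (real n) x) \<longlonglongrightarrow> z0" by simp
  have "(\<lambda>n. w (real n) x) \<longlonglongrightarrow> w0 + (\<Sum>k\<in>K. 0)" unfolding w_def
    by (intro tendsto_intros vanish) (use q0 in auto)
  then show "(\<lambda>n. w (real n) x) \<longlonglongrightarrow> w0" by simp
qed

lemma fields_bound:
  "\<exists>M. \<forall>t\<ge>0. \<forall>x. norm (z t x) \<le> M \<and> norm (w t x) \<le> M"
proof -
  define M where "M = norm z0 + norm w0 + (\<Sum>k\<in>K. norm (c k * p k)) + (\<Sum>k\<in>K. norm (c k * q k))"
  have s: "norm (\<Sum>k\<in>K. a k * decay k t * wave (pi / l) k x) \<le> (\<Sum>k\<in>K. norm (a k))" if "t \<ge> 0" for a t x
    by (intro sum_norm_le) (auto simp: norm_mult intro!: mult_left_le decay_bound that)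
  have "norm (z t x) \<le> M" "norm (w t x) \<le> M" if "t \<ge> 0" for t x
  proof -
    have "norm (z t x) \<le> norm z0 + (\<Sum>k\<in>K. norm (c k * p k))"
      unfolding z_def by (intro norm_triangle_mono order_refl s that)
    moreover have "norm (w t x) \<le> norm w0 + (\<Sum>k\<in>K. norm (c k * q k))"
      unfolding w_def by (intro norm_triangle_mono order_refl s that)
    moreover have "(\<Sum>k\<in>K. norm (c k * p k)) \<ge> 0" "(\<Sum>k\<in>K. norm (c k * q k)) \<ge> 0" by (auto intro: sum_nonneg)
    ultimately show "norm (z t x) \<le> M" "norm (w t x) \<le> M"
      using norm_ge_zero[of z0] norm_ge_zero[of w0] unfolding M_def by linarith+
  qed
  then show ?thesis by blast
qed

definition "energy \<alpha> \<beta> \<gamma> t = integral (period_box l) (\<lambda>x. quartic \<alpha> \<beta> \<gamma> (z t x) (w t x))"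

definition "energy_rate \<alpha> \<beta> \<gamma> t x = 
      4 * \<alpha> * (norm (z t x))\<^sup>2 * (z t x \<bullet> Z t x) + 2 * \<beta> * ((z t x \<bullet> Z t x) * (norm (w t x))\<^sup>2
         + (norm (z t x))\<^sup>2 * (w t x \<bullet> W t x)) + 4 * \<gamma> * (norm (w t x))\<^sup>2 * (w t x \<bullet> W t x)"

lemma energy_derivative:
  "(energy \<alpha> \<beta> \<gamma> has_vector_derivative integral (period_box l) (energy_rate \<alpha> \<beta> \<gamma> t)) (at t)"
proof -
  have poly: "((\<lambda>t. \<alpha> * (X t)^2 + \<beta> * X t * Y t + \<gamma> * (Y t)^2) has_real_derivative
      2 * \<alpha> * X t * X' + \<beta> * (X' * Y t + X t * Y') + 2 * \<gamma> * Y t * Y') (at t)"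
    if "(X has_real_derivative X') (at t)" "(Y has_real_derivative Y') (at t)" for X Y X' Y' t
    using that by (auto intro!: derivative_eq_intros simp: algebra_simps)
  have "((\<lambda>t. integral (period_box l) (\<lambda>x. quartic \<alpha> \<beta> \<gamma> (z t x) (w t x))) has_vector_derivative
     integral (period_box l) (energy_rate \<alpha> \<beta> \<gamma> t)) (at t within UNIV)"
  proof (rule leibniz_rule_vector_derivative)
    fix t x
    have q: "quartic \<alpha> \<beta> \<gamma> (z t x) (w t x) = \<alpha> * ((norm (z t x))\<^sup>2)^2 + \<beta> * (norm (z t x))\<^sup>2 * (norm (w t x))\<^sup>2
        + \<gamma> * ((norm (w t x))\<^sup>2)^2" for t x
      by (simp add: quartic_def flip: power_mult)
    show "((\<lambda>t. quartic \<alpha> \<beta> \<gamma> (z t x) (w t x)) has_vector_derivative energy_rate \<alpha> \<beta> \<gamma> t x) (at t within UNIV)"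
      using poly[OF norm_squared_has_derivative[OF heat_equation(1)] norm_squared_has_derivative[OF heat_equation(2)]]
      unfolding q has_real_derivative_iff_has_vector_derivative[symmetric]
      by (simp add: energy_rate_def algebra_simps)
  next
    show "(\<lambda>x. quartic \<alpha> \<beta> \<gamma> (z t x) (w t x)) integrable_on period_box l" for t
      using trig_fields(1,2)[of t, THEN trig_continuous(1)] by (intro integrable_continuous continuous_intros)
  next
    show "continuous_on (UNIV \<times> period_box l) (\<lambda>(t, x). energy_rate \<alpha> \<beta> \<gamma> t x)"
      unfolding energy_rate_def split_beta by (intro continuous_intros continuous_fields)
  qed auto
  then show ?thesis by (simp add: energy_def[abs_def])
qed

lemma energy_decreasing:
  assumes cert: "\<And>z w A B C. Re (dissipation \<alpha> \<beta> \<gamma> m1 m2 m3 m4 z w A B C) \<ge> 0" and "0 \<le> t"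
  shows "energy \<alpha> \<beta> \<gamma> t \<le> energy \<alpha> \<beta> \<gamma> 0"
proof (rule DERIV_nonpos_imp_nonincreasing[OF assms(2)])
  fix s
  obtain A1 C1 where tr: "trig (pi / l) (A s) A1 (Z s)" "trig (pi / l) (C s) (W s) C1"
    using trig_fields(3,5) by blast
  have "integral (period_box l) (energy_rate \<alpha> \<beta> \<gamma> s) \<le> 0"
    using energy_rate_nonpos[OF l_pos trig_fields(1,2) tr(1) trig_fields(4) tr(2) cert]
    unfolding energy_rate_def .
  then show "\<exists>y. (energy \<alpha> \<beta> \<gamma> has_real_derivative y) (at s) \<and> y \<le> 0"
    using energy_derivative has_real_derivative_iff_has_vector_derivative by blast
qed

lemma energy_limit: "(\<lambda>n. energy \<alpha> \<beta> \<gamma> (real n)) \<longlonglongrightarrow> (2 * l)\<^sup>2 * quartic \<alpha> \<beta> \<gamma> z0 w0"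
proof -
  obtain M where M: "\<And>t x. t \<ge> 0 \<Longrightarrow> norm (z t x) \<le> M \<and> norm (w t x) \<le> M" using fields_bound by blast
  have "(\<lambda>n. integral (period_box l) (\<lambda>x. quartic \<alpha> \<beta> \<gamma> (z (real n) x) (w (real n) x)))
     \<longlonglongrightarrow> integral (period_box l) (\<lambda>x. quartic \<alpha> \<beta> \<gamma> z0 w0)"
  proof (rule dominated_convergence(2)[where h="\<lambda>_. (\<bar>\<alpha>\<bar> + \<bar>\<beta>\<bar> + \<bar>\<gamma>\<bar>) * M^4"])
    show "(\<lambda>x. quartic \<alpha> \<beta> \<gamma> (z (real n) x) (w (real n) x)) integrable_on period_box l" for n
      using trig_fields(1,2)[of "real n", THEN trig_continuous(1)] by (intro integrable_continuous continuous_intros)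
    show "norm (quartic \<alpha> \<beta> \<gamma> (z (real n) x) (w (real n) x)) \<le> (\<bar>\<alpha>\<bar> + \<bar>\<beta>\<bar> + \<bar>\<gamma>\<bar>) * M^4" for n x
      using M[of "real n"] by (auto intro!: quartic_bound)
    show "(\<lambda>n. quartic \<alpha> \<beta> \<gamma> (z (real n) x) (w (real n) x)) \<longlonglongrightarrow> quartic \<alpha> \<beta> \<gamma> z0 w0" for x
      unfolding quartic_def by (intro tendsto_intros fields_limit)
  qed auto
  then show ?thesis using l_pos by (simp add: energy_def content_period_box)
qed

text \<open>The energy at time zero dominates its limit, which is the energy of the constant gradient.\<close>

lemma quasiconvex_dissipative:
  assumes "\<exists>m1 m2 m3 m4. \<forall>z w A B C. Re (dissipation \<alpha> \<beta> \<gamma> m1 m2 m3 m4 z w A B C) \<ge> 0"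
  shows "(2 * l)\<^sup>2 * quartic \<alpha> \<beta> \<gamma> z0 w0 \<le> energy \<alpha> \<beta> \<gamma> 0"
proof -
  obtain m1 m2 m3 m4 where "\<And>z w A B C. Re (dissipation \<alpha> \<beta> \<gamma> m1 m2 m3 m4 z w A B C) \<ge> 0"
    using assms by blast
  from energy_decreasing[OF this] show ?thesis
    by (intro LIMSEQ_le_const2[OF energy_limit]) auto
qed

text \<open>The coefficients \<open>(1, -2, 1)\<close> give the square of \<open>J = |z|\<^sup>2 - |w|\<^sup>2\<close>, the determinant. The difference of
  \<open>J\<close> and its value \<open>J0\<close> at the mean gradient is a divergence, thus \<open>J\<close> has mean \<open>J0\<close> and Jensen's
  inequality applies.\<close>

lemma quasiconvex_det_squared: "(2 * l)\<^sup>2 * quartic 1 (-2) 1 z0 w0 \<le> energy 1 (-2) 1 0"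
proof -
  define \<phi> where "\<phi> x = (\<Sum>k\<in>K. c k * wave (pi / l) k x)" for x
  define \<zeta> \<omega> where "\<zeta> x = (\<Sum>k\<in>K. c k * p k * wave (pi / l) k x)"
    and "\<omega> x = (\<Sum>k\<in>K. c k * q k * wave (pi / l) k x)" for x
  have d: "decay k 0 = 1" for k by (simp add: decay_def)
  have zw: "z 0 x = z0 + \<zeta> x" "w 0 x = w0 + \<omega> x" for x by (simp_all add: z_def w_def d \<zeta>_def \<omega>_def)
  have t: "trig (pi / l) \<phi> \<zeta> \<omega>" "trig (pi / l) \<zeta> (A 0) (B 0)" "trig (pi / l) \<omega> (B 0) (C 0)"
    by (rule trig_cong[OF trig_series[of c]], simp_all add: \<phi>_def \<zeta>_def \<omega>_def)
       (rule trig_cong[OF trig_series[of "\<lambda>k. c k * p k"]], simp_all add: A_def B_def \<zeta>_def d mult_ac,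
        rule trig_cong[OF trig_series[of "\<lambda>k. c k * q k"]], simp_all add: B_def C_def \<omega>_def d mult_ac)
  define J where "J x = (norm (z 0 x))\<^sup>2 - (norm (w 0 x))\<^sup>2" for x
  define J0 where "J0 = (norm z0)\<^sup>2 - (norm w0)\<^sup>2"
  note P = trig_add[OF trig_mult[OF t(1) trig_cnj[OF t(2)]] trig_add[OF trig_scale[OF t(1), of "cnj z0"] trig_scale[OF trig_cnj[OF t(1)], of "-w0"]]]
  note S = trig_add[OF trig_minus[OF trig_mult[OF t(1) trig_cnj[OF t(3)]]] trig_add[OF trig_scale[OF t(1), of "-cnj w0"] trig_scale[OF trig_cnj[OF t(1)], of z0]]]
  have Jc: "continuous_on (period_box l) J"
    unfolding J_def using trig_fields(1,2)[of 0, THEN trig_continuous(1)] by (intro continuous_intros)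
  have "((\<lambda>x. of_real (J x - J0) :: complex) has_integral 0) (period_box l)"
  proof -
    note 1 = integrable_integral[OF trig_continuous(2)[OF P, THEN integrable_continuous[where a="vec (-l)" and b="vec l"]], unfolded trig_derivative_integral(1)[OF P l_pos]]
    note 2 = integrable_integral[OF trig_continuous(3)[OF S, THEN integrable_continuous[where a="vec (-l)" and b="vec l"]], unfolded trig_derivative_integral(2)[OF S l_pos]]
    show ?thesis
      by (rule has_integral_eq_rhs[OF has_integral_eq[OF _ has_integral_add[OF 1 2]]])
         (simp only: J_def J0_def zw of_real_diff complex_norm_square, simp_all add: algebra_simps)
  qed
  from has_integral_linear[OF this bounded_linear_Re] have "((\<lambda>x. J x - J0) has_integral 0) (period_box l)"
    by (simp add: o_def)
  from has_integral_add[OF has_integral_mult_right[OF this, of "2 * J0"] has_integral_const[of "J0\<^sup>2"]]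
  have lin: "((\<lambda>x. 2 * J0 * (J x - J0) + J0\<^sup>2) has_integral (2 * l)\<^sup>2 * J0\<^sup>2) (period_box l)"
    using l_pos by (simp add: content_period_box)
  have q: "quartic 1 (-2) 1 a b = ((norm a)\<^sup>2 - (norm b)\<^sup>2)\<^sup>2" for a b
    unfolding quartic_def by algebra
  have "(2 * l)\<^sup>2 * J0\<^sup>2 \<le> integral (period_box l) (\<lambda>x. (J x)\<^sup>2)"
  proof (rule has_integral_le[OF lin])
    show "((\<lambda>x. (J x)\<^sup>2) has_integral integral (period_box l) (\<lambda>x. (J x)\<^sup>2)) (period_box l)"
      by (intro integrable_integral integrable_continuous continuous_intros Jc)
    have "0 \<le> (J x - J0)\<^sup>2" for x by simp
    then show "2 * J0 * (J x - J0) + J0\<^sup>2 \<le> (J x)\<^sup>2" for x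
      by (simp add: power2_eq_square algebra_simps)
  qed
  then show ?thesis unfolding energy_def q J_def J0_def .
qed

lemma energy_linear:
  "energy (a * \<alpha> + b * \<alpha>') (a * \<beta> + b * \<beta>') (a * \<gamma> + b * \<gamma>') t = a * energy \<alpha> \<beta> \<gamma> t + b * energy \<alpha>' \<beta>' \<gamma>' t"
proof -
  note c = trig_fields(1,2)[of t, THEN trig_continuous(1)]
  show ?thesis unfolding energy_def quartic_combination
    by (subst Henstock_Kurzweil_Integration.integral_add)
       (auto intro!: integrable_continuous continuous_intros c)
qed

lemma quasiconvex_combination:
  assumes "a \<ge> 0" "b \<ge> 0"
    and "(2 * l)\<^sup>2 * quartic \<alpha> \<beta> \<gamma> z0 w0 \<le> energy \<alpha> \<beta> \<gamma> 0"
    and "(2 * l)\<^sup>2 * quartic \<alpha>' \<beta>' \<gamma>' z0 w0 \<le> energy \<alpha>' \<beta>' \<gamma>' 0"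
  shows "(2 * l)\<^sup>2 * quartic (a * \<alpha> + b * \<alpha>') (a * \<beta> + b * \<beta>') (a * \<gamma> + b * \<gamma>') z0 w0
    \<le> energy (a * \<alpha> + b * \<alpha>') (a * \<beta> + b * \<beta>') (a * \<gamma> + b * \<gamma>') 0"
  unfolding energy_linear quartic_combination
  using mult_left_mono[OF assms(3,1)] mult_left_mono[OF assms(4,2)] by (simp add: algebra_simps)

text \<open>Decomposition into generators of the cone. For \<open>\<beta> \<le> 0\<close> the square of the determinant accounts for the
  mixed term. For \<open>\<beta> > 0\<close> choose \<open>s\<close> so that \<open>\<beta>/6 Q\<^sub>s\<close> has the right coefficients at \<open>|z|\<^sup>4\<close> and
  \<open>|z|\<^sup>2 |w|\<^sup>2\<close>; the last condition says that the remaining multiple of \<open>|w|\<^sup>4\<close> is nonnegative.\<close>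

lemma periodic_quasiconvex:
  assumes a: "2*\<alpha> + \<beta> \<ge> 0" and g: "2*\<gamma> + \<beta> \<ge> 0" and u: "6*\<alpha> + \<beta> \<ge> 0" and v: "6*\<gamma> + \<beta> \<ge> 0"
    and uv: "4*\<beta>\<^sup>2 \<le> (6*\<alpha> + \<beta>) * (6*\<gamma> + \<beta>)"
  shows "(2 * l)\<^sup>2 * quartic \<alpha> \<beta> \<gamma> z0 w0 \<le> energy \<alpha> \<beta> \<gamma> 0"
proof -
  note pure = quasiconvex_dissipative[OF dissipation_nonneg_power4(1)] quasiconvex_dissipative[OF dissipation_nonneg_power4(2)]
  show ?thesis
  proof (cases "\<beta> \<le> 0")
    case True
    define b where "b = - \<beta> / 2"
    have "b \<ge> 0" "\<alpha> - b \<ge> 0" "\<gamma> - b \<ge> 0" using True a g by (auto simp: b_def field_simps)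
    from quasiconvex_combination[OF this(1) zero_le_one quasiconvex_det_squared quasiconvex_combination[OF this(2,3) pure]]
    show ?thesis by (simp add: b_def)
  next
    case False
    define s where "s = (6*\<alpha> + \<beta>) / (2*\<beta>)"
    have "4*\<beta>\<^sup>2 > 0" using False by simp
    with uv u v have u0: "6*\<alpha> + \<beta> > 0" by (metis less_le_trans mult_zero_left order_le_less order_less_irrefl)
    then have s: "s > 0" using False by (simp add: s_def)
    have \<alpha>: "\<alpha> = \<beta>/6 * (2 * s - 1)" using False by (simp add: s_def field_simps)
    have "2/s = 4*\<beta> / (6*\<alpha> + \<beta>)" using False u0 by (simp add: s_def field_simps)
    then have "\<beta>/6 * (2/s - 1) = (4*\<beta>\<^sup>2 / (6*\<alpha> + \<beta>) - \<beta>) / 6" by (simp add: field_simps power2_eq_square)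
    also have "4*\<beta>\<^sup>2 / (6*\<alpha> + \<beta>) \<le> 6*\<gamma> + \<beta>" using uv u0 by (simp add: field_simps)
    finally have "\<gamma> - \<beta>/6 * (2/s - 1) \<ge> 0" by simp
    moreover have "\<beta>/6 \<ge> 0" using False by simp
    moreover have e: "\<beta>/6 * (2 * s - 1) + (\<gamma> - \<beta>/6 * (2/s - 1)) * 0 = \<alpha>"
      "\<beta>/6 * 6 + (\<gamma> - \<beta>/6 * (2/s - 1)) * 0 = \<beta>"
      "\<beta>/6 * (2/s - 1) + (\<gamma> - \<beta>/6 * (2/s - 1)) * 1 = \<gamma>"
      using \<alpha> by simp_all
    ultimately show ?thesis
      using quasiconvex_combination[OF _ _ quasiconvex_dissipative[OF dissipation_nonneg_extremal[OF s]] pure(2),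
         of "\<beta>/6" "\<gamma> - \<beta>/6 * (2/s - 1)"] unfolding e by blast
  qed
qed

end

section \<open>Integration by parts\<close>

lemma partial_derivative_eq:
  "(f has_derivative f') (at x) \<Longrightarrow> partial_derivative j f x = f' (axis j 1)"
  unfolding partial_derivative_def by (subst frechet_derivative_at[symmetric]) auto

lemma partial_derivative_along_line:
  fixes f :: "real^'n \<Rightarrow> 'b::real_normed_vector"
  assumes "f differentiable (at (x + t *\<^sub>R axis j 1))"
  shows "((\<lambda>t. f (x + t *\<^sub>R axis j 1)) has_vector_derivative partial_derivative j f (x + t *\<^sub>R axis j 1)) (at t)"
proof -
  have f: "(f has_derivative frechet_derivative f (at (x + t *\<^sub>R axis j 1))) (at (x + t *\<^sub>R axis j 1))"
    using assms frechet_derivative_works by blast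
  have "((\<lambda>t. x + t *\<^sub>R axis j 1) has_derivative (\<lambda>h. h *\<^sub>R axis j 1)) (at t)"
    by (auto intro!: derivative_eq_intros)
  from has_derivative_compose[OF this f] linear_scale[OF has_derivative_linear[OF f]]
  show ?thesis
    unfolding has_vector_derivative_def partial_derivative_def by simp
qed

lemma compact_support_integrable:
  fixes f :: "'a::euclidean_space \<Rightarrow> 'b::euclidean_space"
  assumes "continuous_on UNIV f" "compact K" "\<And>x. x \<notin> K \<Longrightarrow> f x = 0"
  shows "integrable lborel f" "integrable lebesgue f" "U \<in> sets lebesgue \<Longrightarrow> integrable (lebesgue_on U) f"
proof -
  have "(\<lambda>x. indicator K x *\<^sub>R f x) = f" using assms(3) by (auto simp: indicator_def)
  moreover have "integrable lborel (\<lambda>x. indicator K x *\<^sub>R f x)"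
    using borel_integrable_compact[OF assms(2)] continuous_on_subset[OF assms(1)] by blast
  ultimately show *: "integrable lborel f" by simp
  then show **: "integrable lebesgue f"
    using integrable_completion borel_measurable_integrable by blast
  show "integrable (lebesgue_on U) f" if "U \<in> sets lebesgue"
    using integrable_mult_indicator[OF that **] that by (subst integrable_restrict_space) auto
qed

lemma partial_derivative_outside_support:
  fixes f :: "real^'n \<Rightarrow> 'b::real_normed_vector"
  assumes "closed K" "\<And>x. x \<notin> K \<Longrightarrow> f x = 0" "x \<notin> K"
  shows "partial_derivative j f x = 0"
proof -
  have "(f has_derivative (\<lambda>_. 0)) (at x)"
    by (rule has_derivative_transform_within_open[of "\<lambda>_. 0" _ x UNIV "- K"]) (use assms in auto)
  from partial_derivative_eq[OF this] show ?thesis .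
qed

text \<open>Translation invariance of Lebesgue measure shows that difference quotients integrate to zero; they
  converge dominatedly because the support is compact and the derivative is bounded.\<close>

lemma integral_partial_derivative_eq_0:
  fixes f :: "real^'n \<Rightarrow> 'b::euclidean_space"
  assumes diff: "\<And>x. f differentiable (at x)"
    and cont: "continuous_on UNIV (partial_derivative j f)"
    and K: "compact K" "\<And>x. x \<notin> K \<Longrightarrow> f x = 0"
  shows "integral\<^sup>L lborel (partial_derivative j f) = 0"
proof -
  define g where "g = partial_derivative j f"
  define e where "e = (axis j 1 :: real^'n)"
  have g0: "x \<notin> K \<Longrightarrow> g x = 0" for x
    unfolding g_def by (rule partial_derivative_outside_support[OF compact_imp_closed[OF K(1)] K(2)])
  have fcont: "continuous_on UNIV f"
    using diff by (simp add: continuous_at_imp_continuous_on differentiable_imp_continuous_within)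
  note fint = compact_support_integrable(1)[OF fcont K] and gint = compact_support_integrable(1)[OF cont K(1) g0[unfolded g_def]]
  obtain B where B: "\<And>x. norm (g x) \<le> B"
  proof -
    have "bounded (g ` K)" unfolding g_def
      by (intro compact_imp_bounded compact_continuous_image K(1) continuous_on_subset[OF cont]) auto
    then obtain B where "\<And>x. x \<in> K \<Longrightarrow> norm (g x) \<le> B" by (auto simp: bounded_iff)
    then have "norm (g x) \<le> max B 0" for x using g0[of x] by (cases "x \<in> K") (auto simp: le_max_iff_disj)
    then show ?thesis using that by blast
  qed
  (* Contains the support of every difference quotient with step at most 1. *)
  define K' where "K' = {x - y | x y. x \<in> K \<and> y \<in> (\<lambda>t. t *\<^sub>R e) ` {0..1::real}}"
  have K': "compact K'" unfolding K'_def
    by (intro compact_differences K(1) compact_continuous_image continuous_intros) auto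
  define u where "u n x = real (Suc n) *\<^sub>R (f (inverse (real (Suc n)) *\<^sub>R e + x) - f x)" for n x
  have shift: "integral\<^sup>L lborel (\<lambda>x. f (c + x)) = integral\<^sup>L lborel f \<and> integrable lborel (\<lambda>x. f (c + x))" for c
  proof -
    have [measurable]: "f \<in> borel_measurable borel" using fcont by (rule borel_measurable_continuous_onI)
    show ?thesis
      using integral_distr[of "(+) c" lborel borel f] integrable_distr_eq[of "(+) c" lborel borel f] fint
      by (simp add: lborel_distr_plus)
  qed
  have u: "integral\<^sup>L lborel (u n) = 0" "integrable lborel (u n)" for n
    unfolding u_def using shift[of "inverse (real (Suc n)) *\<^sub>R e"] fint by auto
  have line: "((\<lambda>t. f (x + t *\<^sub>R e)) has_vector_derivative g (x + t *\<^sub>R e)) (at t)" for x t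
    unfolding e_def g_def by (rule partial_derivative_along_line[OF diff])
  have "(\<lambda>n. integral\<^sup>L lborel (u n)) \<longlonglongrightarrow> integral\<^sup>L lborel g"
  proof (rule integral_dominated_convergence[where w="\<lambda>x. indicator K' x *\<^sub>R B"])
    show "integrable lborel (\<lambda>x. indicator K' x *\<^sub>R B)"
      using borel_integrable_compact[OF K' continuous_on_const] .
    show "AE x in lborel. (\<lambda>n. u n x) \<longlonglongrightarrow> g x"
    proof (rule AE_I2)
      fix x
      have lim: "((\<lambda>h. norm (f (x + h *\<^sub>R e) - f x - h *\<^sub>R g x) / norm h) \<longlongrightarrow> 0) (at 0)"
        using line[of x 0] unfolding has_vector_derivative_def has_derivative_at by simp
      have eq: "norm (f (x + h *\<^sub>R e) - f x - h *\<^sub>R g x) / norm h = norm ((f (x + h *\<^sub>R e) - f x) /\<^sub>R h - g x)"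
        if "h \<noteq> 0" for h
      proof -
        have "(f (x + h *\<^sub>R e) - f x) /\<^sub>R h - g x = (f (x + h *\<^sub>R e) - f x - h *\<^sub>R g x) /\<^sub>R h"
          using that by (simp add: scaleR_diff_right)
        then show ?thesis by (simp add: divide_inverse mult.commute)
      qed
      have "((\<lambda>h. norm ((f (x + h *\<^sub>R e) - f x) /\<^sub>R h - g x)) \<longlongrightarrow> 0) (at 0)"
        by (rule Lim_transform_eventually[OF lim]) (unfold eventually_at_filter, rule always_eventually, use eq in blast)
      then have "((\<lambda>h. (f (x + h *\<^sub>R e) - f x) /\<^sub>R h) \<longlongrightarrow> g x) (at 0)"
        by (subst Lim_null) (rule tendsto_norm_zero_cancel)
      moreover have "filterlim (\<lambda>n. inverse (real (Suc n))) (at 0) sequentially"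
        unfolding filterlim_at by (intro conjI LIMSEQ_inverse_real_of_nat always_eventually) auto
      ultimately have "(\<lambda>n. (f (x + inverse (real (Suc n)) *\<^sub>R e) - f x) /\<^sub>R inverse (real (Suc n))) \<longlonglongrightarrow> g x"
        by (rule filterlim_compose)
      then show "(\<lambda>n. u n x) \<longlonglongrightarrow> g x"
        unfolding u_def inverse_inverse_eq by (simp only: add.commute)
    qed
    show "AE x in lborel. norm (u n x) \<le> indicator K' x *\<^sub>R B" for n
    proof (rule AE_I2)
      fix x
      define h where "h = inverse (real (Suc n))"
      have h: "h > 0" "h \<le> 1" by (auto simp: h_def field_simps)
      have hn: "real (Suc n) = inverse h" by (simp add: h_def)
      show "norm (u n x) \<le> indicator K' x *\<^sub>R B"
      proof (cases "x \<in> K'")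
        case True
        have "norm (f (x + h *\<^sub>R e) - f (x + 0 *\<^sub>R e)) \<le> B * norm (h - 0)"
        proof (rule differentiable_bound[of UNIV])
          show "((\<lambda>t. f (x + t *\<^sub>R e)) has_derivative (\<lambda>s. s *\<^sub>R g (x + t *\<^sub>R e))) (at t)" for t
            using line[of x t] unfolding has_vector_derivative_def .
          show "onorm (\<lambda>s. s *\<^sub>R g (x + t *\<^sub>R e)) \<le> B" for t
            using B[of "x + t *\<^sub>R e"] onorm_scaleR_left[OF bounded_linear_ident, of "g (x + t *\<^sub>R e)"]
            by (simp add: onorm_id)
        qed auto
        then have "norm (inverse h *\<^sub>R (f (h *\<^sub>R e + x) - f x)) \<le> B"
          unfolding norm_scaleR using h by (simp add: add.commute divide_simps mult.commute)
        then show ?thesis using True by (simp add: u_def hn del: of_nat_Suc)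
      next
        case False
        have "f (x + t *\<^sub>R e) = 0" if "t \<in> {0..1}" for t
        proof (rule K(2), rule notI)
          assume "x + t *\<^sub>R e \<in> K"
          moreover have "x = (x + t *\<^sub>R e) - t *\<^sub>R e" by simp
          ultimately have "x \<in> K'" unfolding K'_def using that by blast
          with False show False ..
        qed
        from this[of h] this[of 0] have "u n x = 0" using h by (simp add: u_def hn add.commute del: of_nat_Suc)
        then show ?thesis using False by simp
      qed
    qed
  qed (use gint u(2) in \<open>auto simp: g_def intro: borel_measurable_integrable\<close>)
  then show ?thesis unfolding u(1) g_def by (simp add: LIMSEQ_const_iff)
qed

lemma smooth_C1:
  assumes "smooth f"
  shows "f differentiable (at x)" "continuous_on UNIV (partial_derivative j f)" "continuous_on UNIV f"
proof -
  have "k_times_continuously_differentiable 1 f" "k_times_continuously_differentiable 0 f"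
    using assms unfolding smooth_def by blast+
  then show "f differentiable (at x)" "continuous_on UNIV (partial_derivative j f)" "continuous_on UNIV f"
    by auto
qed

lemma integral_lebesgue_on_eq_lborel:
  fixes f :: "real^'n \<Rightarrow> 'b::euclidean_space"
  assumes "continuous_on UNIV f" "U \<in> sets lebesgue" "\<And>x. x \<notin> U \<Longrightarrow> f x = 0"
  shows "integral\<^sup>L (lebesgue_on U) f = integral\<^sup>L lborel f"
proof -
  have "integral\<^sup>L (lebesgue_on U) f = integral\<^sup>L lebesgue (\<lambda>x. indicator U x *\<^sub>R f x)"
    using assms(2) by (intro integral_restrict_space) auto
  also have "(\<lambda>x. indicator U x *\<^sub>R f x) = f" using assms(3) by (auto simp: indicator_def)
  also have "integral\<^sup>L lebesgue f = integral\<^sup>L lborel f"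
    using borel_measurable_continuous_onI[OF assms(1)] by (intro integral_completion) simp
  finally show ?thesis .
qed

lemma partial_derivative_component:
  fixes \<psi> :: "real^'n \<Rightarrow> real^'m"
  assumes "\<psi> differentiable (at x)"
  shows "((\<lambda>x. \<psi> x $ i) has_derivative (\<lambda>h. frechet_derivative \<psi> (at x) h $ i)) (at x)"
  using bounded_linear.has_derivative[OF bounded_linear_vec_nth] assms frechet_derivative_works by blast

lemma jacobian_component: "jacobian \<psi> (at x) $ i $ j = partial_derivative j \<psi> x $ i"
  by (simp add: jacobian_def matrix_def partial_derivative_def)

lemma continuous_on_jacobian:
  fixes \<psi> :: "real^'n \<Rightarrow> real^'m"
  assumes "smooth \<psi>"
  shows "continuous_on UNIV (\<lambda>x. jacobian \<psi> (at x))"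
proof -
  have "(\<lambda>x. jacobian \<psi> (at x)) = (\<lambda>x. \<chi> i j. partial_derivative j \<psi> x $ i)"
    by (simp add: fun_eq_iff vec_eq_iff jacobian_component)
  then show ?thesis
    by (simp only:) (intro continuous_on_vec_lambda continuous_intros smooth_C1(2)[OF assms])
qed

lemma jacobian_outside_support:
  fixes \<psi> :: "real^'n \<Rightarrow> real^'m"
  assumes "compact K" "\<And>x. x \<notin> K \<Longrightarrow> \<psi> x = 0" "x \<notin> K"
  shows "jacobian \<psi> (at x) = 0"
  unfolding vec_eq_iff jacobian_component
  using partial_derivative_outside_support[OF compact_imp_closed[OF assms(1)] assms(2,3)] by simp

lemma test_function_integration_by_parts:
  fixes \<psi> :: "real^'n \<Rightarrow> real^'m" and \<eta> :: "real^'n \<Rightarrow> 'b::euclidean_space"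
  assumes "test_function U \<psi>" "U \<in> sets lebesgue"
    and \<eta>: "\<And>x. \<eta> differentiable (at x)" "continuous_on UNIV (partial_derivative j \<eta>)"
  shows "(\<integral>x. (jacobian \<psi> (at x) $ i $ j) *\<^sub>R \<eta> x \<partial>lebesgue_on U)
     = - (\<integral>x. (\<psi> x $ i) *\<^sub>R partial_derivative j \<eta> x \<partial>lebesgue_on U)"
proof -
  obtain K where K: "compact K" "K \<subseteq> U" "\<And>x. x \<notin> K \<Longrightarrow> \<psi> x = 0" and s: "smooth \<psi>"
    using assms(1) unfolding test_function_def by blast
  have \<eta>c: "continuous_on UNIV \<eta>"
    using \<eta>(1) by (simp add: continuous_at_imp_continuous_on differentiable_imp_continuous_within)
  have Jc: "continuous_on UNIV (\<lambda>x. jacobian \<psi> (at x) $ i $ j)"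
    by (intro continuous_intros continuous_on_jacobian s)
  have J0: "x \<notin> K \<Longrightarrow> jacobian \<psi> (at x) $ i $ j = 0" for x
    using jacobian_outside_support[OF K(1,3)] by simp
  define F where "F x = (\<psi> x $ i) *\<^sub>R \<eta> x" for x
  have dF: "(F has_derivative (\<lambda>h. (\<psi> x $ i) *\<^sub>R frechet_derivative \<eta> (at x) h
     + (frechet_derivative \<psi> (at x) h $ i) *\<^sub>R \<eta> x)) (at x)" for x
    unfolding F_def
    by (intro has_derivative_scaleR partial_derivative_component smooth_C1(1)[OF s])
       (use \<eta>(1) frechet_derivative_works in blast)
  have pF: "partial_derivative j F x = (\<psi> x $ i) *\<^sub>R partial_derivative j \<eta> x + (jacobian \<psi> (at x) $ i $ j) *\<^sub>R \<eta> x" for x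
    unfolding partial_derivative_eq[OF dF] jacobian_component by (simp add: partial_derivative_def)
  have c1: "continuous_on UNIV (\<lambda>x. (\<psi> x $ i) *\<^sub>R partial_derivative j \<eta> x)"
    by (intro continuous_intros smooth_C1(3)[OF s] \<eta>(2))
  have c2: "continuous_on UNIV (\<lambda>x. (jacobian \<psi> (at x) $ i $ j) *\<^sub>R \<eta> x)"
    by (intro continuous_intros Jc \<eta>c)
  have "integral\<^sup>L lborel (partial_derivative j F) = 0"
  proof (rule integral_partial_derivative_eq_0[OF _ _ K(1)])
    show "F differentiable (at x)" for x using dF differentiable_def by blast
    show "continuous_on UNIV (partial_derivative j F)"
      unfolding pF[abs_def] by (intro continuous_on_add c1 c2)
  qed (simp add: F_def K(3))
  then have "integral\<^sup>L lborel (\<lambda>x. (\<psi> x $ i) *\<^sub>R partial_derivative j \<eta> x)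
     + integral\<^sup>L lborel (\<lambda>x. (jacobian \<psi> (at x) $ i $ j) *\<^sub>R \<eta> x) = 0"
    unfolding pF[abs_def]
    by (subst (asm) Bochner_Integration.integral_add)
       (auto intro!: compact_support_integrable(1)[OF _ K(1)] c1 c2 simp: J0 K(3))
  moreover have "x \<notin> U \<Longrightarrow> x \<notin> K" for x using K(2) by blast
  ultimately show ?thesis
    using integral_lebesgue_on_eq_lborel[OF c1 assms(2)] integral_lebesgue_on_eq_lborel[OF c2 assms(2)]
    by (simp add: J0 K(3) add_eq_0_iff2)
qed

lemma tendsto_L1_int_bounded_factor:
  fixes u :: "nat \<Rightarrow> 'a \<Rightarrow> real" and \<eta> :: "'a \<Rightarrow> 'b::euclidean_space"
  assumes u: "\<And>n. integrable M (u n)" "integrable M f" and \<eta>: "\<eta> \<in> borel_measurable M" "\<And>x. norm (\<eta> x) \<le> B"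
    and lim: "(\<lambda>n. \<integral>\<^sup>+x. ennreal (norm (u n x - f x)) \<partial>M) \<longlonglongrightarrow> 0"
  shows "(\<lambda>n. \<integral>x. u n x *\<^sub>R \<eta> x \<partial>M) \<longlonglongrightarrow> (\<integral>x. f x *\<^sub>R \<eta> x \<partial>M)"
proof (rule tendsto_L1_int)
  note [measurable] = borel_measurable_integrable[OF u(1)] borel_measurable_integrable[OF u(2)] \<eta>(1)
  have B: "B \<ge> 0" using order_trans[OF norm_ge_zero \<eta>(2)] .
  have int: "integrable M (\<lambda>x. g x *\<^sub>R \<eta> x)" if "integrable M g" for g
    by (rule Bochner_Integration.integrable_bound[of M "\<lambda>x. B *\<^sub>R g x"])
       (use that \<eta> B in \<open>auto simp: abs_mult mult.commute[of B] intro!: mult_left_mono AE_I2\<close>)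
  show "integrable M (\<lambda>x. u n x *\<^sub>R \<eta> x)" "integrable M (\<lambda>x. f x *\<^sub>R \<eta> x)" for n
    using int u by auto
  show "(\<lambda>n. \<integral>\<^sup>+x. ennreal (norm (u n x *\<^sub>R \<eta> x - f x *\<^sub>R \<eta> x)) \<partial>M) \<longlonglongrightarrow> 0"
  proof (rule tendsto_sandwich[OF _ _ tendsto_const])
    have "(\<lambda>n. ennreal B * (\<integral>\<^sup>+x. ennreal (norm (u n x - f x)) \<partial>M)) \<longlonglongrightarrow> ennreal B * 0"
      by (intro ennreal_tendsto_cmult lim) simp
    then show "(\<lambda>n. ennreal B * (\<integral>\<^sup>+x. ennreal (norm (u n x - f x)) \<partial>M)) \<longlonglongrightarrow> 0" by simp
    show "\<forall>\<^sub>F n in sequentially. (\<integral>\<^sup>+x. ennreal (norm (u n x *\<^sub>R \<eta> x - f x *\<^sub>R \<eta> x)) \<partial>M)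
       \<le> ennreal B * (\<integral>\<^sup>+x. ennreal (norm (u n x - f x)) \<partial>M)"
    proof (rule always_eventually, rule allI)
      fix n
      have "norm (u n x *\<^sub>R \<eta> x - f x *\<^sub>R \<eta> x) \<le> B * norm (u n x - f x)" for x
        unfolding scaleR_left_diff_distrib[symmetric] norm_scaleR
        using mult_left_mono[OF \<eta>(2)[of x], of "\<bar>u n x - f x\<bar>"] by (simp add: mult.commute)
      then have "(\<integral>\<^sup>+x. ennreal (norm (u n x *\<^sub>R \<eta> x - f x *\<^sub>R \<eta> x)) \<partial>M) \<le> (\<integral>\<^sup>+x. ennreal B * ennreal (norm (u n x - f x)) \<partial>M)"
        using B by (intro nn_integral_mono) (simp flip: ennreal_mult')
      also have "\<dots> = ennreal B * (\<integral>\<^sup>+x. ennreal (norm (u n x - f x)) \<partial>M)"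
        by (intro nn_integral_cmult) measurable
      finally show "(\<integral>\<^sup>+x. ennreal (norm (u n x *\<^sub>R \<eta> x - f x *\<^sub>R \<eta> x)) \<partial>M)
       \<le> ennreal B * (\<integral>\<^sup>+x. ennreal (norm (u n x - f x)) \<partial>M)" .
    qed
  qed auto
qed

text \<open>Zero boundary values allow test fields \<open>\<eta>\<close> that do not vanish near the boundary of \<open>U\<close>: the identity
  holds for the approximating test functions and passes to the \<open>L\<^sup>1\<close> limit because \<open>\<eta>\<close> and its derivative
  are bounded.\<close>

lemma weak_integration_by_parts:
  fixes \<phi> :: "real^'n \<Rightarrow> real^'m" and \<eta> :: "real^'n \<Rightarrow> 'b::euclidean_space"
  assumes W: "W_1_1_zero U \<phi> G" and U: "U \<in> sets lebesgue"
    and \<eta>: "\<And>x. \<eta> differentiable (at x)" "continuous_on UNIV (partial_derivative j \<eta>)"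
    and bound: "\<And>x. norm (\<eta> x) \<le> B" "\<And>x. norm (partial_derivative j \<eta> x) \<le> B"
  shows "(\<integral>x. (G x $ i $ j) *\<^sub>R \<eta> x \<partial>lebesgue_on U) = - (\<integral>x. (\<phi> x $ i) *\<^sub>R partial_derivative j \<eta> x \<partial>lebesgue_on U)"
proof -
  obtain \<psi> where \<psi>: "\<And>k::nat. test_function U (\<psi> k)"
    and l\<phi>: "(\<lambda>k. \<integral>\<^sup>+x. ennreal (norm (\<psi> k x - \<phi> x)) \<partial>lebesgue_on U) \<longlonglongrightarrow> 0"
    and lG: "(\<lambda>k. \<integral>\<^sup>+x. ennreal (norm (jacobian (\<psi> k) (at x) - G x)) \<partial>lebesgue_on U) \<longlonglongrightarrow> 0"
    and int: "integrable (lebesgue_on U) \<phi>" "integrable (lebesgue_on U) G"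
    using W unfolding W_1_1_zero_def by blast
  have comp: "integrable (lebesgue_on U) (\<lambda>x. \<phi> x $ i)" "integrable (lebesgue_on U) (\<lambda>x. G x $ i $ j)"
    using integrable_bounded_linear[OF bounded_linear_vec_nth int(1)]
      integrable_bounded_linear[OF bounded_linear_vec_nth integrable_bounded_linear[OF bounded_linear_vec_nth int(2)]]
    by auto
  have \<eta>c: "continuous_on UNIV \<eta>"
    using \<eta>(1) by (simp add: continuous_at_imp_continuous_on differentiable_imp_continuous_within)
  have meas: "h \<in> borel_measurable (lebesgue_on U)" if "continuous_on UNIV h" for h :: "real^'n \<Rightarrow> 'b"
    by (intro measurable_restrict_space1 measurable_completion) (simp add: borel_measurable_continuous_onI that)
  have int\<psi>: "integrable (lebesgue_on U) (\<lambda>x. \<psi> k x $ i)" "integrable (lebesgue_on U) (\<lambda>x. jacobian (\<psi> k) (at x) $ i $ j)" for k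
  proof -
    obtain K where K: "compact K" "\<And>x. x \<notin> K \<Longrightarrow> \<psi> k x = 0" and s: "smooth (\<psi> k)"
      using \<psi>[of k] unfolding test_function_def by blast
    show "integrable (lebesgue_on U) (\<lambda>x. \<psi> k x $ i)"
      by (rule compact_support_integrable(3)[OF _ K(1) _ U]) (auto intro!: continuous_intros smooth_C1(3)[OF s] simp: K(2))
    show "integrable (lebesgue_on U) (\<lambda>x. jacobian (\<psi> k) (at x) $ i $ j)"
      by (rule compact_support_integrable(3)[OF _ K(1) _ U])
        (auto intro!: continuous_intros continuous_on_jacobian[OF s] simp: jacobian_outside_support[OF K])
  qed
  have lim\<phi>: "(\<lambda>k. \<integral>\<^sup>+x. ennreal (norm (\<psi> k x $ i - \<phi> x $ i)) \<partial>lebesgue_on U) \<longlonglongrightarrow> 0"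
    by (rule tendsto_sandwich[OF _ _ tendsto_const l\<phi>])
       (auto intro!: always_eventually nn_integral_mono ennreal_leI simp: component_le_norm_cart simp flip: vector_minus_component)
  have c2: "\<bar>A $ i $ j\<bar> \<le> norm A" for A :: "real^'n^'m"
    by (rule order_trans[OF component_le_norm_cart Finite_Cartesian_Product.norm_nth_le])
  have limG: "(\<lambda>k. \<integral>\<^sup>+x. ennreal (norm (jacobian (\<psi> k) (at x) $ i $ j - G x $ i $ j)) \<partial>lebesgue_on U) \<longlonglongrightarrow> 0"
    by (rule tendsto_sandwich[OF _ _ tendsto_const lG])
       (auto intro!: always_eventually nn_integral_mono ennreal_leI simp: c2 simp flip: vector_minus_component)
  have "(\<lambda>k. \<integral>x. (jacobian (\<psi> k) (at x) $ i $ j) *\<^sub>R \<eta> x \<partial>lebesgue_on U) \<longlonglongrightarrow> (\<integral>x. (G x $ i $ j) *\<^sub>R \<eta> x \<partial>lebesgue_on U)"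
    by (rule tendsto_L1_int_bounded_factor[OF int\<psi>(2) comp(2) meas[OF \<eta>c] bound(1) limG])
  moreover have "(\<lambda>k. - (\<integral>x. (\<psi> k x $ i) *\<^sub>R partial_derivative j \<eta> x \<partial>lebesgue_on U))
      \<longlonglongrightarrow> - (\<integral>x. (\<phi> x $ i) *\<^sub>R partial_derivative j \<eta> x \<partial>lebesgue_on U)"
    by (intro tendsto_minus tendsto_L1_int_bounded_factor[OF int\<psi>(1) comp(1) meas[OF \<eta>(2)] bound(2) lim\<phi>])
  ultimately show ?thesis
    using LIMSEQ_unique by (simp add: test_function_integration_by_parts[OF \<psi> U \<eta>])
qed

section \<open>Fourier coefficients of a weak gradient\<close>

lemma wave_has_derivative:
  "(wave \<rho> k has_derivative (\<lambda>h. of_real (\<rho> * (of_int (fst k) * h$1 + of_int (snd k) * h$2)) * (\<i> * wave \<rho> k x))) (at x)"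
proof -
  have lin: "((\<lambda>x::real^2. \<rho> * (of_int (fst k) * x$1 + of_int (snd k) * x$2)) has_derivative
      (\<lambda>h. \<rho> * (of_int (fst k) * h$1 + of_int (snd k) * h$2))) (at x)"
    by (intro has_derivative_mult_right has_derivative_add bounded_linear_imp_has_derivative bounded_linear_vec_nth)
  have cis: "(cis has_derivative (\<lambda>s. s *\<^sub>R (\<i> * cis t))) (at t)" for t
    by (auto intro!: derivative_eq_intros)
  from has_derivative_compose[OF lin cis] show ?thesis
    unfolding wave_def[abs_def] by (simp add: scaleR_conv_of_real)
qed

lemma wave_partial_derivative:
  "partial_derivative 1 (wave \<rho> k) x = \<i> * of_real (\<rho> * of_int (fst k)) * wave \<rho> k x"
  "partial_derivative 2 (wave \<rho> k) x = \<i> * of_real (\<rho> * of_int (snd k)) * wave \<rho> k x"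
  unfolding partial_derivative_eq[OF wave_has_derivative] by (simp_all add: axis_def)

definition fourier :: "(real^2) set \<Rightarrow> real \<Rightarrow> (real^2 \<Rightarrow> complex) \<Rightarrow> int \<times> int \<Rightarrow> complex" where
  "fourier U \<rho> f k = (\<integral>y. f y * wave \<rho> (-k) y \<partial>lebesgue_on U)"

lemma integrable_mult_wave:
  assumes "integrable (lebesgue_on U) f"
  shows "integrable (lebesgue_on U) (\<lambda>y. f y * wave \<rho> k y)"
proof (rule Bochner_Integration.integrable_bound[OF assms])
  have "wave \<rho> k \<in> borel_measurable borel"
    by (intro borel_measurable_continuous_onI continuous_on_wave continuous_on_id)
  then have "wave \<rho> k \<in> borel_measurable (lebesgue_on U)"
    by (intro measurable_restrict_space1 measurable_completion) simp
  then show "(\<lambda>y. f y * wave \<rho> k y) \<in> borel_measurable (lebesgue_on U)"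
    using borel_measurable_integrable[OF assms] by measurable
qed (simp add: norm_mult)

text \<open>The Fourier coefficients of the two parts of the gradient come from a single function \<open>\<phi>c\<close>. This is
  the compatibility \<open>\<partial>\<^sup>*z = \<partial>w\<close> that turns the convolved gradient into the gradient of a trigonometric
  polynomial.\<close>

lemma fourier_weak_gradient:
  fixes \<phi> :: "real^2 \<Rightarrow> real^2"
  assumes W: "W_1_1_zero U \<phi> G" and U: "U \<in> sets lebesgue"
  defines "\<phi>c \<equiv> \<lambda>y. Complex (\<phi> y $ 1) (\<phi> y $ 2)"
  shows "fourier U \<rho> (\<lambda>y. conformal_part (G y)) k = dz_symbol \<rho> k * fourier U \<rho> \<phi>c k"
    "fourier U \<rho> (\<lambda>y. anticonformal_part (G y)) k = dzbar_symbol \<rho> k * fourier U \<rho> \<phi>c k"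
proof -
  have int: "integrable (lebesgue_on U) \<phi>" "integrable (lebesgue_on U) G"
    using W unfolding W_1_1_zero_def by blast+
  define e where "e = wave \<rho> (-k)"
  define I where "I i j = (\<integral>y. (G y $ i $ j) *\<^sub>R e y \<partial>lebesgue_on U)" for i j
  define \<Phi> where "\<Phi> i = (\<integral>y. (\<phi> y $ i) *\<^sub>R e y \<partial>lebesgue_on U)" for i
  have i\<phi>: "integrable (lebesgue_on U) (\<lambda>y. (\<phi> y $ i) *\<^sub>R e y)" for i
    using integrable_mult_wave[OF integrable_of_real[OF integrable_bounded_linear[OF bounded_linear_vec_nth int(1)]], of i \<rho> "-k"]
    by (simp add: scaleR_conv_of_real e_def)
  have iG: "integrable (lebesgue_on U) (\<lambda>y. (G y $ i $ j) *\<^sub>R e y)" for i j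
    using integrable_mult_wave[OF integrable_of_real[OF integrable_bounded_linear[OF bounded_linear_vec_nth integrable_bounded_linear[OF bounded_linear_vec_nth int(2)]]], of i j \<rho> "-k"]
    by (simp add: scaleR_conv_of_real e_def)
  have d: "e differentiable (at x)" for x
    unfolding e_def using wave_has_derivative differentiable_def by blast
  have p: "partial_derivative 1 e = (\<lambda>x. (- \<i> * of_real (\<rho> * of_int (fst k))) * e x)"
     "partial_derivative 2 e = (\<lambda>x. (- \<i> * of_real (\<rho> * of_int (snd k))) * e x)"
    unfolding e_def by (auto simp: wave_partial_derivative)
  have ne: "norm (e x) = 1" for x by (simp add: e_def)
  have c: "continuous_on UNIV e" unfolding e_def by (intro continuous_on_wave continuous_on_id)
  have transfer: "I i j = \<i> * of_real c * \<Phi> i"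
    if pj: "partial_derivative j e = (\<lambda>x. (- \<i> * of_real c) * e x)" for i j c
  proof -
    have "I i j = - (\<integral>x. (\<phi> x $ i) *\<^sub>R partial_derivative j e x \<partial>lebesgue_on U)"
      unfolding I_def
      by (rule weak_integration_by_parts[OF W U d, where B="1 + \<bar>c\<bar>"])
        (auto simp: pj ne norm_mult intro!: continuous_intros c)
    also have "\<dots> = - (\<integral>x. (- \<i> * of_real c) * ((\<phi> x $ i) *\<^sub>R e x) \<partial>lebesgue_on U)"
      unfolding pj by (simp add: algebra_simps)
    also have "\<dots> = \<i> * of_real c * \<Phi> i"
      unfolding \<Phi>_def by (subst Bochner_Integration.integral_mult_right[OF i\<phi>]) simp
    finally show ?thesis .
  qed
  note I1 = transfer[OF p(1)] and I2 = transfer[OF p(2)]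
  have f: "fourier U \<rho> \<phi>c k = \<Phi> 1 + \<i> * \<Phi> 2"
  proof -
    have "fourier U \<rho> \<phi>c k = (\<integral>y. (\<phi> y $ 1) *\<^sub>R e y + \<i> * ((\<phi> y $ 2) *\<^sub>R e y) \<partial>lebesgue_on U)"
      unfolding fourier_def \<phi>c_def e_def
      by (intro Bochner_Integration.integral_cong refl) (simp add: Complex_eq scaleR_conv_of_real algebra_simps)
    also have "\<dots> = \<Phi> 1 + \<i> * \<Phi> 2"
      unfolding \<Phi>_def by (simp add: i\<phi> del: mult_scaleR_right)
    finally show ?thesis .
  qed
  have "fourier U \<rho> (\<lambda>y. conformal_part (G y)) k = (\<integral>y. ((G y $ 1 $ 1) *\<^sub>R e y + (G y $ 2 $ 2) *\<^sub>R e y) / 2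
      + (\<i> / 2) * ((G y $ 2 $ 1) *\<^sub>R e y - (G y $ 1 $ 2) *\<^sub>R e y) \<partial>lebesgue_on U)"
    unfolding fourier_def conformal_part_def e_def
    by (intro Bochner_Integration.integral_cong refl) (simp add: Complex_eq scaleR_conv_of_real field_simps)
  also have "\<dots> = (I 1 1 + I 2 2) / 2 + (\<i> / 2) * (I 2 1 - I 1 2)"
    unfolding I_def by (simp add: iG del: mult_scaleR_right)
  also have "\<dots> = dz_symbol \<rho> k * fourier U \<rho> \<phi>c k"
    unfolding f I1 I2 dz_symbol_def Complex_eq by (simp add: field_simps)
  finally show "fourier U \<rho> (\<lambda>y. conformal_part (G y)) k = dz_symbol \<rho> k * fourier U \<rho> \<phi>c k" .
  have "fourier U \<rho> (\<lambda>y. anticonformal_part (G y)) k = (\<integral>y. ((G y $ 1 $ 1) *\<^sub>R e y - (G y $ 2 $ 2) *\<^sub>R e y) / 2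
      + (\<i> / 2) * ((G y $ 2 $ 1) *\<^sub>R e y + (G y $ 1 $ 2) *\<^sub>R e y) \<partial>lebesgue_on U)"
    unfolding fourier_def anticonformal_part_def e_def
    by (intro Bochner_Integration.integral_cong refl) (simp add: Complex_eq scaleR_conv_of_real field_simps)
  also have "\<dots> = (I 1 1 - I 2 2) / 2 + (\<i> / 2) * (I 2 1 + I 1 2)"
    unfolding I_def by (simp add: iG del: mult_scaleR_right)
  also have "\<dots> = dzbar_symbol \<rho> k * fourier U \<rho> \<phi>c k"
    unfolding f I1 I2 dzbar_symbol_def Complex_eq by (simp add: field_simps)
  finally show "fourier U \<rho> (\<lambda>y. anticonformal_part (G y)) k = dzbar_symbol \<rho> k * fourier U \<rho> \<phi>c k" .
qed

section \<open>A trigonometric approximate identity\<close>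

definition peak :: "real \<Rightarrow> real^2 \<Rightarrow> real" where
  "peak l x = (2 + cos (pi / l * x$1) + cos (pi / l * x$2)) / 4"

text \<open>Normalised powers of a function with values in \<open>[0, 1]\<close> that equals \<open>1\<close> only at the lattice points
  \<open>2l \<int>\<^sup>2\<close>. They form a nonnegative approximate identity of trigonometric polynomials.\<close>

definition peak_kernel :: "real \<Rightarrow> nat \<Rightarrow> real^2 \<Rightarrow> real" where
  "peak_kernel l n x = peak l x ^ n / integral (period_box l) (\<lambda>x. peak l x ^ n)"

lemma peak_range: "0 \<le> peak l x" "peak l x \<le> 1"
proof -
  have "0 \<le> (2 + a + b) / 4 \<and> (2 + a + b) / 4 \<le> 1" if "-1 \<le> a" "a \<le> 1" "-1 \<le> b" "b \<le> 1" for a b :: real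
    using that by simp
  from this[OF cos_ge_minus_one cos_le_one cos_ge_minus_one cos_le_one]
  show "0 \<le> peak l x" "peak l x \<le> 1" unfolding peak_def by blast+
qed

lemma continuous_on_peak [continuous_intros]:
  fixes f :: "'a::t2_space \<Rightarrow> real^2"
  assumes "continuous_on S f"
  shows "continuous_on S (\<lambda>x. peak l (f x))"
proof -
  have "continuous_on S (\<lambda>x. cos (c * f x $ i))" for c i
    by (rule continuous_on_cos) (intro continuous_intros assms)
  then show ?thesis unfolding peak_def divide_inverse[of _ 4]
    by (intro continuous_on_mult continuous_on_add continuous_on_const)
qed

lemma continuous_on_kernel [continuous_intros]:
  fixes f :: "'a::t2_space \<Rightarrow> real^2"
  shows "continuous_on S f \<Longrightarrow> continuous_on S (\<lambda>x. peak_kernel l n (f x))"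
  unfolding peak_kernel_def divide_inverse by (intro continuous_intros)

lemma trig_expansion:
  assumes "trig \<rho> f f1 f2"
  shows "\<exists>K a. finite K \<and> (\<forall>x. f x = (\<Sum>k\<in>K. a k * wave \<rho> k x))"
  using assms
proof induction
  case (trig_wave c k)
  show ?case by (rule exI[of _ "{k}"], rule exI[of _ "\<lambda>_. c"]) simp
next
  case (trig_add f f1 f2 g g1 g2)
  then obtain K a L b where K: "finite K" "\<And>x. f x = (\<Sum>k\<in>K. a k * wave \<rho> k x)"
    and L: "finite L" "\<And>x. g x = (\<Sum>k\<in>L. b k * wave \<rho> k x)" by blast
  show ?case
  proof (intro exI[of _ "K \<union> L"] exI[of _ "\<lambda>k. (if k \<in> K then a k else 0) + (if k \<in> L then b k else 0)"] conjI allI)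
    fix x
    have "f x = (\<Sum>k\<in>K\<union>L. (if k \<in> K then a k else 0) * wave \<rho> k x)"
      unfolding K(2) using K(1) L(1) by (intro sum.mono_neutral_cong_left) auto
    moreover have "g x = (\<Sum>k\<in>K\<union>L. (if k \<in> L then b k else 0) * wave \<rho> k x)"
      unfolding L(2) using K(1) L(1) by (intro sum.mono_neutral_cong_left) auto
    ultimately show "f x + g x = (\<Sum>k\<in>K\<union>L. ((if k \<in> K then a k else 0) + (if k \<in> L then b k else 0)) * wave \<rho> k x)"
      by (simp add: distrib_right sum.distrib)
  qed (use K(1) L(1) in auto)
qed

lemma trig_power: "trig \<rho> f f1 f2 \<Longrightarrow> \<exists>g1 g2. trig \<rho> (\<lambda>x. f x ^ n) g1 g2"
proof (induction n)
  case 0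
  show ?case using trig_const[of \<rho> 1] by auto
next
  case (Suc n)
  then obtain g1 g2 where "trig \<rho> (\<lambda>x. f x ^ n) g1 g2" by blast
  from trig_mult[OF Suc.prems this] show ?case by auto
qed

lemma trig_peak: "\<exists>f1 f2. trig (pi / l) (\<lambda>x. of_real (peak l x)) f1 f2"
proof -
  have cos: "complex_of_real (cos t) = (cis t + cis (-t)) / 2" for t by (simp add: complex_eq_iff)
  note w = trig_wave[of "pi / l" "1/8"]
  note T = trig_add[OF trig_const[of _ "1/2"]
    trig_add[OF trig_add[OF w[of "(1,0)"] w[of "(-1,0)"]] trig_add[OF w[of "(0,1)"] w[of "(0,-1)"]]]]
  show ?thesis
    by (intro exI, rule trig_cong[OF T _ refl refl]) (simp add: peak_def cos wave_def field_simps)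
qed

lemma kernel_expansion:
  "\<exists>K a. finite K \<and> (\<forall>x. complex_of_real (peak_kernel l n x) = (\<Sum>k\<in>K. a k * wave (pi / l) k x))"
proof -
  define N where "N = integral (period_box l) (\<lambda>x. peak l x ^ n)"
  obtain f1 f2 where "trig (pi / l) (\<lambda>x. complex_of_real (peak l x)) f1 f2" using trig_peak by blast
  from trig_power[OF this, of n] obtain g1 g2 where "trig (pi / l) (\<lambda>x. complex_of_real (peak l x) ^ n) g1 g2" by blast
  from trig_scale[OF this, of "of_real (inverse N)"]
  have "trig (pi / l) (\<lambda>x. complex_of_real (peak_kernel l n x)) (\<lambda>x. of_real (inverse N) * g1 x) (\<lambda>x. of_real (inverse N) * g2 x)"
    by (rule trig_cong) (simp_all add: peak_kernel_def N_def field_simps)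
  from trig_expansion[OF this] show ?thesis by blast
qed

lemma wave_diff: "wave \<rho> k (x - y) = wave \<rho> k x * wave \<rho> (-k) y"
  by (simp add: wave_def cis_mult algebra_simps)

text \<open>Near the origin \<open>peak\<close> exceeds \<open>\<eta>\<close>, so the mass of its powers decays more slowly than \<open>\<eta> ^ n\<close> up to a
  constant.\<close>

lemma peak_mass_lower_bound:
  assumes "l > 0" "\<eta> < 1" "0 \<le> \<eta>"
  shows "\<exists>v>0. \<forall>n. v * \<eta>^n \<le> integral (period_box l) (\<lambda>x. peak l x ^ n)"
proof -
  have "isCont (peak l) 0"
    using continuous_on_peak[OF continuous_on_id, of UNIV l] by (simp add: continuous_on_eq_continuous_at)
  then have "(peak l \<longlongrightarrow> peak l 0) (nhds 0)"
    by (simp only: continuous_at tendsto_at_iff_tendsto_nhds)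
  moreover have "peak l 0 > \<eta>" using assms by (simp add: peak_def)
  ultimately have "eventually (\<lambda>x. peak l x > \<eta>) (nhds 0)"
    by (rule order_tendstoD)
  then obtain d where d: "d > 0" "\<And>x. norm x < d \<Longrightarrow> peak l x > \<eta>"
    unfolding eventually_nhds_metric by (auto simp: dist_norm)
  define r where "r = min (d/4) l"
  have r: "r > 0" "r \<le> l" "2 * r < d" using d(1) assms(1) by (auto simp: r_def min_def)
  have sub: "period_box r \<subseteq> period_box l" using r by (auto simp: mem_box_cart) (metis order_trans neg_le_iff_le)+
  have c: "continuous_on S (\<lambda>x. peak l x ^ n)" for S n by (intro continuous_intros)
  have "(2 * r)\<^sup>2 * \<eta>^n \<le> integral (period_box l) (\<lambda>x. peak l x ^ n)" for n
  proof -
    have "(2 * r)\<^sup>2 * \<eta>^n = integral (period_box r) (\<lambda>x. \<eta>^n)" using r by (simp add: content_period_box)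
    also have "\<dots> \<le> integral (period_box r) (\<lambda>x. peak l x ^ n)"
    proof (rule integral_le)
      fix x assume x: "x \<in> period_box r"
      have "norm x \<le> \<bar>x$1\<bar> + \<bar>x$2\<bar>" using norm_le_l1_cart[of x] by (simp add: UNIV_2)
      also have "\<dots> \<le> r + r" using x by (intro add_mono) (auto simp: mem_box_cart abs_le_iff minus_le_iff)
      finally have "peak l x > \<eta>" using r d(2) by simp
      then show "\<eta>^n \<le> peak l x ^ n" using assms by (intro power_mono) auto
    qed (auto intro!: integrable_continuous c)
    also have "\<dots> \<le> integral (period_box l) (\<lambda>x. peak l x ^ n)"
      by (rule integral_subset_le[OF sub]) (auto intro!: integrable_continuous c zero_le_power peak_range)
    finally show ?thesis .
  qed
  then show ?thesis using r by (intro exI[of _ "(2 * r)\<^sup>2"]) auto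
qed

lemma kernel_nonneg: "0 \<le> peak_kernel l n x"
  unfolding peak_kernel_def
  by (intro divide_nonneg_nonneg zero_le_power peak_range Henstock_Kurzweil_Integration.integral_nonneg)
     (auto intro!: integrable_continuous continuous_intros zero_le_power peak_range)

lemma kernel_integral: 
  assumes "l > 0"
  shows "integral (period_box l) (peak_kernel l n) = 1"
proof -
  have "integral (period_box l) (\<lambda>x. peak l x ^ n) > 0"
  proof -
    obtain v where "v > 0" "v * (1/2)^n \<le> integral (period_box l) (\<lambda>x. peak l x ^ n)"
      using peak_mass_lower_bound[OF assms, of "1/2"] by auto
    moreover from this have "v * (1/2)^n > 0" by simp
    ultimately show ?thesis by linarith
  qed
  then show ?thesis unfolding peak_kernel_def[abs_def] by simp
qed

lemma integral_wave_series:
  assumes "l > 0" "finite K"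
  shows "integral (period_box l) (\<lambda>x. \<Sum>k\<in>K. a k * wave (pi / l) k x) = (if 0 \<in> K then a 0 else 0) * of_real ((2 * l)\<^sup>2)"
proof -
  have "integral (period_box l) (\<lambda>x. \<Sum>k\<in>K. a k * wave (pi / l) k x)
     = (\<Sum>k\<in>K. integral (period_box l) (\<lambda>x. a k * wave (pi / l) k x))"
    by (intro Henstock_Kurzweil_Integration.integral_sum assms integrable_continuous continuous_intros)
  also have "\<dots> = (\<Sum>k\<in>K. if k = 0 then a k * of_real ((2 * l)\<^sup>2) else 0)"
    by (intro sum.cong refl) (simp add: integral_wave[OF assms(1)])
  also have "\<dots> = (if 0 \<in> K then a 0 else 0) * of_real ((2 * l)\<^sup>2)"
    using assms(2) by (simp add: sum.delta)
  finally show ?thesis .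
qed

lemma integral_of_real_cbox:
  fixes f :: "real^2 \<Rightarrow> real"
  assumes "continuous_on (cbox a b) f"
  shows "integral (cbox a b) (\<lambda>x. complex_of_real (f x)) = of_real (integral (cbox a b) f)"
  using integral_linear[OF integrable_continuous[OF assms] bounded_linear_of_real] by (simp add: o_def)

lemma kernel_series:
  assumes "l > 0"
  obtains K a where "finite K" "\<And>x. complex_of_real (peak_kernel l n x) = (\<Sum>k\<in>K. a k * wave (pi / l) k x)"
    "(if 0 \<in> K then a 0 else 0) * of_real ((2 * l)\<^sup>2) = (1::complex)"
proof -
  obtain K a where K: "finite K" "\<And>x. complex_of_real (peak_kernel l n x) = (\<Sum>k\<in>K. a k * wave (pi / l) k x)"
    using kernel_expansion by blast
  have "(if 0 \<in> K then a 0 else 0) * of_real ((2 * l)\<^sup>2) = (1::complex)"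
    using integral_of_real_cbox[of "vec (-l)" "vec l" "peak_kernel l n"] kernel_integral[OF assms, of n]
    by (simp add: K(2) integral_wave_series[OF assms K(1)] continuous_on_kernel[OF continuous_on_id])
  with K show ?thesis using that by blast
qed

text \<open>Shifting a wave only multiplies it by a phase, so only the constant coefficient contributes, wherever
  the kernel is centred.\<close>

lemma kernel_integral_shift:
  assumes "l > 0"
  shows "integral (period_box l) (\<lambda>x. peak_kernel l n (x - y)) = 1" "integral (period_box l) (\<lambda>y. peak_kernel l n (x - y)) = 1"
proof -
  obtain K a where K: "finite K" "\<And>x. complex_of_real (peak_kernel l n x) = (\<Sum>k\<in>K. a k * wave (pi / l) k x)"
    and a0: "(if 0 \<in> K then a 0 else 0) * of_real ((2 * l)\<^sup>2) = (1::complex)"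
    using kernel_series[OF assms] by blast
  have "complex_of_real (integral (period_box l) (\<lambda>x. peak_kernel l n (x - y))) =
      integral (period_box l) (\<lambda>x. \<Sum>k\<in>K. (a k * wave (pi / l) (-k) y) * wave (pi / l) k x)"
    by (subst integral_of_real_cbox[symmetric])
       (auto intro!: continuous_intros simp: K(2) wave_diff mult_ac)
  also have "\<dots> = 1" unfolding integral_wave_series[OF assms K(1)] using a0 by (auto split: if_splits)
  finally show "integral (period_box l) (\<lambda>x. peak_kernel l n (x - y)) = 1" by (simp only: of_real_eq_1_iff)
  have "complex_of_real (integral (period_box l) (\<lambda>y. peak_kernel l n (x - y))) =
      integral (period_box l) (\<lambda>y. \<Sum>k\<in>uminus ` K. (a (-k) * wave (pi / l) (-k) x) * wave (pi / l) k y)"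
    by (subst integral_of_real_cbox[symmetric])
       (auto intro!: continuous_intros simp: K(2) wave_diff mult_ac sum.reindex)
  also have "\<dots> = 1" 
    unfolding integral_wave_series[OF assms finite_imageI[OF K(1)]] using a0 by (auto split: if_splits simp: image_iff)
  finally show "integral (period_box l) (\<lambda>y. peak_kernel l n (x - y)) = 1" by (simp only: of_real_eq_1_iff)
qed

text \<open>With period \<open>4R\<close> in each variable, the square \<open>[-3R, 3R]\<^sup>2\<close> contains no lattice point but the origin.
  Away from the origin \<open>peak\<close> is therefore at most some \<open>\<eta>0 < 1\<close>, and its powers are negligible
  against a mass of order \<open>\<eta>1 ^ n\<close> with \<open>\<eta>0 < \<eta>1 < 1\<close>.\<close>

lemma kernel_concentrates:
  assumes "R > 0" "d > 0"
  shows "\<exists>m. m \<longlonglongrightarrow> 0 \<and> (\<forall>n x. norm x \<ge> d \<longrightarrow> \<bar>x$1\<bar> \<le> 3*R \<longrightarrow> \<bar>x$2\<bar> \<le> 3*R \<longrightarrow> peak_kernel (2*R) n x \<le> m n)"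
proof -
  define T where "T = {x :: real^2. norm x \<ge> d} \<inter> period_box (3*R)"
  have T: "compact T" unfolding T_def by (intro closed_Int_compact closed_Collect_le continuous_intros compact_cbox)
  have less1: "peak (2*R) x < 1" if "x \<in> T" for x
  proof (rule ccontr)
    have c0: "t = 0" if "\<bar>t\<bar> \<le> 3*R" "cos (pi / (2*R) * t) = 1" for t
    proof -
      obtain n :: int where n: "pi / (2*R) * t = of_int n * 2 * pi"
        using \<open>cos _ = 1\<close> unfolding cos_one_2pi_int by blast
      then have t: "t = 4 * R * of_int n" using assms(1) by (simp add: field_simps)
      have "\<bar>of_int n :: real\<bar> < 1"
      proof -
        have "4 * R * \<bar>of_int n\<bar> \<le> 3*R" using \<open>\<bar>t\<bar> \<le> 3*R\<close> assms(1) unfolding t by (simp add: abs_mult)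
        then have "4 * \<bar>of_int n :: real\<bar> \<le> 3" using assms(1) by (simp add: mult.commute mult.left_commute)
        then show ?thesis by linarith
      qed
      then have "n = 0" by linarith
      then show ?thesis using t by simp
    qed
    assume "\<not> peak (2*R) x < 1"
    then have "cos (pi / (2*R) * x$1) + cos (pi / (2*R) * x$2) \<ge> 2" unfolding peak_def by simp
    moreover have "cos (pi / (2*R) * x$1) \<le> 1" "cos (pi / (2*R) * x$2) \<le> 1" by simp_all
    ultimately have "cos (pi / (2*R) * x$1) = 1" "cos (pi / (2*R) * x$2) = 1" by linarith+
    moreover have "\<bar>x$1\<bar> \<le> 3*R" "\<bar>x$2\<bar> \<le> 3*R" using that by (auto simp: T_def mem_box_cart abs_le_iff minus_le_iff)
    ultimately have "x$1 = 0" "x$2 = 0" using c0 by blast+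
    then have "x = 0" by (simp add: vec_eq_iff forall_2)
    then show False using that assms(2) by (simp add: T_def)
  qed
  obtain \<eta>0 where \<eta>0: "0 \<le> \<eta>0" "\<eta>0 < 1" "\<And>x. x \<in> T \<Longrightarrow> peak (2*R) x \<le> \<eta>0"
  proof (cases "T = {}")
    case True
    then show ?thesis using that[of 0] by auto
  next
    case False
    have "continuous_on T (peak (2*R))" by (intro continuous_on_peak continuous_on_id)
    from continuous_attains_sup[OF T False this] obtain y where "y \<in> T" "\<And>x. x \<in> T \<Longrightarrow> peak (2*R) x \<le> peak (2*R) y" by blast
    then show ?thesis using that[of "peak (2*R) y"] less1 peak_range by auto
  qed
  define \<eta>1 where "\<eta>1 = (1 + \<eta>0) / 2"
  have \<eta>1: "\<eta>0 < \<eta>1" "\<eta>1 < 1" "0 < \<eta>1" using \<eta>0 by (auto simp: \<eta>1_def)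
  obtain v where v: "v > 0" "\<And>n. v * \<eta>1^n \<le> integral (period_box (2*R)) (\<lambda>x. peak (2*R) x ^ n)"
    using peak_mass_lower_bound[of "2*R" \<eta>1] assms(1) \<eta>1 by auto
  show ?thesis
  proof (intro exI[of _ "\<lambda>n. (\<eta>0/\<eta>1)^n / v"] conjI allI impI)
    have "(\<lambda>n. (\<eta>0/\<eta>1)^n) \<longlonglongrightarrow> 0" using \<eta>0 \<eta>1 by (intro LIMSEQ_power_zero) simp
    from tendsto_divide[OF this tendsto_const[of v]] show "(\<lambda>n. (\<eta>0/\<eta>1)^n / v) \<longlonglongrightarrow> 0" using v(1) by simp
    fix n and x :: "real^2" assume x: "norm x \<ge> d" "\<bar>x$1\<bar> \<le> 3*R" "\<bar>x$2\<bar> \<le> 3*R"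
    then have "x \<in> T" by (auto simp: T_def mem_box_cart forall_2)
    from \<eta>0(3)[OF this] have "peak (2*R) x ^ n \<le> \<eta>0 ^ n" by (intro power_mono peak_range)
    moreover have "0 < v * \<eta>1^n" using v(1) \<eta>1 by simp
    ultimately have "peak_kernel (2*R) n x \<le> \<eta>0^n / (v * \<eta>1^n)"
      unfolding peak_kernel_def using v(2)[of n] \<eta>0(1) by (intro frac_le) auto
    also have "\<dots> = (\<eta>0/\<eta>1)^n / v" by (simp add: power_divide field_simps)
    finally show "peak_kernel (2*R) n x \<le> (\<eta>0/\<eta>1)^n / v" .
  qed
qed

section \<open>Mollification\<close>

definition mollify :: "real \<Rightarrow> nat \<Rightarrow> (real^2 \<Rightarrow> complex) \<Rightarrow> real^2 \<Rightarrow> complex" where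
  "mollify l n f x = (\<integral>y. peak_kernel l n (x - y) *\<^sub>R f y \<partial>lebesgue_on (period_box l))"

lemma kernel_mult_series:
  assumes K: "finite K" "\<And>x. complex_of_real (peak_kernel l n x) = (\<Sum>k\<in>K. a k * wave (pi / l) k x)"
  shows "peak_kernel l n (x - y) *\<^sub>R v = (\<Sum>k\<in>K. a k * wave (pi / l) k x * (v * wave (pi / l) (-k) y))"
  unfolding scaleR_conv_of_real K(2) wave_diff by (simp add: sum_distrib_right sum_distrib_left mult_ac)

lemma integrable_kernel_mult:
  fixes f :: "real^2 \<Rightarrow> complex"
  assumes "integrable (lebesgue_on (period_box l)) f" 
  shows "integrable (lebesgue_on (period_box l)) (\<lambda>y. peak_kernel l n (x - y) *\<^sub>R f y)"
proof -
  obtain K a where K: "finite K" "\<And>x. complex_of_real (peak_kernel l n x) = (\<Sum>k\<in>K. a k * wave (pi / l) k x)"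
    using kernel_expansion by blast
  show ?thesis unfolding kernel_mult_series[OF K]
    by (intro Bochner_Integration.integrable_sum integrable_mult_right integrable_mult_wave assms)
qed

lemma mollify_series:
  assumes K: "finite K" "\<And>x. complex_of_real (peak_kernel l n x) = (\<Sum>k\<in>K. a k * wave (pi / l) k x)"
    and f: "integrable (lebesgue_on (period_box l)) f"
  shows "mollify l n f x = (\<Sum>k\<in>K. a k * fourier (period_box l) (pi / l) f k * wave (pi / l) k x)"
proof -
  note int = integrable_mult_wave[OF f, where \<rho>="pi / l"]
  have "mollify l n f x = (\<Sum>k\<in>K. \<integral>y. a k * wave (pi / l) k x * (f y * wave (pi / l) (-k) y) \<partial>lebesgue_on (period_box l))"
    unfolding mollify_def kernel_mult_series[OF K]
    by (intro Bochner_Integration.integral_sum integrable_mult_right int)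
  also have "\<dots> = (\<Sum>k\<in>K. a k * wave (pi / l) k x * fourier (period_box l) (pi / l) f k)"
    unfolding fourier_def by (intro sum.cong refl Bochner_Integration.integral_mult_right int)
  finally show ?thesis by (simp add: mult_ac)
qed

lemma continuous_on_mollify:
  assumes "integrable (lebesgue_on (period_box l)) f"
  shows "continuous_on S (mollify l n f)"
proof -
  obtain K a where K: "finite K" "\<And>x. complex_of_real (peak_kernel l n x) = (\<Sum>k\<in>K. a k * wave (pi / l) k x)"
    using kernel_expansion by blast
  show ?thesis unfolding mollify_series[OF K assms, abs_def] by (intro continuous_intros)
qed

lemma norm_mollify_le:
  assumes f: "integrable (lebesgue_on (period_box l)) f"
  shows "norm (mollify l n f x) \<le> (\<integral>y. peak_kernel l n (x - y) * norm (f y) \<partial>lebesgue_on (period_box l))"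
proof -
  have "norm (mollify l n f x) \<le> (\<integral>y. norm (peak_kernel l n (x - y) *\<^sub>R f y) \<partial>lebesgue_on (period_box l))"
    unfolding mollify_def by (rule integral_norm_bound)
  then show ?thesis by (simp add: kernel_nonneg)
qed

text \<open>Young's inequality for convolutions. Interchanging the integrals amounts to reading off the
  constant Fourier coefficient of the mollification of \<open>norm f\<close>.\<close>

lemma mollify_L1_bound:
  assumes l: "l > 0" and f: "integrable (lebesgue_on (period_box l)) f"
  shows "integral (period_box l) (\<lambda>x. norm (mollify l n f x)) \<le> (\<integral>y. norm (f y) \<partial>lebesgue_on (period_box l))"
proof -
  define h where "h y = complex_of_real (norm (f y))" for y
  have h: "integrable (lebesgue_on (period_box l)) h" unfolding h_def using f by auto
  obtain K a where K: "finite K" "\<And>x. complex_of_real (peak_kernel l n x) = (\<Sum>k\<in>K. a k * wave (pi / l) k x)"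
    and a0: "(if 0 \<in> K then a 0 else 0) * of_real ((2 * l)\<^sup>2) = (1::complex)"
    using kernel_series[OF l] by blast
  have "norm (mollify l n f x) \<le> Re (mollify l n h x)" for x
  proof -
    have "mollify l n h x = of_real (\<integral>y. peak_kernel l n (x - y) * norm (f y) \<partial>lebesgue_on (period_box l))"
      unfolding mollify_def h_def by (simp add: scaleR_conv_of_real flip: of_real_mult)
    then show ?thesis using norm_mollify_le[OF f] by simp
  qed
  then have "integral (period_box l) (\<lambda>x. norm (mollify l n f x)) \<le> integral (period_box l) (\<lambda>x. Re (mollify l n h x))"
    by (intro integral_le integrable_continuous continuous_intros continuous_on_mollify f h)
  also have "\<dots> = Re (integral (period_box l) (mollify l n h))"
    using integral_linear[OF integrable_continuous[OF continuous_on_mollify[OF h]] bounded_linear_Re]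
    by (simp add: o_def)
  also have "integral (period_box l) (mollify l n h) = fourier (period_box l) (pi / l) h 0"
    unfolding mollify_series[OF K h, abs_def] integral_wave_series[OF l K(1)]
    using a0 by (auto split: if_splits)
  also have "Re \<dots> = (\<integral>y. norm (f y) \<partial>lebesgue_on (period_box l))"
    by (simp add: fourier_def h_def)
  finally show ?thesis .
qed

lemma mollify_bounded:
  assumes l: "l > 0" and f: "integrable (lebesgue_on (period_box l)) f"
    and M: "AE y in lebesgue_on (period_box l). norm (f y) \<le> M"
  shows "norm (mollify l n f x) \<le> M"
proof -
  have k: "continuous_on S (\<lambda>y. peak_kernel l n (x - y))" for S by (intro continuous_intros)
  note ki = continuous_imp_integrable[OF k, of "vec (-l)" "vec l"]
  have "norm (mollify l n f x) \<le> (\<integral>y. peak_kernel l n (x - y) * norm (f y) \<partial>lebesgue_on (period_box l))"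
    by (rule norm_mollify_le[OF f])
  also have "\<dots> \<le> (\<integral>y. peak_kernel l n (x - y) * M \<partial>lebesgue_on (period_box l))"
  proof (rule integral_mono_AE)
    show "integrable (lebesgue_on (period_box l)) (\<lambda>y. peak_kernel l n (x - y) * norm (f y))"
      using integrable_norm[OF integrable_kernel_mult[OF f, of n x]] by (simp add: kernel_nonneg)
    show "AE y in lebesgue_on (period_box l). peak_kernel l n (x - y) * norm (f y) \<le> peak_kernel l n (x - y) * M"
      using M by eventually_elim (intro mult_left_mono kernel_nonneg)
  qed (use ki in auto)
  also have "\<dots> = M"
    using kernel_integral_shift(2)[OF l, of n x] lebesgue_integral_eq_integral[OF ki] by simp
  finally show ?thesis .
qed

text \<open>The support condition keeps the periodic copies of the kernel harmless: where \<open>g x \<noteq> g y\<close>, one of the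
  points lies in \<open>[-R, R]\<^sup>2\<close>, so \<open>x - y\<close> lies in the square on which the kernel concentrates at the origin.\<close>

lemma mollify_uniform_limit:
  assumes R: "R > 0" and g: "continuous_on UNIV g" "\<And>x. x \<notin> period_box R \<Longrightarrow> g x = 0" and e: "e > 0"
  shows "\<exists>N. \<forall>n\<ge>N. \<forall>x\<in>period_box (2*R). norm (mollify (2*R) n g x - g x) \<le> e"
proof -
  let ?D = "period_box (2*R)"
  have l: "2*R > 0" using R by simp
  have gc: "continuous_on S g" for S using g(1) continuous_on_subset by blast
  obtain B where B: "B > 0" "\<And>x. x \<in> ?D \<Longrightarrow> norm (g x) \<le> B"
    using compact_imp_bounded[OF compact_continuous_image[OF gc compact_cbox, of "vec (-(2*R))" "vec (2*R)"]]
    unfolding bounded_pos by auto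
  have "uniformly_continuous_on ?D g" by (intro compact_uniformly_continuous gc compact_cbox)
  then obtain d where d: "d > 0" "\<And>x y. x \<in> ?D \<Longrightarrow> y \<in> ?D \<Longrightarrow> dist x y < d \<Longrightarrow> dist (g x) (g y) < e/2"
    unfolding uniformly_continuous_on_def using e by (metis half_gt_zero)
  obtain m' where m': "m' \<longlonglongrightarrow> 0" "\<And>n x. norm x \<ge> d \<Longrightarrow> \<bar>x$1\<bar> \<le> 3*R \<Longrightarrow> \<bar>x$2\<bar> \<le> 3*R \<Longrightarrow> peak_kernel (2*R) n x \<le> m' n"
    using kernel_concentrates[OF R d(1)] by blast
  define m where "m n = \<bar>m' n\<bar>" for n
  have m: "m \<longlonglongrightarrow> 0" "\<And>n x. norm x \<ge> d \<Longrightarrow> \<bar>x$1\<bar> \<le> 3*R \<Longrightarrow> \<bar>x$2\<bar> \<le> 3*R \<Longrightarrow> peak_kernel (2*R) n x \<le> m n"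
    and m0: "\<And>n. 0 \<le> m n"
    unfolding m_def using tendsto_rabs_zero[OF m'(1)] m'(2) by (auto intro: order_trans[OF _ abs_ge_self])
  define c where "c = (2 * (2*R))\<^sup>2 * (2 * B)"
  have c: "c > 0" using R B by (simp add: c_def)
  have "(\<lambda>n. c * m n) \<longlonglongrightarrow> c * 0" by (intro tendsto_intros m(1))
  then have "eventually (\<lambda>n. c * m n < e/2) sequentially"
    using e by (intro order_tendstoD(2)[of _ "c * 0"]) auto
  then obtain N where N: "\<And>n. n \<ge> N \<Longrightarrow> c * m n < e/2" unfolding eventually_sequentially by blast
  have "norm (mollify (2*R) n g x - g x) \<le> e" if n: "n \<ge> N" and x: "x \<in> ?D" for n x
  proof -
    let ?k = "\<lambda>y. peak_kernel (2*R) n (x - y)"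
    have kc: "continuous_on S ?k" for S by (intro continuous_intros)
    have "mollify (2*R) n g x = integral ?D (\<lambda>y. ?k y *\<^sub>R g y)"
      unfolding mollify_def
      by (intro lebesgue_integral_eq_integral continuous_imp_integrable continuous_intros kc gc) auto
    moreover have "g x = integral ?D (\<lambda>y. ?k y *\<^sub>R g x)"
      using integral_linear[OF integrable_continuous[OF kc] bounded_linear_scaleR_left, of "vec (-(2*R))" "vec (2*R)" "g x"]
      by (simp add: o_def kernel_integral_shift(2)[OF l])
    ultimately have "mollify (2*R) n g x - g x = integral ?D (\<lambda>y. ?k y *\<^sub>R g y) - integral ?D (\<lambda>y. ?k y *\<^sub>R g x)"
      by simp
    also have "\<dots> = integral ?D (\<lambda>y. ?k y *\<^sub>R g y - ?k y *\<^sub>R g x)"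
      by (intro Henstock_Kurzweil_Integration.integral_diff[symmetric] integrable_continuous continuous_intros kc gc)
    also have "norm \<dots> \<le> integral ?D (\<lambda>y. (e/2) * ?k y + 2 * B * m n)"
    proof (rule integral_norm_bound_integral)
      show "(\<lambda>y. ?k y *\<^sub>R g y - ?k y *\<^sub>R g x) integrable_on ?D" "(\<lambda>y. (e/2) * ?k y + 2 * B * m n) integrable_on ?D"
        by (intro integrable_continuous continuous_intros kc gc)+
      fix y assume y: "y \<in> ?D"
      have "\<bar>(x - y)$i\<bar> \<le> 3*R" if "x \<in> period_box R \<or> y \<in> period_box R" for i
      proof -
        have "-(2*R) \<le> x$i \<and> x$i \<le> 2*R" "-(2*R) \<le> y$i \<and> y$i \<le> 2*R"
          using x y by (auto simp: mem_box_cart)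
        moreover have "(-R \<le> x$i \<and> x$i \<le> R) \<or> (-R \<le> y$i \<and> y$i \<le> R)"
          using that by (auto simp: mem_box_cart)
        ultimately show ?thesis unfolding vector_minus_component by linarith
      qed
      moreover have "x \<in> period_box R \<or> y \<in> period_box R" if "g x \<noteq> g y"
        using that g(2) by metis
      ultimately have far: "?k y \<le> m n" if "norm (x - y) \<ge> d" "g x \<noteq> g y"
        using that by (intro m(2)) auto
      have eq: "norm (?k y *\<^sub>R g y - ?k y *\<^sub>R g x) = ?k y * norm (g y - g x)"
        unfolding scaleR_diff_right[symmetric] norm_scaleR using kernel_nonneg[of "2*R" n "x - y"] by simp
      show "norm (?k y *\<^sub>R g y - ?k y *\<^sub>R g x) \<le> (e/2) * ?k y + 2 * B * m n"
      proof (cases "norm (x - y) < d \<or> g x = g y")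
        case True
        then have "norm (g y - g x) \<le> e/2" using d(2)[OF x y] e by (auto simp: dist_norm norm_minus_commute)
        then have "?k y * norm (g y - g x) \<le> ?k y * (e/2)" by (intro mult_left_mono kernel_nonneg)
        moreover have "0 \<le> 2 * B * m n" using B(1) m0 by simp
        ultimately show ?thesis unfolding eq mult.commute[of "?k y" "e/2"] by linarith
      next
        case False
        have "norm (g y - g x) \<le> 2 * B" using norm_triangle_ineq4[of "g y" "g x"] B(2)[OF x] B(2)[OF y] by linarith
        then have "?k y * norm (g y - g x) \<le> m n * (2 * B)"
          using False far m0 by (intro mult_mono) auto
        moreover have "0 \<le> e/2 * ?k y" using e kernel_nonneg[of "2*R" n "x - y"] by simp
        ultimately show ?thesis unfolding eq by (simp add: mult.commute)
      qed
    qed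
    also have "\<dots> = integral ?D (\<lambda>y. (e/2) * ?k y) + integral ?D (\<lambda>y. 2 * B * m n)"
      by (intro Henstock_Kurzweil_Integration.integral_add integrable_continuous continuous_intros kc)
    also have "\<dots> = e/2 + c * m n"
      using kernel_integral_shift(2)[OF l, of n x] content_period_box[OF l] by (simp add: c_def)
    also have "\<dots> \<le> e" using N[OF n] by simp
    finally show ?thesis .
  qed
  then show ?thesis by blast
qed


lemma mollify_diff:
  assumes "integrable (lebesgue_on (period_box l)) f" "integrable (lebesgue_on (period_box l)) g"
  shows "mollify l n (\<lambda>x. f x - g x) x = mollify l n f x - mollify l n g x"
  unfolding mollify_def scaleR_diff_right
  by (intro Bochner_Integration.integral_diff integrable_kernel_mult assms)

text \<open>Approximation of \<open>f\<close> by continuous functions: their mollifications converge uniformly, and the error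
  is controlled by \<open>mollify_L1_bound\<close>.\<close>

lemma mollify_tendsto_L1:
  assumes R: "R > 0" and f: "integrable (lebesgue_on (period_box (2*R))) f"
    and g: "\<And>m. continuous_on UNIV (g m)" "\<And>m x. x \<notin> period_box R \<Longrightarrow> g m x = 0"
    and lim: "(\<lambda>m. \<integral>x. norm (g m x - f x) \<partial>lebesgue_on (period_box (2*R))) \<longlonglongrightarrow> 0"
  shows "(\<lambda>n. \<integral>x. norm (mollify (2*R) n f x - f x) \<partial>lebesgue_on (period_box (2*R))) \<longlonglongrightarrow> 0"
proof -
  define l where "l = 2*R"
  have l: "l > 0" using R by (simp add: l_def)
  let ?M = "lebesgue_on (period_box l)"
  have f: "integrable ?M f" using f by (simp add: l_def)
  have gi: "integrable ?M (g m)" for m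
    using continuous_imp_integrable continuous_on_subset[OF g(1)] by blast
  have mi: "integrable ?M (mollify l n h)" if "integrable ?M h" for n h
    using continuous_imp_integrable continuous_on_mollify[OF that] by blast
  define E where "E h n = (\<integral>x. norm (mollify l n h x - h x) \<partial>?M)" for h n
  define c where "c = (2 * l)\<^sup>2"
  have c: "c > 0" using l by (simp add: c_def)
  have "E f \<longlonglongrightarrow> 0"
  proof (rule LIMSEQ_I)
    fix r :: real assume r: "r > 0"
    have "eventually (\<lambda>m. (\<integral>x. norm (g m x - f x) \<partial>?M) < r/4) sequentially"
      using order_tendstoD(2)[OF lim, of "r/4"] r by (simp add: l_def)
    then obtain m where m: "(\<integral>x. norm (g m x - f x) \<partial>?M) < r/4"
      unfolding eventually_sequentially by blast
    have "r / (4 * c) > 0" using r c by simp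
    from mollify_uniform_limit[OF R g(1,2) this]
    obtain N where N: "\<And>n x. n \<ge> N \<Longrightarrow> x \<in> period_box l \<Longrightarrow> norm (mollify l n (g m) x - g m x) \<le> r / (4 * c)"
      unfolding l_def by blast
    have "E f n < r" if n: "n \<ge> N" for n
    proof -
      define h where "h x = f x - g m x" for x
      have h: "integrable ?M h" unfolding h_def using f gi by auto
      have "E f n \<le> (\<integral>x. norm (mollify l n h x) + norm (mollify l n (g m) x - g m x) + norm (g m x - f x) \<partial>?M)"
        unfolding E_def
      proof (rule integral_mono)
        fix x
        have "mollify l n f x - f x = mollify l n h x + (mollify l n (g m) x - g m x) + (g m x - f x)"
          unfolding h_def mollify_diff[OF f gi] by simp
        then show "norm (mollify l n f x - f x) \<le> norm (mollify l n h x) + norm (mollify l n (g m) x - g m x) + norm (g m x - f x)"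
          by (metis norm_triangle_mono norm_triangle_ineq order_refl)
      qed (intro Bochner_Integration.integrable_add Bochner_Integration.integrable_diff integrable_norm mi h gi f)+
      also have "\<dots> = (\<integral>x. norm (mollify l n h x) \<partial>?M) + (\<integral>x. norm (mollify l n (g m) x - g m x) \<partial>?M) + (\<integral>x. norm (g m x - f x) \<partial>?M)"
        by (simp add: mi h gi f)
      also have "(\<integral>x. norm (mollify l n h x) \<partial>?M) = integral (period_box l) (\<lambda>x. norm (mollify l n h x))"
        by (intro lebesgue_integral_eq_integral) (auto intro!: mi h)
      also have "\<dots> \<le> (\<integral>y. norm (h y) \<partial>?M)" by (rule mollify_L1_bound[OF l h])
      also have "\<dots> = (\<integral>x. norm (g m x - f x) \<partial>?M)" by (simp add: h_def norm_minus_commute)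
      also have "(\<integral>x. norm (mollify l n (g m) x - g m x) \<partial>?M) \<le> (\<integral>x. r / (4 * c) \<partial>?M)"
      proof (rule integral_mono)
        show "integrable ?M (\<lambda>x. r / (4 * c))" by (intro continuous_imp_integrable continuous_intros) 
      qed (auto intro!: mi gi N n)
      also have "\<dots> = integral (period_box l) (\<lambda>x. r / (4 * c))"
        by (intro lebesgue_integral_eq_integral continuous_imp_integrable continuous_on_const) auto
      also have "\<dots> = r / 4" using c content_period_box[OF l] by (simp add: c_def)
      finally show ?thesis using m r by simp
    qed
    moreover have "0 \<le> E f n" for n unfolding E_def by simp
    ultimately show "\<exists>N. \<forall>n\<ge>N. norm (E f n - 0) < r" by (auto intro!: exI[of _ N])
  qed
  then show ?thesis unfolding E_def l_def .
qed

section \<open>Quasiconvexity of the quartic\<close>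

lemma extend_by_zero:
  fixes h :: "real^2 \<Rightarrow> 'b::{banach, second_countable_topology}"
  assumes "U \<in> sets lebesgue" "U \<subseteq> period_box l"
  shows "integrable (lebesgue_on (period_box l)) (\<lambda>x. indicator U x *\<^sub>R h x) \<longleftrightarrow> integrable (lebesgue_on U) h"
    "(\<integral>x. indicator U x *\<^sub>R h x \<partial>lebesgue_on (period_box l)) = (\<integral>x. h x \<partial>lebesgue_on U)"
proof -
  have *: "indicat_real (period_box l) x * indicat_real U x = indicat_real U x" for x
    using assms(2) by (auto simp: indicator_def)
  show "integrable (lebesgue_on (period_box l)) (\<lambda>x. indicator U x *\<^sub>R h x) \<longleftrightarrow> integrable (lebesgue_on U) h"
    by (subst integrable_restrict_space, simp, subst integrable_restrict_space) (use assms in \<open>auto simp: *\<close>)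
  show "(\<integral>x. indicator U x *\<^sub>R h x \<partial>lebesgue_on (period_box l)) = (\<integral>x. h x \<partial>lebesgue_on U)"
    by (subst integral_restrict_space, simp, subst integral_restrict_space) (use assms in \<open>auto simp: *\<close>)
qed

lemma period_box_mono:
  assumes "r \<le> l"
  shows "period_box r \<subseteq> period_box l"
proof
  fix x :: "real^2" assume "x \<in> period_box r"
  then have *: "-r \<le> x$i \<and> x$i \<le> r" for i by (simp add: mem_box_cart)
  have "-l \<le> x$i \<and> x$i \<le> l" for i using *[of i] assms by linarith
  then show "x \<in> period_box l" by (simp add: mem_box_cart)
qed

text \<open>The mollified gradient, shifted by a constant matrix, is the time zero state of a heat flow as in
  \<open>periodic_map\<close>: its Fourier coefficients are those of a gradient times the coefficients of the kernel.\<close>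

lemma mollified_gradient_energy:
  fixes \<phi> :: "real^2 \<Rightarrow> real^2"
  assumes l: "l > 0" and W: "W_1_1_zero U \<phi> G" and U: "U \<in> sets lebesgue" "U \<subseteq> period_box l"
    and rc: "2*\<alpha> + \<beta> \<ge> 0" "2*\<gamma> + \<beta> \<ge> 0" "6*\<alpha> + \<beta> \<ge> 0" "6*\<gamma> + \<beta> \<ge> 0"
      "4*\<beta>\<^sup>2 \<le> (6*\<alpha> + \<beta>) * (6*\<gamma> + \<beta>)"
  defines "\<zeta> \<equiv> \<lambda>x. indicator U x *\<^sub>R conformal_part (G x)" and "\<omega> \<equiv> \<lambda>x. indicator U x *\<^sub>R anticonformal_part (G x)"
  assumes int: "integrable (lebesgue_on (period_box l)) \<zeta>" "integrable (lebesgue_on (period_box l)) \<omega>"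
  shows "(2 * l)\<^sup>2 * quartic \<alpha> \<beta> \<gamma> z0 w0
    \<le> (\<integral>x. quartic \<alpha> \<beta> \<gamma> (z0 + mollify l n \<zeta> x) (w0 + mollify l n \<omega> x) \<partial>lebesgue_on (period_box l))"
proof -
  define \<phi>h where "\<phi>h = fourier U (pi / l) (\<lambda>y. Complex (\<phi> y $ 1) (\<phi> y $ 2))"
  obtain K a where K: "finite K" "\<And>x. complex_of_real (peak_kernel l n x) = (\<Sum>k\<in>K. a k * wave (pi / l) k x)"
    using kernel_expansion by blast
  interpret periodic_map l K "\<lambda>k. a k * \<phi>h k" z0 w0
    by standard (use l K in auto)
  have four: "fourier (period_box l) (pi / l) (\<lambda>x. indicator U x *\<^sub>R f x) k = fourier U (pi / l) f k" for f :: "real^2 \<Rightarrow> complex" and k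
    unfolding fourier_def using extend_by_zero(2)[OF U, of "\<lambda>y. f y * wave (pi / l) (-k) y"] by simp
  have d: "decay k 0 = 1" for k by (simp add: decay_def)
  have "z 0 x = z0 + mollify l n \<zeta> x" for x
    unfolding z_def mollify_series[OF K int(1)] d
    unfolding \<zeta>_def four fourier_weak_gradient(1)[OF W U(1)] \<phi>h_def by (simp add: mult_ac)
  moreover have "w 0 x = w0 + mollify l n \<omega> x" for x
    unfolding w_def mollify_series[OF K int(2)] d
    unfolding \<omega>_def four fourier_weak_gradient(2)[OF W U(1)] \<phi>h_def by (simp add: mult_ac)
  ultimately have "energy \<alpha> \<beta> \<gamma> 0 = integral (period_box l) (\<lambda>x. quartic \<alpha> \<beta> \<gamma> (z0 + mollify l n \<zeta> x) (w0 + mollify l n \<omega> x))"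
    unfolding energy_def by simp
  also have "\<dots> = (\<integral>x. quartic \<alpha> \<beta> \<gamma> (z0 + mollify l n \<zeta> x) (w0 + mollify l n \<omega> x) \<partial>lebesgue_on (period_box l))"
    by (intro lebesgue_integral_eq_integral[symmetric] continuous_imp_integrable continuous_intros continuous_on_mollify int) auto
  finally show ?thesis using periodic_quasiconvex[OF rc] by simp
qed

lemma mollified_part_tendsto_L1:
  fixes \<phi> :: "real^2 \<Rightarrow> real^2" and p :: "real^2^2 \<Rightarrow> complex"
  assumes R: "R > 0" and W: "W_1_1_zero U \<phi> G" and U: "U \<in> sets lebesgue" "U \<subseteq> period_box R"
    and p: "linear p"
  defines "f \<equiv> \<lambda>x. indicator U x *\<^sub>R p (G x)"
  shows "integrable (lebesgue_on (period_box (2*R))) f"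
    "(\<lambda>n. \<integral>x. norm (mollify (2*R) n f x - f x) \<partial>lebesgue_on (period_box (2*R))) \<longlonglongrightarrow> 0"
proof -
  have bl: "bounded_linear p" using p linear_conv_bounded_linear by blast
  then obtain C where C: "\<And>A. norm (p A) \<le> norm A * C" "C > 0"
    using bounded_linear.pos_bounded[OF bl] by blast
  have U2: "U \<subseteq> period_box (2*R)"
    using U(2) R period_box_mono[of R "2*R"] by auto
  obtain \<psi> where \<psi>: "\<And>k::nat. test_function U (\<psi> k)"
    and lG: "(\<lambda>k. \<integral>\<^sup>+x. ennreal (norm (jacobian (\<psi> k) (at x) - G x)) \<partial>lebesgue_on U) \<longlonglongrightarrow> 0"
    and int: "integrable (lebesgue_on U) G"
    using W unfolding W_1_1_zero_def by blast
  show fi: "integrable (lebesgue_on (period_box (2*R))) f"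
    unfolding f_def extend_by_zero(1)[OF U(1) U2] by (rule integrable_bounded_linear[OF bl int])
  define J where "J k x = jacobian (\<psi> k) (at x)" for k x
  define g where "g k x = p (J k x)" for k x
  have Jc: "continuous_on UNIV (J k)" and J0: "x \<notin> U \<Longrightarrow> J k x = 0" and Ji: "integrable (lebesgue_on U) (J k)" for k x
  proof -
    obtain K where K: "compact K" "K \<subseteq> U" "\<And>x. x \<notin> K \<Longrightarrow> \<psi> k x = 0" and s: "smooth (\<psi> k)"
      using \<psi>[of k] unfolding test_function_def by blast
    show c: "continuous_on UNIV (J k)" unfolding J_def[abs_def] by (rule continuous_on_jacobian[OF s])
    have z: "J k x = 0" if "x \<notin> K" for x
      unfolding J_def by (rule jacobian_outside_support[OF K(1,3) that])
    then show "x \<notin> U \<Longrightarrow> J k x = 0" using K(2) by blast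
    show "integrable (lebesgue_on U) (J k)"
      by (rule compact_support_integrable(3)[OF c K(1) z U(1)])
  qed
  have "(\<lambda>k. \<integral>x. norm (g k x - f x) \<partial>lebesgue_on (period_box (2*R))) \<longlonglongrightarrow> 0"
  proof -
    have d: "integrable (lebesgue_on U) (\<lambda>x. J k x - G x)" for k
      by (rule Bochner_Integration.integrable_diff[OF Ji int])
    have nn: "(\<integral>\<^sup>+x. ennreal (norm (J k x - G x)) \<partial>lebesgue_on U) = ennreal (\<integral>x. norm (J k x - G x) \<partial>lebesgue_on U)" for k
      by (rule nn_integral_eq_integral[OF integrable_norm[OF d]]) simp
    have "(\<lambda>k. ennreal (\<integral>x. norm (J k x - G x) \<partial>lebesgue_on U)) \<longlonglongrightarrow> ennreal 0"
      using lG unfolding J_def[symmetric] nn by simp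
    then have lim: "(\<lambda>k. \<integral>x. norm (J k x - G x) \<partial>lebesgue_on U) \<longlonglongrightarrow> 0"
      by (subst (asm) tendsto_ennreal_iff) auto
    have eq: "norm (g k x - f x) = indicator U x *\<^sub>R norm (p (J k x - G x))" for k x
      using J0[of x k] linear_0[OF p] by (auto simp: g_def f_def indicator_def linear_diff[OF p])
    have le: "(\<integral>x. norm (g k x - f x) \<partial>lebesgue_on (period_box (2*R))) \<le> (\<integral>x. norm (J k x - G x) \<partial>lebesgue_on U) * C" for k
    proof -
      have "(\<integral>x. norm (g k x - f x) \<partial>lebesgue_on (period_box (2*R))) = (\<integral>x. norm (p (J k x - G x)) \<partial>lebesgue_on U)"
        unfolding eq by (rule extend_by_zero(2)[OF U(1) U2])
      also have "\<dots> \<le> (\<integral>x. norm (J k x - G x) * C \<partial>lebesgue_on U)"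
        by (rule integral_mono[OF integrable_norm[OF integrable_bounded_linear[OF bl d]] integrable_mult_left[OF integrable_norm[OF d]] C(1)])
      finally show ?thesis by simp
    qed
    have "(\<lambda>k. (\<integral>x. norm (J k x - G x) \<partial>lebesgue_on U) * C) \<longlonglongrightarrow> 0 * C" by (intro tendsto_intros lim)
    then have lim0: "(\<lambda>k. (\<integral>x. norm (J k x - G x) \<partial>lebesgue_on U) * C) \<longlonglongrightarrow> 0" by simp
    show ?thesis
      by (rule tendsto_sandwich[OF _ _ tendsto_const lim0]) (simp_all add: le)
  qed
  then show "(\<lambda>n. \<integral>x. norm (mollify (2*R) n f x - f x) \<partial>lebesgue_on (period_box (2*R))) \<longlonglongrightarrow> 0"
  proof (rule mollify_tendsto_L1[OF R fi, rotated 2])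
    show "continuous_on UNIV (g m)" for m
      unfolding g_def[abs_def] by (intro bounded_linear.continuous_on[OF bl] Jc)
    fix m and x :: "real^2" assume "x \<notin> period_box R"
    then have "x \<notin> U" using U(2) by blast
    then have "J m x = 0" by (rule J0)
    then show "g m x = 0" unfolding g_def by (metis linear_0[OF p])
  qed
qed

text \<open>Mollification gives the inequality on the period box for the smoothed gradients. These are uniformly
  bounded and, along a subsequence, converge almost everywhere, so dominated convergence applies. Outside
  \<open>U\<close> the extended gradient is zero and both sides agree.\<close>

lemma quartic_quasiconvex_inequality:
  fixes \<phi> :: "real^2 \<Rightarrow> real^2"
  assumes U: "U \<in> sets lebesgue" "bounded U" and W: "W_1_infinity_zero U \<phi> G"
    and rc: "2*\<alpha> + \<beta> \<ge> 0" "2*\<gamma> + \<beta> \<ge> 0" "6*\<alpha> + \<beta> \<ge> 0" "6*\<gamma> + \<beta> \<ge> 0"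
      "4*\<beta>\<^sup>2 \<le> (6*\<alpha> + \<beta>) * (6*\<gamma> + \<beta>)"
  shows "measure lebesgue U * quartic \<alpha> \<beta> \<gamma> (conformal_part F) (anticonformal_part F)
    \<le> (\<integral>x. quartic \<alpha> \<beta> \<gamma> (conformal_part (F + G x)) (anticonformal_part (F + G x)) \<partial>lebesgue_on U)"
proof -
  have W11: "W_1_1_zero U \<phi> G" and Winf: "L_infinity_on G U"
    using W unfolding W_1_infinity_zero_def W_1_infinity_def by auto
  obtain R where R: "R > 0" "U \<subseteq> period_box R"
  proof -
    obtain B where B: "B > 0" "\<And>x. x \<in> U \<Longrightarrow> norm x \<le> B" using U(2) unfolding bounded_pos by blast
    have "U \<subseteq> period_box B"
    proof
      fix x assume "x \<in> U"
      then have "\<bar>x $ i\<bar> \<le> B" for i using B(2) component_le_norm_cart[of x i] by (meson order_trans)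
      then show "x \<in> period_box B" by (auto simp: mem_box_cart abs_le_iff minus_le_iff)
    qed
    with B(1) show ?thesis using that by blast
  qed
  define l where "l = 2*R"
  have l: "l > 0" using R by (simp add: l_def)
  have Ul: "U \<subseteq> period_box l"
    using R period_box_mono[of R l] by (auto simp: l_def)
  let ?M = "lebesgue_on (period_box l)"
  define \<zeta> where "\<zeta> = (\<lambda>x. indicator U x *\<^sub>R conformal_part (G x))"
  define \<omega> where "\<omega> = (\<lambda>x. indicator U x *\<^sub>R anticonformal_part (G x))"
  define z0 w0 where "z0 = conformal_part F" and "w0 = anticonformal_part F"
  define q where "q = quartic \<alpha> \<beta> \<gamma> z0 w0"
  have \<zeta>: "integrable ?M \<zeta>" "(\<lambda>n. \<integral>x. norm (mollify l n \<zeta> x - \<zeta> x) \<partial>?M) \<longlonglongrightarrow> 0"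
    using mollified_part_tendsto_L1[OF R(1) W11 U(1) R(2) linear_parts(1)] unfolding \<zeta>_def l_def by blast+
  have \<omega>: "integrable ?M \<omega>" "(\<lambda>n. \<integral>x. norm (mollify l n \<omega> x - \<omega> x) \<partial>?M) \<longlonglongrightarrow> 0"
    using mollified_part_tendsto_L1[OF R(1) W11 U(1) R(2) linear_parts(2)] unfolding \<omega>_def l_def by blast+
  have mi: "integrable ?M (mollify l n h)" if "integrable ?M h" for n h
    using continuous_imp_integrable continuous_on_mollify[OF that] by blast
  define u where "u n x = norm (mollify l n \<zeta> x - \<zeta> x) + norm (mollify l n \<omega> x - \<omega> x)" for n x
  have ui: "integrable ?M (u n)" for n
    unfolding u_def[abs_def] by (intro Bochner_Integration.integrable_add integrable_norm Bochner_Integration.integrable_diff mi \<zeta>(1) \<omega>(1))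
  have "(\<lambda>n. \<integral>x. norm (u n x) \<partial>?M) \<longlonglongrightarrow> 0"
  proof -
    have "(\<integral>x. norm (u n x) \<partial>?M) = (\<integral>x. norm (mollify l n \<zeta> x - \<zeta> x) \<partial>?M) + (\<integral>x. norm (mollify l n \<omega> x - \<omega> x) \<partial>?M)" for n
      unfolding u_def by (simp add: mi \<zeta>(1) \<omega>(1))
    then show ?thesis using tendsto_add[OF \<zeta>(2) \<omega>(2)] by simp
  qed
  from tendsto_L1_AE_subseq[OF ui this] obtain r where r: "strict_mono r" "AE x in ?M. (\<lambda>n. u (r n) x) \<longlonglongrightarrow> 0"
    by blast
  have lim: "AE x in ?M. (\<lambda>n. mollify l (r n) \<zeta> x) \<longlonglongrightarrow> \<zeta> x \<and> (\<lambda>n. mollify l (r n) \<omega> x) \<longlonglongrightarrow> \<omega> x"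
    using r(2)
  proof eventually_elim
    case (elim x)
    have "(\<lambda>n. mollify l (r n) \<zeta> x - \<zeta> x) \<longlonglongrightarrow> 0" "(\<lambda>n. mollify l (r n) \<omega> x - \<omega> x) \<longlonglongrightarrow> 0"
      by (rule Lim_null_comparison[OF _ elim], simp add: u_def)+
    then show ?case by (simp add: LIM_zero_iff)
  qed
  obtain M where M: "AE x in ?M. norm (\<zeta> x) \<le> M" "AE x in ?M. norm (\<omega> x) \<le> M"
  proof -
    obtain C where C: "AE x in lebesgue_on U. norm (G x) \<le> C" using Winf unfolding L_infinity_on_def by blast
    have bound: "\<exists>B. AE x in ?M. norm (indicator U x *\<^sub>R p (G x)) \<le> B" if "linear p" for p :: "real^2^2 \<Rightarrow> complex"
    proof -
      obtain D where D: "\<And>A. norm (p A) \<le> norm A * D" "D > 0"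
        using bounded_linear.pos_bounded[of p] \<open>linear p\<close>[unfolded linear_conv_bounded_linear] by blast
      have "AE x in lebesgue. x \<in> U \<longrightarrow> norm (G x) \<le> C"
        using C by (subst (asm) AE_restrict_space_iff) (use U in auto)
      then have "AE x in lebesgue. norm (indicator U x *\<^sub>R p (G x)) \<le> \<bar>C\<bar> * D"
      proof eventually_elim
        case (elim x)
        show ?case
        proof (cases "x \<in> U")
          case True
          then have "norm (p (G x)) \<le> norm (G x) * D" "norm (G x) * D \<le> \<bar>C\<bar> * D"
            using D elim by (auto intro!: mult_right_mono)
          then show ?thesis using True by simp
        qed (use D in simp)
      qed
      then show ?thesis by (subst AE_restrict_space_iff) auto
    qed
    obtain B1 B2 where B: "AE x in ?M. norm (\<zeta> x) \<le> B1" "AE x in ?M. norm (\<omega> x) \<le> B2"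
      using bound[OF linear_parts(1)] bound[OF linear_parts(2)] unfolding \<zeta>_def \<omega>_def by blast
    have "AE x in ?M. norm (\<zeta> x) \<le> max B1 B2" using B(1) by eventually_elim (rule max.coboundedI1)
    moreover have "AE x in ?M. norm (\<omega> x) \<le> max B1 B2" using B(2) by eventually_elim (rule max.coboundedI2)
    ultimately show ?thesis by (rule that)
  qed
  define N where "N = norm z0 + norm w0 + M"
  have N: "norm (z0 + mollify l n \<zeta> x) \<le> N" "norm (w0 + mollify l n \<omega> x) \<le> N" for n x
    using mollify_bounded[OF l \<zeta>(1) M(1), of n x] mollify_bounded[OF l \<omega>(1) M(2), of n x]
      norm_triangle_ineq[of z0 "mollify l n \<zeta> x"] norm_triangle_ineq[of w0 "mollify l n \<omega> x"]
      norm_ge_zero[of z0] norm_ge_zero[of w0]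
    unfolding N_def by linarith+
  define f where "f x = quartic \<alpha> \<beta> \<gamma> (z0 + \<zeta> x) (w0 + \<omega> x)" for x
  define B where "B = (\<bar>\<alpha>\<bar> + \<bar>\<beta>\<bar> + \<bar>\<gamma>\<bar>) * N^4"
  have fm: "f \<in> borel_measurable ?M"
    unfolding f_def[abs_def] quartic_def
    using borel_measurable_integrable[OF \<zeta>(1)] borel_measurable_integrable[OF \<omega>(1)] by measurable
  have const: "integrable ?M (\<lambda>_. c)" for c :: real by (intro continuous_imp_integrable continuous_on_const)
  have dom: "integrable ?M f"
    "(\<lambda>n. \<integral>x. quartic \<alpha> \<beta> \<gamma> (z0 + mollify l (r n) \<zeta> x) (w0 + mollify l (r n) \<omega> x) \<partial>?M) \<longlonglongrightarrow> integral\<^sup>L ?M f"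
  proof -
    have meas: "(\<lambda>x. quartic \<alpha> \<beta> \<gamma> (z0 + mollify l (r n) \<zeta> x) (w0 + mollify l (r n) \<omega> x)) \<in> borel_measurable ?M" for n
      by (intro borel_measurable_integrable continuous_imp_integrable continuous_intros continuous_on_mollify \<zeta>(1) \<omega>(1))
    have L: "AE x in ?M. (\<lambda>n. quartic \<alpha> \<beta> \<gamma> (z0 + mollify l (r n) \<zeta> x) (w0 + mollify l (r n) \<omega> x)) \<longlonglongrightarrow> f x"
      using lim unfolding f_def quartic_def by eventually_elim (intro tendsto_intros, auto)
    have D: "AE x in ?M. norm (quartic \<alpha> \<beta> \<gamma> (z0 + mollify l (r n) \<zeta> x) (w0 + mollify l (r n) \<omega> x)) \<le> B" for n
      unfolding B_def by (intro AE_I2) (simp add: quartic_bound N)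
    show "integrable ?M f" by (rule integrable_dominated_convergence[OF fm meas const L D])
    show "(\<lambda>n. \<integral>x. quartic \<alpha> \<beta> \<gamma> (z0 + mollify l (r n) \<zeta> x) (w0 + mollify l (r n) \<omega> x) \<partial>?M) \<longlonglongrightarrow> integral\<^sup>L ?M f"
      by (rule integral_dominated_convergence[OF fm meas const L D])
  qed
  have "(2 * l)\<^sup>2 * q \<le> integral\<^sup>L ?M f"
    unfolding q_def
    by (rule LIMSEQ_le_const[OF dom(2)])
      (use mollified_gradient_energy[OF l W11 U(1) Ul rc, folded \<zeta>_def \<omega>_def, OF \<zeta>(1) \<omega>(1)] in blast)
  moreover have cq: "(\<integral>x. q \<partial>?M) = (2 * l)\<^sup>2 * q"
    by (subst lebesgue_integral_eq_integral[OF const]) (use content_period_box[OF l] in auto)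
  ultimately have "0 \<le> (\<integral>x. f x - q \<partial>?M)"
    unfolding Bochner_Integration.integral_diff[OF dom(1) const] by linarith
  define h where "h x = quartic \<alpha> \<beta> \<gamma> (conformal_part (F + G x)) (anticonformal_part (F + G x))" for x
  have fh: "f x - q = indicator U x *\<^sub>R (h x - q)" for x
    by (auto simp: f_def q_def h_def \<zeta>_def \<omega>_def z0_def w0_def indicator_def linear_add[OF linear_parts(1)] linear_add[OF linear_parts(2)])
  have hi: "integrable (lebesgue_on U) (\<lambda>x. h x - q)"
    unfolding extend_by_zero(1)[OF U(1) Ul, symmetric] fh[symmetric] by (intro Bochner_Integration.integrable_diff dom(1) const)
  interpret U: finite_measure "lebesgue_on U"
    using bounded_set_imp_lmeasurable[OF U(2,1)] by (rule finite_measure_lebesgue_on)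
  have cU: "integrable (lebesgue_on U) (\<lambda>x. q)" "(\<integral>x. q \<partial>lebesgue_on U) = measure lebesgue U * q"
    using U(1) by (simp_all add: measure_restrict_space)
  have "(\<integral>x. f x - q \<partial>?M) = (\<integral>x. h x - q \<partial>lebesgue_on U)"
    unfolding fh by (rule extend_by_zero(2)[OF U(1) Ul])
  also have "\<dots> = (\<integral>x. h x \<partial>lebesgue_on U) - measure lebesgue U * q"
    using Bochner_Integration.integral_diff[OF Bochner_Integration.integrable_add[OF hi cU(1)] cU(1)] cU(2) by simp
  finally show ?thesis using \<open>0 \<le> (\<integral>x. f x - q \<partial>?M)\<close> unfolding h_def q_def z0_def w0_def by simp
qed

section \<open>Smooth functions of compact support\<close>

text \<open>For \<open>m = 0\<close> the classical function \<open>exp (-1/t)\<close>. The powers of \<open>1/t\<close> are included since the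
  derivative of \<open>cutoff m\<close> is a combination of \<open>cutoff (m + 1)\<close> and \<open>cutoff (m + 2)\<close>.\<close>

definition cutoff :: "nat \<Rightarrow> real \<Rightarrow> real" where
  "cutoff m t = (if t > 0 then exp (- (1 / t)) / t ^ m else 0)"

lemma cutoff_outside_ball:
  fixes x :: "'a::real_inner"
  assumes "x \<notin> cball 0 (1/2)"
  shows "cutoff m (1/4 - x \<bullet> x) = 0"
proof -
  have "(1/2)\<^sup>2 < (norm x)\<^sup>2" using assms by (intro power_strict_mono) auto
  then show ?thesis by (simp add: cutoff_def power2_norm_eq_inner power_divide)
qed

text \<open>Exponential decay beats powers: \<open>exp (1/t) \<ge> (1/(k t)) ^ k\<close> with \<open>k = m + 2\<close>. The surplus factor \<open>t\<^sup>2\<close>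
  gives the derivative zero at the origin.\<close>

lemma cutoff_quadratic_bound: "\<bar>cutoff m t\<bar> \<le> real (m + 2) ^ (m + 2) * t\<^sup>2"
proof (cases "t > 0")
  case True
  define k where "k = m + 2"
  have k: "k > 0" by (simp add: k_def)
  have "(1 / (real k * t)) ^ k \<le> (1 + (1 / t) / real k) ^ k"
    using True k by (intro power_mono) (auto simp: mult.commute)
  also have "\<dots> \<le> exp (1 / t)"
    using True k by (intro exp_ge_one_plus_x_over_n_power_n) (auto intro: order_trans[of _ 0])
  finally have "inverse (exp (1 / t)) \<le> inverse ((1 / (real k * t)) ^ k)"
    using True k by (intro le_imp_inverse_le) auto
  then have "exp (- (1 / t)) \<le> (real k * t) ^ k"
    by (simp add: exp_minus power_divide)
  then have "exp (- (1 / t)) / t ^ m \<le> (real k * t) ^ k / t ^ m"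
    using True by (intro divide_right_mono) auto
  also have "\<dots> = real k ^ k * t\<^sup>2"
    using True by (simp add: k_def power_mult_distrib power_add power2_eq_square)
  finally show ?thesis using True by (simp add: cutoff_def k_def)
qed (simp add: cutoff_def)

lemma cutoff_has_derivative:
  "(cutoff m has_real_derivative cutoff (m + 2) t - real m * cutoff (m + 1) t) (at t)"
proof -
  consider "t > 0" | "t < 0" | "t = 0" by linarith
  then show ?thesis
  proof cases
    case 1
    have "((\<lambda>t. exp (- (1 / t)) / t ^ m) has_real_derivative cutoff (m + 2) t - real m * cutoff (m + 1) t) (at t)"
    proof -
      have "((\<lambda>t. exp (- (1 / t)) / t ^ m) has_real_derivative
          (exp (- (1 / t)) * (1 / t\<^sup>2) * t ^ m - exp (- (1 / t)) * (real m * t ^ (m - 1))) / (t ^ m * t ^ m)) (at t)"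
      proof (rule DERIV_divide)
        have "((\<lambda>t. - (1 / t)) has_real_derivative 1 / t\<^sup>2) (at t)"
          using 1 by (auto intro!: derivative_eq_intros simp: power2_eq_square)
        from DERIV_chain2[OF DERIV_exp this]
        show "((\<lambda>t. exp (- (1 / t))) has_real_derivative exp (- (1 / t)) * (1 / t\<^sup>2)) (at t)" .
        show "((\<lambda>t. t ^ m) has_real_derivative real m * t ^ (m - 1)) (at t)"
          using DERIV_pow[of m t] by simp
      qed (use 1 in simp)
      also have "(exp (- (1 / t)) * (1 / t\<^sup>2) * t ^ m - exp (- (1 / t)) * (real m * t ^ (m - 1))) / (t ^ m * t ^ m)
          = cutoff (m + 2) t - real m * cutoff (m + 1) t"
        using 1 by (cases m) (simp_all add: cutoff_def field_simps power2_eq_square)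
      finally show ?thesis .
    qed
    then show ?thesis
      by (rule has_field_derivative_transform_within_open[of _ _ _ "{0<..}"]) (use 1 in \<open>auto simp: cutoff_def\<close>)
  next
    case 2
    have "((\<lambda>t. 0) has_real_derivative cutoff (m + 2) t - real m * cutoff (m + 1) t) (at t)"
      using 2 by (simp add: cutoff_def)
    then show ?thesis
      by (rule has_field_derivative_transform_within_open[of _ _ _ "{..<0}"]) (use 2 in \<open>auto simp: cutoff_def\<close>)
  next
    case 3
    define C where "C = real (m + 2) ^ (m + 2)"
    have bound: "\<bar>cutoff m h / h\<bar> \<le> C * \<bar>h\<bar>" for h
    proof (cases "h = 0")
      case False
      have "\<bar>cutoff m h / h\<bar> \<le> C * h\<^sup>2 / \<bar>h\<bar>"
        unfolding abs_divide C_def by (intro divide_right_mono cutoff_quadratic_bound) auto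
      also have "\<dots> = C * \<bar>h\<bar>" using False by (cases "h > 0") (auto simp: power2_eq_square)
      finally show ?thesis .
    qed simp
    have "((\<lambda>h. C * \<bar>h\<bar>) \<longlongrightarrow> C * \<bar>0\<bar>) (at 0)" by (intro tendsto_intros)
    then have lim: "((\<lambda>h. C * \<bar>h\<bar>) \<longlongrightarrow> 0) (at 0)" by simp
    have "((\<lambda>h. cutoff m h / h) \<longlongrightarrow> 0) (at 0)"
      by (rule Lim_null_comparison[OF _ lim]) (use bound in \<open>simp add: always_eventually abs_divide\<close>)
    then show ?thesis using 3 by (simp add: has_field_derivative_iff cutoff_def)
  qed
qed

text \<open>A class of functions that is closed under partial derivatives; membership is thus enough for
  smoothness.\<close>

inductive elementary :: "(real^'n::finite \<Rightarrow> real) \<Rightarrow> bool" where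
  elementary_const: "elementary (\<lambda>x. c)"
| elementary_coordinate: "elementary (\<lambda>x. x $ i)"
| elementary_add: "elementary f \<Longrightarrow> elementary g \<Longrightarrow> elementary (\<lambda>x. f x + g x)"
| elementary_mult: "elementary f \<Longrightarrow> elementary g \<Longrightarrow> elementary (\<lambda>x. f x * g x)"
| elementary_sin: "elementary (\<lambda>x. sin (b \<bullet> x))"
| elementary_cos: "elementary (\<lambda>x. cos (b \<bullet> x))"
| elementary_cutoff: "elementary (\<lambda>x. cutoff m (1/4 - x \<bullet> x))"

lemma elementary_has_derivative:
  fixes f :: "real^'n \<Rightarrow> real"
  assumes "elementary f"
  shows "\<exists>f'. (\<forall>x. (f has_derivative f' x) (at x)) \<and> (\<forall>h. elementary (\<lambda>x. f' x h))"
  using assms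
proof induction
  case (elementary_const c)
  show ?case by (rule exI[of _ "\<lambda>x h. 0"]) (auto intro: elementary.intros)
next
  case (elementary_coordinate i)
  show ?case
    by (rule exI[of _ "\<lambda>x h. h $ i"])
      (auto intro: elementary.intros bounded_linear_imp_has_derivative bounded_linear_vec_nth)
next
  case (elementary_add f g)
  then obtain f' g' where "\<And>x. (f has_derivative f' x) (at x)" "\<And>h. elementary (\<lambda>x. f' x h)"
    "\<And>x. (g has_derivative g' x) (at x)" "\<And>h. elementary (\<lambda>x. g' x h)" by blast
  then show ?case
    by (intro exI[of _ "\<lambda>x h. f' x h + g' x h"]) (auto intro: elementary.intros has_derivative_add)
next
  case (elementary_mult f g)
  then obtain f' g' where "\<And>x. (f has_derivative f' x) (at x)" "\<And>h. elementary (\<lambda>x. f' x h)"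
    "\<And>x. (g has_derivative g' x) (at x)" "\<And>h. elementary (\<lambda>x. g' x h)" by blast
  with elementary_mult.hyps show ?case
    by (intro exI[of _ "\<lambda>x h. f x * g' x h + f' x h * g x"]) (auto intro!: elementary.intros has_derivative_mult)
next
  case (elementary_sin b)
  have "((\<lambda>x. sin (b \<bullet> x)) has_derivative (\<lambda>h. cos (b \<bullet> x) * (b \<bullet> h))) (at x)" for x
    by (auto intro!: derivative_eq_intros)
  then show ?case
    by (intro exI[of _ "\<lambda>x h. cos (b \<bullet> x) * (b \<bullet> h)"]) (auto intro: elementary.intros)
next
  case (elementary_cos b)
  have d: "((\<lambda>x. cos (b \<bullet> x)) has_derivative (\<lambda>h. sin (b \<bullet> x) * (- (b \<bullet> h)))) (at x)" for x
    by (auto intro!: derivative_eq_intros)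
  show ?case
    by (intro exI[of _ "\<lambda>x h. sin (b \<bullet> x) * (- (b \<bullet> h))"] conjI allI d elementary.intros)
next
  case (elementary_cutoff m)
  define r where "r x = 1/4 - x \<bullet> x" for x :: "real^'n"
  have dr: "(r has_derivative (\<lambda>h. - (2 * (x \<bullet> h)))) (at x)" for x
    unfolding r_def[abs_def] by (auto intro!: derivative_eq_intros simp: inner_commute)
  have d: "((\<lambda>x. cutoff m (r x)) has_derivative (\<lambda>h. (cutoff (m + 2) (r x) - real m * cutoff (m + 1) (r x)) * (- (2 * (x \<bullet> h))))) (at x)" for x
    using has_derivative_compose[OF dr cutoff_has_derivative[unfolded has_field_derivative_def]] .
  have sum: "elementary (\<lambda>x. \<Sum>i\<in>I. c i * x $ i)" if "finite I" for I and c :: "'n \<Rightarrow> real"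
    using that by induction (auto intro!: elementary.intros)
  have inner: "elementary (\<lambda>x. x \<bullet> h)" for h :: "real^'n"
    using sum[of UNIV "\<lambda>i. h $ i"] by (simp add: inner_vec_def mult.commute)
  have "elementary (\<lambda>x. (cutoff (m + 2) (r x) + (- real m) * cutoff (m + 1) (r x)) * ((-2) * (x \<bullet> h)))" for h
    unfolding r_def by (intro elementary.intros inner)
  then have el: "elementary (\<lambda>x. (cutoff (m + 2) (r x) - real m * cutoff (m + 1) (r x)) * (- (2 * (x \<bullet> h))))" for h
    by simp
  have "\<exists>f'. (\<forall>x. ((\<lambda>x. cutoff m (r x)) has_derivative f' x) (at x)) \<and> (\<forall>h. elementary (\<lambda>x. f' x h))"
    by (intro exI[of _ "\<lambda>x h. (cutoff (m + 2) (r x) - real m * cutoff (m + 1) (r x)) * (- (2 * (x \<bullet> h)))"] conjI allI d el)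
  then show ?case unfolding r_def .
qed

lemma elementary_smooth:
  fixes f :: "real^'n \<Rightarrow> real" and a :: "'b::real_normed_vector"
  assumes "elementary f"
  shows "smooth (\<lambda>x. f x *\<^sub>R a)"
proof -
  have d: "\<exists>f'. (\<forall>x. ((\<lambda>x. f x *\<^sub>R a) has_derivative (\<lambda>h. f' x h *\<^sub>R a)) (at x)) \<and> (\<forall>h. elementary (\<lambda>x. f' x h))"
    if el: "elementary f" for f :: "real^'n \<Rightarrow> real"
  proof -
    obtain f' where f': "\<And>x. (f has_derivative f' x) (at x)" "\<And>h. elementary (\<lambda>x. f' x h)"
      using elementary_has_derivative[OF el] by blast
    show ?thesis using has_derivative_scaleR_left[OF f'(1)] f'(2) by blast
  qed
  have "k_times_continuously_differentiable k (\<lambda>x. f x *\<^sub>R a)" for k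
    using assms
  proof (induction k arbitrary: f)
    case 0
    obtain f' where "\<And>x. ((\<lambda>x. f x *\<^sub>R a) has_derivative (\<lambda>h. f' x h *\<^sub>R a)) (at x)"
      using d[OF 0] by blast
    from has_derivative_continuous[OF this] show ?case
      by (simp add: continuous_at_imp_continuous_on)
  next
    case (Suc k)
    obtain f' where f': "\<And>x. ((\<lambda>x. f x *\<^sub>R a) has_derivative (\<lambda>h. f' x h *\<^sub>R a)) (at x)" "\<And>h. elementary (\<lambda>x. f' x h)"
      using d[OF Suc.prems] by blast
    have "partial_derivative j (\<lambda>x. f x *\<^sub>R a) = (\<lambda>x. f' x (axis j 1) *\<^sub>R a)" for j
      using partial_derivative_eq[OF f'(1)] by blast
    then show ?case using f' Suc.IH by (auto simp: differentiable_def)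
  qed
  then show ?thesis unfolding smooth_def by blast
qed

lemma test_function_in_W_1_infinity_zero:
  fixes \<phi> :: "real^'n \<Rightarrow> real^'m"
  assumes \<phi>: "test_function U \<phi>" and U: "U \<in> sets lebesgue"
  shows "W_1_infinity_zero U \<phi> (\<lambda>x. jacobian \<phi> (at x))"
proof -
  obtain K where K: "compact K" "K \<subseteq> U" "\<And>x. x \<notin> K \<Longrightarrow> \<phi> x = 0" and s: "smooth \<phi>"
    using \<phi> unfolding test_function_def by blast
  have c: "continuous_on UNIV \<phi>" by (rule smooth_C1(3)[OF s])
  have Jc: "continuous_on UNIV (\<lambda>x. jacobian \<phi> (at x))" by (rule continuous_on_jacobian[OF s])
  have J0: "jacobian \<phi> (at x) = 0" if "x \<notin> K" for x by (rule jacobian_outside_support[OF K(1,3) that])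
  have li: "locally_integrable_on f U \<and> integrable (lebesgue_on U) f \<and> L_infinity_on f U"
    if f: "continuous_on UNIV f" "\<And>x. x \<notin> K \<Longrightarrow> f x = 0" for f :: "real^'n \<Rightarrow> 'c::euclidean_space"
  proof (intro conjI)
    show "locally_integrable_on f U"
      unfolding locally_integrable_on_def
    proof (intro allI impI)
      fix K' :: "(real^'n) set" assume "compact K' \<and> K' \<subseteq> U"
      then have "K' \<in> sets lebesgue" using fmeasurableD[OF lmeasurable_compact] by blast
      from compact_support_integrable(3)[OF f(1) K(1) f(2) this] show "integrable (lebesgue_on K') f" by simp
    qed
    show i: "integrable (lebesgue_on U) f" by (rule compact_support_integrable(3)[OF f(1) K(1) f(2) U])
    have "bounded (f ` K)"
      by (intro compact_imp_bounded compact_continuous_image K(1) continuous_on_subset[OF f(1)]) auto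
    then obtain B where "\<And>x. x \<in> K \<Longrightarrow> norm (f x) \<le> B" by (auto simp: bounded_iff)
    then have "norm (f x) \<le> max B 0" for x using f(2)[of x] by (cases "x \<in> K") (auto simp: le_max_iff_disj)
    then show "L_infinity_on f U" unfolding L_infinity_on_def using borel_measurable_integrable[OF i] by blast
  qed
  have li1: "integrable (lebesgue_on U) \<phi> \<and> L_infinity_on \<phi> U" using li[OF c K(3)] by blast
  have li2: "integrable (lebesgue_on U) (\<lambda>x. jacobian \<phi> (at x)) \<and> L_infinity_on (\<lambda>x. jacobian \<phi> (at x)) U"
    using li[OF Jc J0] by blast
  have weak: "has_weak_jacobian_on \<phi> (\<lambda>x. jacobian \<phi> (at x)) U"
    unfolding has_weak_jacobian_on_def
  proof (intro conjI allI impI)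
    fix \<psi> :: "real^'n \<Rightarrow> real" and i j assume "test_function U \<psi>"
    then have "smooth \<psi>" unfolding test_function_def by blast
    from test_function_integration_by_parts[OF \<phi> U smooth_C1(1,2)[OF this], of i j]
    show "(\<integral>x. \<phi> x $ i * partial_derivative j \<psi> x \<partial>lebesgue_on U) = - (\<integral>x. jacobian \<phi> (at x) $ i $ j * \<psi> x \<partial>lebesgue_on U)"
      by simp
  qed (rule li[OF c K(3), THEN conjunct1], assumption, rule li[OF Jc J0, THEN conjunct1])
  have "W_1_1_zero U \<phi> (\<lambda>x. jacobian \<phi> (at x))"
    unfolding W_1_1_zero_def
  proof (intro conjI)
    show "\<exists>\<psi>::nat \<Rightarrow> real^'n \<Rightarrow> real^'m. (\<forall>k. test_function U (\<psi> k)) \<and>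
        (\<lambda>k. \<integral>\<^sup>+x. ennreal (norm (\<psi> k x - \<phi> x)) \<partial>lebesgue_on U) \<longlonglongrightarrow> 0 \<and>
        (\<lambda>k. \<integral>\<^sup>+x. ennreal (norm (jacobian (\<psi> k) (at x) - jacobian \<phi> (at x))) \<partial>lebesgue_on U) \<longlonglongrightarrow> 0"
      by (rule exI[of _ "\<lambda>_. \<phi>"]) (simp add: \<phi>)
  qed (rule weak, rule li1[THEN conjunct1], rule li2[THEN conjunct1])
  then show ?thesis
    unfolding W_1_infinity_zero_def W_1_infinity_def using weak li1 li2 by blast
qed

section \<open>Quasiconvexity implies rank-one convexity\<close>

text \<open>Near \<open>p\<close> the sphere is the graph of \<open>- sqrt (1 - |y'|\<^sup>2)\<close> over the hyperplane normal to \<open>p\<close>. Capping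
  \<open>|y'|\<close> at \<open>1/2\<close> makes this function Lipschitz on the whole space and changes nothing inside the ball of
  radius \<open>1/2\<close> around \<open>p\<close>.\<close>

lemma bounded_lipschitz_domain_unit_ball:
  "bounded_lipschitz_domain (ball (0::'a::euclidean_space) 1)"
  unfolding bounded_lipschitz_domain_def
proof (intro conjI ballI)
  fix p :: 'a assume "p \<in> frontier (ball 0 1)"
  then have p: "norm p = 1" by (simp add: frontier_ball dist_norm)
  define g :: "'a \<Rightarrow> real" where "g y = - sqrt (1 - (min (norm y) (1/2))\<^sup>2)" for y
  have lip: "1-lipschitz_on UNIV g"
  proof (rule lipschitz_onI)
    fix x y :: 'a
    define m n where "m = min (norm x) (1/2)" and "n = min (norm y) (1/2)"
    have mn: "0 \<le> m" "m \<le> 1/2" "0 \<le> n" "n \<le> 1/2" by (auto simp: m_def n_def)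
    have sq: "sqrt (1 - m\<^sup>2) \<ge> 1/2" if "0 \<le> m" "m \<le> 1/2" for m :: real
    proof (rule real_le_rsqrt)
      have "m\<^sup>2 \<le> (1/2)\<^sup>2" using that by (intro power_mono)
      then show "(1/2)\<^sup>2 \<le> 1 - m\<^sup>2" by (simp add: power2_eq_square)
    qed
    have ge: "m\<^sup>2 \<le> 1" "n\<^sup>2 \<le> 1" using mn power_mono[of m 1 2] power_mono[of n 1 2] by auto
    have "(sqrt (1 - m\<^sup>2) - sqrt (1 - n\<^sup>2)) * (sqrt (1 - m\<^sup>2) + sqrt (1 - n\<^sup>2)) = (n - m) * (n + m)"
      using ge by (simp add: algebra_simps power2_eq_square)
    then have "\<bar>sqrt (1 - m\<^sup>2) - sqrt (1 - n\<^sup>2)\<bar> * (sqrt (1 - m\<^sup>2) + sqrt (1 - n\<^sup>2)) = \<bar>n - m\<bar> * (n + m)"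
      using sq[OF mn(1,2)] sq[OF mn(3,4)] mn by (metis abs_mult abs_of_nonneg add_nonneg_nonneg real_sqrt_ge_zero diff_ge_0_iff_ge ge)
    moreover have "\<bar>sqrt (1 - m\<^sup>2) - sqrt (1 - n\<^sup>2)\<bar> * 1 \<le> \<bar>sqrt (1 - m\<^sup>2) - sqrt (1 - n\<^sup>2)\<bar> * (sqrt (1 - m\<^sup>2) + sqrt (1 - n\<^sup>2))"
      using sq[OF mn(1,2)] sq[OF mn(3,4)] by (intro mult_left_mono) auto
    moreover have "\<bar>n - m\<bar> * (n + m) \<le> \<bar>n - m\<bar> * 1" using mn by (intro mult_left_mono) auto
    moreover have "\<bar>n - m\<bar> \<le> \<bar>norm y - norm x\<bar>" by (auto simp: m_def n_def min_def)
    moreover have "\<bar>norm y - norm x\<bar> \<le> norm (x - y)" by (metis norm_triangle_ineq3 norm_minus_commute)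
    ultimately show "dist (g x) (g y) \<le> 1 * dist x y"
      by (simp add: g_def dist_norm dist_real_def abs_minus_commute flip: m_def n_def)
  qed simp
  define \<nu> where "\<nu> = - p"
  have \<nu>: "norm \<nu> = 1" "\<nu> \<bullet> \<nu> = 1" using p by (auto simp: \<nu>_def dot_square_norm)
  have "ball 0 1 \<inter> ball p (1/2) = {y \<in> ball p (1/2). y \<bullet> \<nu> > g (y - (y \<bullet> \<nu>) *\<^sub>R \<nu>)}"
  proof -
    have "norm y < 1 \<longleftrightarrow> y \<bullet> \<nu> > g (y - (y \<bullet> \<nu>) *\<^sub>R \<nu>)" if y: "dist p y < 1/2" for y
    proof -
      define s where "s = y \<bullet> \<nu>"
      define y' where "y' = y - s *\<^sub>R \<nu>"
      have orth: "y' \<bullet> \<nu> = 0" by (simp add: y'_def inner_diff_left s_def \<nu>)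
      have pythagoras: "(norm (y' + t *\<^sub>R \<nu>))\<^sup>2 = (norm y')\<^sup>2 + t\<^sup>2" for t
        unfolding norm_squared_line orth \<nu>(1) by simp
      have yy: "(norm y)\<^sup>2 = (norm y')\<^sup>2 + s\<^sup>2"
        using pythagoras[of s] by (simp add: y'_def)
      have py: "y - p = y' + (s + 1) *\<^sub>R \<nu>" by (simp add: y'_def \<nu>_def algebra_simps)
      have "(norm (y - p))\<^sup>2 = (norm y')\<^sup>2 + (s + 1)\<^sup>2"
        unfolding py by (rule pythagoras)
      moreover have "(norm (y - p))\<^sup>2 < (1/2)\<^sup>2"
        using y by (intro power_strict_mono) (auto simp: dist_norm norm_minus_commute)
      ultimately have "(norm y')\<^sup>2 < (1/2)\<^sup>2" "(s + 1)\<^sup>2 < (1/2)\<^sup>2"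
        using zero_le_power2[of "s + 1"] zero_le_power2[of "norm y'"] by linarith+
      then have n: "norm y' < 1/2" and s: "\<bar>s + 1\<bar> < 1/2"
        using power2_less_imp_less[of "norm y'" "1/2"] power2_less_imp_less[of "\<bar>s + 1\<bar>" "1/2"] by auto
      then have s0: "s < 0" by linarith
      have g: "g y' = - sqrt (1 - (norm y')\<^sup>2)" using n by (simp add: g_def)
      have pos: "0 \<le> 1 - (norm y')\<^sup>2" using \<open>(norm y')\<^sup>2 < (1/2)\<^sup>2\<close> by (simp add: power2_eq_square)
      have "norm y < 1 \<longleftrightarrow> (norm y)\<^sup>2 < 1" by (simp add: abs_square_less_1)
      also have "\<dots> \<longleftrightarrow> (- s)\<^sup>2 < 1 - (norm y')\<^sup>2" unfolding yy by auto
      also have "\<dots> \<longleftrightarrow> - s < sqrt (1 - (norm y')\<^sup>2)"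
        using s0 by (metis less_eq_real_def neg_0_less_iff_less real_less_rsqrt real_sqrt_less_iff real_sqrt_unique)
      also have "\<dots> \<longleftrightarrow> s > g y'" unfolding g by auto
      finally show ?thesis unfolding s_def y'_def .
    qed
    then show ?thesis by auto
  qed
  with lip \<nu>(1) show "\<exists>r>0. \<exists>\<nu>. norm \<nu> = 1 \<and> (\<exists>g L. L-lipschitz_on UNIV g \<and>
      ball 0 1 \<inter> ball p r = {y \<in> ball p r. y \<bullet> \<nu> > g (y - (y \<bullet> \<nu>) *\<^sub>R \<nu>)})"
    by (intro exI[of _ "1/2"] conjI exI[of _ \<nu>] exI[of _ g] exI[of _ 1]) auto
qed auto

abbreviation second_variation_at :: "real \<Rightarrow> real \<Rightarrow> real \<Rightarrow> real^2^2 \<Rightarrow> real^2^2 \<Rightarrow> real" where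
  "second_variation_at \<alpha> \<beta> \<gamma> F X \<equiv> second_variation \<alpha> \<beta> \<gamma> (conformal_part F) (anticonformal_part F) (conformal_part X) (anticonformal_part X)"

text \<open>Quasiconvexity is applied to \<open>t f a\<close> and \<open>-t f a\<close>. The sum of the two inequalities has no terms of
  odd order in \<open>t\<close>; divide by \<open>t\<^sup>2\<close> and let \<open>t\<close> tend to zero.\<close>

lemma second_variation_nonneg_test_function:
  fixes Q :: "real^2^2 \<Rightarrow> real" and f :: "real^2 \<Rightarrow> real"
  assumes Q: "\<And>F. Q F = quartic \<alpha> \<beta> \<gamma> (conformal_part F) (anticonformal_part F)"
    and qc: "quasiconvex Q"
    and f: "elementary f" "\<And>x. x \<notin> cball 0 (1/2) \<Longrightarrow> f x = 0"
  shows "integrable (lebesgue_on (ball 0 1)) (\<lambda>x. second_variation_at \<alpha> \<beta> \<gamma> F (jacobian (\<lambda>x. f x *\<^sub>R a) (at x)))"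
    "0 \<le> (\<integral>x. second_variation_at \<alpha> \<beta> \<gamma> F (jacobian (\<lambda>x. f x *\<^sub>R a) (at x)) \<partial>lebesgue_on (ball 0 1))"
proof -
  let ?U = "ball (0::real^2) 1"
  let ?K = "cball (0::real^2) (1/2)"
  note lin = linear_parts[THEN linear_add] linear_parts[THEN linear_diff] linear_parts[THEN linear_scale]
  have U: "?U \<in> sets lebesgue" by simp
  obtain f' where f': "\<And>x. (f has_derivative f' x) (at x)" "\<And>h. elementary (\<lambda>x. f' x h)"
    using elementary_has_derivative[OF f(1)] by blast
  define J where "J x = jacobian (\<lambda>x. f x *\<^sub>R a) (at x)" for x
  have Jt: "jacobian (\<lambda>x. (t * f x) *\<^sub>R a) (at x) = t *\<^sub>R J x" for t x
  proof -
    have "((\<lambda>x. (t * f x) *\<^sub>R a) has_derivative (\<lambda>h. (t * f' x h) *\<^sub>R a)) (at x)" for t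
      by (intro has_derivative_scaleR_left has_derivative_mult_right f')
    then have "jacobian (\<lambda>x. (t * f x) *\<^sub>R a) (at x) $ i $ j = t * f' x (axis j 1) * a $ i" for t i j
      unfolding jacobian_component by (subst partial_derivative_eq) auto
    from this[of t] this[of 1] show ?thesis by (simp add: vec_eq_iff J_def)
  qed
  have test: "test_function ?U (\<lambda>x. (t * f x) *\<^sub>R a)" for t
    unfolding test_function_def
  proof (intro conjI exI[of _ ?K] allI impI)
    show "smooth (\<lambda>x. (t * f x) *\<^sub>R a)"
      by (rule elementary_smooth[OF elementary_mult[OF elementary_const f(1)]])
  qed (use f(2) in auto)
  have Jc: "continuous_on UNIV J"
    unfolding J_def[abs_def] by (rule continuous_on_jacobian[OF elementary_smooth[OF f(1)]])
  have J0: "J x = 0" if "x \<notin> ?K" for x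
    unfolding J_def by (rule jacobian_outside_support[OF compact_cball _ that]) (use f(2) in auto)
  have pc: "continuous_on UNIV (\<lambda>x. conformal_part (J x))" "continuous_on UNIV (\<lambda>x. anticonformal_part (J x))"
    by (rule linear_continuous_on_compose[OF Jc linear_parts(1)], rule linear_continuous_on_compose[OF Jc linear_parts(2)])
  have int: "integrable (lebesgue_on ?U) h" if "continuous_on UNIV h" "\<And>x. x \<notin> ?K \<Longrightarrow> h x = 0" for h :: "real^2 \<Rightarrow> real"
    by (rule compact_support_integrable(3)[OF that(1) compact_cball that(2) U])
  have Qc: "continuous_on UNIV (\<lambda>x. Q (F + t *\<^sub>R J x))" for t
    unfolding Q lin by (intro continuous_intros pc)
  have hi: "integrable (lebesgue_on ?U) (\<lambda>x. Q (F + t *\<^sub>R J x) - Q F)" for t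
  proof (rule int)
    show "continuous_on UNIV (\<lambda>x. Q (F + t *\<^sub>R J x) - Q F)" by (intro continuous_intros Qc)
  qed (simp add: J0)
  interpret U: finite_measure "lebesgue_on ?U"
    by (rule finite_measure_lebesgue_on) auto
  have const: "integrable (lebesgue_on ?U) (\<lambda>x. Q F)" "(\<integral>x. Q F \<partial>lebesgue_on ?U) = measure lebesgue ?U * Q F"
    by (simp_all add: measure_restrict_space)
  have nonneg: "0 \<le> (\<integral>x. Q (F + t *\<^sub>R J x) - Q F \<partial>lebesgue_on ?U)" for t
  proof -
    have "measure lebesgue ?U * Q F \<le> (\<integral>x. Q (F + t *\<^sub>R J x) \<partial>lebesgue_on ?U)"
      using qc[unfolded quasiconvex_def, THEN conjunct2, rule_format, OF bounded_lipschitz_domain_unit_ball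
          test_function_in_W_1_infinity_zero[OF test U, of t], of F]
      unfolding Jt .
    moreover have "(\<integral>x. Q (F + t *\<^sub>R J x) - Q F \<partial>lebesgue_on ?U) = (\<integral>x. Q (F + t *\<^sub>R J x) \<partial>lebesgue_on ?U) - measure lebesgue ?U * Q F"
      using Bochner_Integration.integral_diff[OF Bochner_Integration.integrable_add[OF hi const(1)] const(1), of t] const(2) by simp
    ultimately show ?thesis by simp
  qed
  have qi: "integrable (lebesgue_on ?U) (\<lambda>x. Q (J x))"
  proof (rule int)
    show "continuous_on UNIV (\<lambda>x. Q (J x))" unfolding Q by (intro continuous_intros pc)
  qed (simp add: Q J0 quartic_def linear_parts[THEN linear_0])
  have si: "integrable (lebesgue_on ?U) (\<lambda>x. second_variation_at \<alpha> \<beta> \<gamma> F (J x))"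
  proof (rule int)
    show "continuous_on UNIV (\<lambda>x. second_variation_at \<alpha> \<beta> \<gamma> F (J x))"
      unfolding second_variation_def by (intro continuous_intros pc)
  qed (simp add: second_variation_def J0 linear_parts[THEN linear_0])
  then show "integrable (lebesgue_on ?U) (\<lambda>x. second_variation_at \<alpha> \<beta> \<gamma> F (jacobian (\<lambda>x. f x *\<^sub>R a) (at x)))"
    unfolding J_def .
  have "0 \<le> (\<integral>x. second_variation_at \<alpha> \<beta> \<gamma> F (J x) \<partial>lebesgue_on ?U)"
  proof (rule nonneg_of_perturbation)
    fix t :: real assume "t > 0"
    have "0 \<le> (\<integral>x. Q (F + t *\<^sub>R J x) - Q F \<partial>lebesgue_on ?U) + (\<integral>x. Q (F + (-t) *\<^sub>R J x) - Q F \<partial>lebesgue_on ?U)"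
      using nonneg[of t] nonneg[of "-t"] by linarith
    also have "\<dots> = (\<integral>x. (Q (F + t *\<^sub>R J x) - Q F) + (Q (F + (-t) *\<^sub>R J x) - Q F) \<partial>lebesgue_on ?U)"
      by (rule Bochner_Integration.integral_add[OF hi hi, symmetric])
    also have "\<dots> = (\<integral>x. 2 * t\<^sup>2 * second_variation_at \<alpha> \<beta> \<gamma> F (J x) + 2 * t^4 * Q (J x) \<partial>lebesgue_on ?U)"
    proof (intro Bochner_Integration.integral_cong refl)
      fix x
      have "Q (F + t *\<^sub>R J x) + Q (F - t *\<^sub>R J x) = 2 * Q F + 2 * t\<^sup>2 * second_variation_at \<alpha> \<beta> \<gamma> F (J x) + 2 * t^4 * Q (J x)"
        unfolding Q lin by (rule quartic_symmetric_difference)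
      then show "(Q (F + t *\<^sub>R J x) - Q F) + (Q (F + (-t) *\<^sub>R J x) - Q F) = 2 * t\<^sup>2 * second_variation_at \<alpha> \<beta> \<gamma> F (J x) + 2 * t^4 * Q (J x)"
        by simp
    qed
    also have "\<dots> = 2 * t\<^sup>2 * (\<integral>x. second_variation_at \<alpha> \<beta> \<gamma> F (J x) \<partial>lebesgue_on ?U) + 2 * t^4 * (\<integral>x. Q (J x) \<partial>lebesgue_on ?U)"
      using si qi by simp
    finally show "0 \<le> t\<^sup>2 * (\<integral>x. second_variation_at \<alpha> \<beta> \<gamma> F (J x) \<partial>lebesgue_on ?U) + t^4 * (\<integral>x. Q (J x) \<partial>lebesgue_on ?U)"
      by simp
  qed
  then show "0 \<le> (\<integral>x. second_variation_at \<alpha> \<beta> \<gamma> F (jacobian (\<lambda>x. f x *\<^sub>R a) (at x)) \<partial>lebesgue_on ?U)"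
    unfolding J_def .
qed

text \<open>A quadratic form summed over an orthogonal rotation of a pair of arguments does not change; this is
  what cancels the cross terms between the oscillation and the derivative of the cutoff.\<close>

lemma second_variation_rotate:
  assumes "c\<^sup>2 + s\<^sup>2 = 1"
  shows "second_variation \<alpha> \<beta> \<gamma> z w (c *\<^sub>R \<zeta>1 + s *\<^sub>R \<zeta>2) (c *\<^sub>R \<omega>1 + s *\<^sub>R \<omega>2)
     + second_variation \<alpha> \<beta> \<gamma> z w (c *\<^sub>R \<zeta>2 - s *\<^sub>R \<zeta>1) (c *\<^sub>R \<omega>2 - s *\<^sub>R \<omega>1)
     = second_variation \<alpha> \<beta> \<gamma> z w \<zeta>1 \<omega>1 + second_variation \<alpha> \<beta> \<gamma> z w \<zeta>2 \<omega>2"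
proof -
  have n: "(norm (c *\<^sub>R u + s *\<^sub>R v))\<^sup>2 = c\<^sup>2 * (norm u)\<^sup>2 + 2 * c * s * (u \<bullet> v) + s\<^sup>2 * (norm v)\<^sup>2"
    "(norm (c *\<^sub>R v - s *\<^sub>R u))\<^sup>2 = c\<^sup>2 * (norm v)\<^sup>2 - 2 * c * s * (u \<bullet> v) + s\<^sup>2 * (norm u)\<^sup>2" for u v :: complex
    unfolding power2_norm_eq_inner inner_add_left inner_add_right inner_diff_left inner_diff_right inner_scaleR_left inner_scaleR_right
    unfolding inner_commute[of v u] by algebra+
  show ?thesis
    unfolding second_variation_def n inner_add_right inner_diff_right inner_scaleR_right
    using assms by algebra
qed

text \<open>In complex notation \<open>a \<otimes> b\<close> has the parts \<open>a cnj b / 2\<close> and \<open>a b / 2\<close>, so \<open>b\<close> is a unit vector whose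
  square has the phase of \<open>\<omega> / \<zeta>\<close>.\<close>

lemma rank_one_parts:
  fixes \<zeta> \<omega> :: complex
  assumes "norm \<zeta> = norm \<omega>"
  obtains a b :: "real^2" where "conformal_part (\<chi> i j. a$i * b$j) = \<zeta>" "anticonformal_part (\<chi> i j. a$i * b$j) = \<omega>"
proof -
  obtain u v :: complex where uv: "u * cnj v = 2 * \<zeta>" "u * v = 2 * \<omega>"
  proof (cases "\<zeta> = 0")
    case True
    then show ?thesis using assms that[of 0 0] by simp
  next
    case False
    define v where "v = cis ((Arg \<omega> - Arg \<zeta>) / 2)"
    have "v * v * \<zeta> = \<omega>"
    proof -
      have "v * v = cis (Arg \<omega> - Arg \<zeta>)" by (simp add: v_def cis_mult)
      moreover have "\<zeta> = of_real (norm \<zeta>) * cis (Arg \<zeta>)" "\<omega> = of_real (norm \<omega>) * cis (Arg \<omega>)"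
        using rcis_cmod_Arg[of \<zeta>] rcis_cmod_Arg[of \<omega>] by (simp_all add: rcis_def)
      ultimately show ?thesis using assms by (metis cis_mult diff_add_cancel mult.left_commute)
    qed
    moreover have "v * cnj v = 1" by (simp add: v_def cis_cnj cis_mult)
    ultimately show ?thesis using that[of "2 * \<zeta> * v" v] by (simp add: mult_ac)
  qed
  define a b :: "real^2" where "a = vector [Re u, Im u]" and "b = vector [Re v, Im v]"
  have "conformal_part (\<chi> i j. a$i * b$j) = u * cnj v / 2" "anticonformal_part (\<chi> i j. a$i * b$j) = u * v / 2"
    by (simp_all add: conformal_part_def anticonformal_part_def a_def b_def complex_eq_iff)
  with uv show ?thesis using that by simp
qed

lemma nonneg_if_quadratic_bound:
  fixes a b :: real
  assumes "\<And>N. 0 \<le> N\<^sup>2 * a + b"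
  shows "0 \<le> a"
proof (rule ccontr)
  assume "\<not> 0 \<le> a"
  then have a: "a < 0" by simp
  define N where "N = sqrt ((\<bar>b\<bar> + 1) / - a)"
  have "N\<^sup>2 = (\<bar>b\<bar> + 1) / - a" unfolding N_def using a by (intro real_sqrt_pow2 divide_nonneg_pos) auto
  then have "N\<^sup>2 * a = - (\<bar>b\<bar> + 1)" using a by simp
  with assms[of N] show False by linarith
qed

lemma cutoff_squared_integral_pos:
  fixes U :: "(real^'n) set"
  defines "U \<equiv> ball 0 1"
  shows "integrable (lebesgue_on U) (\<lambda>x. (cutoff 0 (1/4 - x \<bullet> x))\<^sup>2)"
    "0 < (\<integral>x. (cutoff 0 (1/4 - x \<bullet> x))\<^sup>2 \<partial>lebesgue_on U)"
proof -
  define f where "f x = (cutoff 0 (1/4 - x \<bullet> x))\<^sup>2" for x :: "real^'n"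
  define B where "B = ball (0::real^'n) (1/4)"
  define c where "c = (exp (- (16/3 :: real)))\<^sup>2"
  have U: "U \<in> sets lebesgue" by (simp add: U_def)
  have z: "f x = 0" if "x \<notin> cball 0 (1/2)" for x
    by (simp add: f_def cutoff_outside_ball[OF that])
  have "continuous_on UNIV (cutoff 0)"
    using cutoff_has_derivative DERIV_isCont by (intro continuous_at_imp_continuous_on) blast
  then have "continuous_on UNIV (\<lambda>x::real^'n. cutoff 0 (1/4 - x \<bullet> x))"
    by (rule continuous_on_compose2) (auto intro!: continuous_intros)
  then have "continuous_on UNIV f" unfolding f_def by (intro continuous_intros)
  from compact_support_integrable(3)[OF this compact_cball z U]
  have i: "integrable (lebesgue_on U) f" .
  then show "integrable (lebesgue_on U) (\<lambda>x. (cutoff 0 (1/4 - x \<bullet> x))\<^sup>2)" unfolding f_def .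
  have B: "B \<in> sets lebesgue" "B \<subseteq> U" by (auto simp: B_def U_def)
  interpret U: finite_measure "lebesgue_on U"
    by (rule finite_measure_lebesgue_on) (auto simp: U_def)
  have Bs: "B \<in> sets (lebesgue_on U)" using B U by (simp add: sets_restrict_space_iff)
  have "0 < c * measure lebesgue B" unfolding B_def by (simp add: c_def content_ball_pos)
  also have "\<dots> = (\<integral>x. c * indicator B x \<partial>lebesgue_on U)"
    using B U Bs by (simp add: measure_restrict_space Int_absorb2)
  also have "\<dots> \<le> (\<integral>x. f x \<partial>lebesgue_on U)"
  proof (rule integral_mono)
    show "integrable (lebesgue_on U) (\<lambda>x. c * indicator B x)"
      using Bs B(2) by (intro integrable_mult_right) (simp add: U.emeasure_finite less_top[symmetric] integrable_indicator_iff Int_absorb2)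
    fix x
    show "c * indicator B x \<le> f x"
    proof (cases "x \<in> B")
      case True
      then have "norm x < 1/4" by (simp add: B_def)
      then have "(norm x)\<^sup>2 < (1/4)\<^sup>2" by (intro power_strict_mono) auto
      then have t: "1/4 - x \<bullet> x > 3/16" by (simp add: power2_norm_eq_inner power_divide)
      then have "1 / (1/4 - x \<bullet> x) \<le> 1 / (3/16)" by (intro divide_left_mono) auto
      then have "exp (- (16/3)) \<le> cutoff 0 (1/4 - x \<bullet> x)" using t by (simp add: cutoff_def)
      then have "c \<le> f x" unfolding c_def f_def by (intro power_mono) auto
      then show ?thesis using True by simp
    qed (simp add: f_def)
  qed (rule i)
  finally show "0 < (\<integral>x. (cutoff 0 (1/4 - x \<bullet> x))\<^sup>2 \<partial>lebesgue_on U)" unfolding f_def .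
qed

text \<open>With \<open>k\<close> the cutoff, the gradients of \<open>k sin(N b \<bullet> x) a\<close> and \<open>k cos(N b \<bullet> x) a\<close> arise from
  \<open>N k a \<otimes> b\<close> and \<open>Y = a \<otimes> \<nabla>k\<close> by a rotation. The second variations add up to
  \<open>N\<^sup>2 k\<^sup>2\<close> times that of \<open>a \<otimes> b\<close> plus a term independent of \<open>N\<close>.\<close>

lemma quasiconvex_imp_second_variation_nonneg:
  fixes Q :: "real^2^2 \<Rightarrow> real"
  assumes Q: "\<And>F. Q F = quartic \<alpha> \<beta> \<gamma> (conformal_part F) (anticonformal_part F)"
    and qc: "quasiconvex Q" and n: "norm \<zeta> = norm \<omega>"
  shows "0 \<le> second_variation \<alpha> \<beta> \<gamma> z w \<zeta> \<omega>"
proof -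
  define U where "U = ball (0::real^2) 1"
  define F where "F = of_parts z w"
  obtain a b :: "real^2" where ab: "conformal_part (\<chi> i j. a$i * b$j) = \<zeta>" "anticonformal_part (\<chi> i j. a$i * b$j) = \<omega>"
    using rank_one_parts[OF n] by blast
  define M :: "real^2^2" where "M = (\<chi> i j. a$i * b$j)"
  define k where "k x = cutoff 0 (1/4 - x \<bullet> x)" for x :: "real^2"
  have k: "elementary k" unfolding k_def by (rule elementary_cutoff)
  have k0: "k x = 0" if "x \<notin> cball 0 (1/2)" for x
    unfolding k_def by (rule cutoff_outside_ball[OF that])
  obtain k' where k': "\<And>x. (k has_derivative k' x) (at x)"
    using elementary_has_derivative[OF k] by blast
  define Y :: "real^2 \<Rightarrow> real^2^2" where "Y x = (\<chi> i j. a$i * k' x (axis j 1))" for x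
  define S where "S X = second_variation_at \<alpha> \<beta> \<gamma> F X" for X
  note lin = linear_parts[THEN linear_add] linear_parts[THEN linear_diff] linear_parts[THEN linear_scale]
  have scale: "S (r *\<^sub>R X) = r\<^sup>2 * S X" for r X
    unfolding S_def lin second_variation_def by (simp add: power_mult_distrib algebra_simps) algebra
  define I where "I = (\<integral>x. (k x)\<^sup>2 \<partial>lebesgue_on U)"
  note I = cutoff_squared_integral_pos[where 'n=2, folded U_def k_def, folded I_def]
  have "0 \<le> N\<^sup>2 * (I * S M) + (\<integral>x. S (Y x) \<partial>lebesgue_on U)" for N
  proof -
    define f1 f2 where "f1 x = k x * sin ((N *\<^sub>R b) \<bullet> x)" and "f2 x = k x * cos ((N *\<^sub>R b) \<bullet> x)" for x
    define J1 J2 where "J1 x = jacobian (\<lambda>x. f1 x *\<^sub>R a) (at x)" and "J2 x = jacobian (\<lambda>x. f2 x *\<^sub>R a) (at x)" for x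
    have el: "elementary f1" "elementary f2"
      unfolding f1_def f2_def by (intro elementary_mult k elementary_sin elementary_cos)+
    have sup: "\<And>x. x \<notin> cball 0 (1/2) \<Longrightarrow> f1 x = 0" "\<And>x. x \<notin> cball 0 (1/2) \<Longrightarrow> f2 x = 0"
      unfolding f1_def f2_def by (simp_all add: k0 del: mem_cball)
    note sv1 = second_variation_nonneg_test_function[OF Q qc el(1) sup(1), of F a, folded J1_def U_def S_def]
    note sv2 = second_variation_nonneg_test_function[OF Q qc el(2) sup(2), of F a, folded J2_def U_def S_def]
    have eq: "S (J1 x) + S (J2 x) = (N\<^sup>2 * S M) * (k x)\<^sup>2 + S (Y x)" for x
    proof -
      define c s where "c = cos ((N *\<^sub>R b) \<bullet> x)" and "s = sin ((N *\<^sub>R b) \<bullet> x)"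
      have "((\<lambda>x. f1 x *\<^sub>R a) has_derivative (\<lambda>h. (k x * (c * ((N *\<^sub>R b) \<bullet> h)) + k' x h * s) *\<^sub>R a)) (at x)"
        unfolding f1_def c_def s_def
        by (intro has_derivative_scaleR_left has_derivative_mult k') (auto intro!: derivative_eq_intros)
      from partial_derivative_eq[OF this] have J1: "J1 x = c *\<^sub>R ((N * k x) *\<^sub>R M) + s *\<^sub>R Y x"
        unfolding J1_def vec_eq_iff jacobian_component
        by (simp add: M_def Y_def inner_axis algebra_simps)
      have "((\<lambda>x. f2 x *\<^sub>R a) has_derivative (\<lambda>h. (k x * (- s * ((N *\<^sub>R b) \<bullet> h)) + k' x h * c) *\<^sub>R a)) (at x)"
        unfolding f2_def c_def s_def
        by (intro has_derivative_scaleR_left has_derivative_mult k') (auto intro!: derivative_eq_intros)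
      from partial_derivative_eq[OF this] have J2: "J2 x = c *\<^sub>R Y x - s *\<^sub>R ((N * k x) *\<^sub>R M)"
        unfolding J2_def vec_eq_iff jacobian_component
        by (simp add: M_def Y_def inner_axis algebra_simps)
      have "c\<^sup>2 + s\<^sup>2 = 1" by (simp add: c_def s_def)
      then have "S (J1 x) + S (J2 x) = S ((N * k x) *\<^sub>R M) + S (Y x)"
        unfolding S_def J1 J2 lin by (rule second_variation_rotate)
      then show ?thesis unfolding scale by (simp add: power_mult_distrib mult_ac)
    qed
    have iY: "integrable (lebesgue_on U) (\<lambda>x. S (Y x))"
    proof -
      have "integrable (lebesgue_on U) (\<lambda>x. S (J1 x) + S (J2 x) - (N\<^sup>2 * S M) * (k x)\<^sup>2)"
        by (intro Bochner_Integration.integrable_diff Bochner_Integration.integrable_add integrable_mult_right sv1(1) sv2(1) I(1))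
      then show ?thesis unfolding eq by simp
    qed
    have "0 \<le> (\<integral>x. S (J1 x) \<partial>lebesgue_on U) + (\<integral>x. S (J2 x) \<partial>lebesgue_on U)"
      using sv1(2) sv2(2) by simp
    also have "\<dots> = (\<integral>x. S (J1 x) + S (J2 x) \<partial>lebesgue_on U)"
      by (rule Bochner_Integration.integral_add[OF sv1(1) sv2(1), symmetric])
    also have "\<dots> = (N\<^sup>2 * S M) * I + (\<integral>x. S (Y x) \<partial>lebesgue_on U)"
      unfolding eq I_def
      by (subst Bochner_Integration.integral_add[OF integrable_mult_right[OF I(1)] iY]) simp
    finally show ?thesis by (simp add: mult_ac)
  qed
  then have "0 \<le> I * S M" by (rule nonneg_if_quadratic_bound)
  then have "0 \<le> S M" using I(2) by (simp add: zero_le_mult_iff)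
  then show ?thesis by (simp add: S_def F_def M_def ab)
qed

theorem theorem2:
  fixes Q :: "real^2^2 \<Rightarrow> real"
  assumes "homogeneous_polynomial 4 Q"
    and "\<And>F U V. rotation_matrix U \<Longrightarrow> rotation_matrix V \<Longrightarrow> Q (U ** F ** transpose V) = Q F"
  shows "quasiconvex Q \<longleftrightarrow> rank_one_convex Q"
proof -
  obtain \<alpha> \<beta> \<gamma> where Q: "\<And>F. Q F = quartic \<alpha> \<beta> \<gamma> (conformal_part F) (anticonformal_part F)"
    using biinvariant_quartic[OF assms] by blast
  show ?thesis
  proof
    assume "quasiconvex Q"
    then show "rank_one_convex Q"
      unfolding rank_one_convex_quartic_iff[OF Q]
      using quasiconvex_imp_second_variation_nonneg[OF Q] by blast
  next
    assume "rank_one_convex Q"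
    then have sv: "0 \<le> second_variation \<alpha> \<beta> \<gamma> z w \<zeta> \<omega>" if "norm \<zeta> = norm \<omega>" for z w \<zeta> \<omega>
      unfolding rank_one_convex_quartic_iff[OF Q] using that by blast
    have "continuous_on UNIV Q"
      unfolding Q[abs_def]
      by (intro continuous_intros linear_continuous_on linear_parts[unfolded linear_conv_bounded_linear])
    moreover have "measure lebesgue U * Q F \<le> (\<integral>x. Q (F + G x) \<partial>lebesgue_on U)"
      if U: "bounded_lipschitz_domain U" and W: "W_1_infinity_zero U \<phi> G" for U F G and \<phi> :: "real^2 \<Rightarrow> real^2"
    proof -
      have "U \<in> sets lebesgue" "bounded U"
        using U unfolding bounded_lipschitz_domain_def by auto
      from quartic_quasiconvex_inequality[OF this W quartic_coefficient_conditions[OF sv]]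
      show ?thesis unfolding Q .
    qed
    ultimately show "quasiconvex Q" unfolding quasiconvex_def by blast
  qed
qed

end
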